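(* Let $M_\phi=SO(n+2)/SO(n)\times SO(2)$, with $n+2=2N$ or $n+2=2N+1$. The collective hamiltonians $F(\mathfrak{so}(n)\oplus\mathfrak{so}(2),\mathfrak{so}(n-2)\oplus\mathfrak{so}(2),\ldots)$ define a completely integrable model on $M_\phi$. The Nijenhuis tensor $N_\phi=\pi_0\circ\Omega_{kks}$ is of maximal rank and its eigenvalues are $$\lambda^{(k)}_\pm=\pm|a_k|-\sum_{j=1}^kb_j+1,\quad k=1,\ldots,N-1,\qquad\text{and}\qquad \lambda^{(N)}=1-\sum_{j=1}^Nb_j\ \text{ if } n+2=2N+1,$$ where $\pm i a_k$ are the eigenvalues (other than the remaining ones, which are zero) of the moment map $\mu_{\mathfrak{so}(n+2-2k)}$ for $\mathfrak{so}(n+2-2k)\subset\mathfrak g_k'$, and $b_k={\rm pf}(\mu_{\mathfrak{so}(2)})$ with $\mathfrak{so}(2)\subset\mathfrak g_k'$. The bihamiltonian polytope is described, in terms of the parameters $(a_k,b_k)$, as $\mathcal C(N_\phi)\subset\mathbb R^n$, where $(a_k,b_k)\in\mathcal C(N_\phi)$ if and only if $$0\le|a_k|\le|a_{k-1}|,\qquad |b_k|\le|a_{k-1}|-|a_k|,\qquad k=1,\ldots,N,$$ with $a_0=1$, $a_N=0$ and, if $n+2=2N$, $b_N=0$.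
   Context: **Setting.** $G=SO(n+2)$, $\mathfrak g=\mathfrak{so}(n+2)$ (real antisymmetric matrices; $\mathfrak g_{\mathbb C}$ is assumed simple). Let $\sigma=\begin{pmatrix}0&1\\-1&0\end{pmatrix}$, ${\rm pf}(b\sigma)=b$. The Cartan subalgebra is $\mathfrak t=\{{\rm diag}(t_1\sigma,\dots,t_N\sigma)\}$ if $n+2=2N$ and $\{{\rm diag}(0,t_1\sigma,\dots,t_N\sigma)\}$ if $n+2=2N+1$. With $\varepsilon_j$ taking the value $it_j$, the positive roots are $\varepsilon_i\pm\varepsilon_j$ for $i>j$ and, if $n+2$ is odd, also $\varepsilon_i$. $\phi=\alpha_1$ is the first simple root ($\varepsilon_N-\varepsilon_{N-1}$, or $\varepsilon_1$ if $N=1$); $H_\phi=SO(n)\times SO(2)$ is block diagonal with $SO(2)$ in the lowest right block, and $\rho_\phi={\rm diag}(0_n,\sigma)$. Identify $\mathfrak g^*\cong\mathfrak g$ by the trace form. $M_\phi=G/H_\phi$ is the adjoint orbit of $\rho_\phi$ via $\mu(gH_\phi)=g\rho_\phi g^{-1}$; put $\mu(X)={\rm Tr}(\mu X)$. The KKS Poisson bivector $\Omega^{-1}_{kks}$ is determined by $\{\mu(X),\mu(Y)\}_{kks}=\mu([X,Y])$. A bivector $\pi$ is viewed as a map $T^*M\to TM$ by $\langle\pi(\alpha),\beta\rangle=\langle\pi,\alpha\wedge\beta\rangle$, and $\Omega_{kks}:TM_\phi\to T^*M_\phi$ is the inverse of the map $\Omega_{kks}^{-1}$. **Bruhat-Poisson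 structure.** $J:\mathfrak g_{\mathbb C}\to\mathfrak g_{\mathbb C}$ is linear with $J|_{\mathfrak t}=0$, $J(E_\alpha)=\pm iE_\alpha$ for root vectors of positive/negative roots; $C_\pm=i\pm J$; $\mathfrak b_\pm=C_\pm(\mathfrak g)$. $\mathfrak g_{\mathbb C}=\mathfrak g\oplus\mathfrak b_-$ with projections ${\rm pr}_{\mathfrak g,-}$, ${\rm pr}_{\mathfrak b_-}$, and $\langle A,B\rangle={\rm Im}\,{\rm Tr}(AB)$. The standard Poisson-Lie structure $\pi_G$ is, for $\xi,\eta\in\mathfrak g\cong\mathfrak g^*$, $$\langle r_{g^{-1}}\pi_G(g),\xi\wedge\eta\rangle=\langle {\rm pr}_{\mathfrak g,-}({\rm Ad}_{g^{-1}}C_-(\xi)),\,{\rm pr}_{\mathfrak b_-}({\rm Ad}_{g^{-1}}C_-(\eta))\rangle ,$$ where $r_{g^{-1}}$ is right translation to the identity. $\pi_0$ is the unique Poisson structure on $M_\phi$ making $(G,\pi_G)\to (M_\phi,\pi_0)$ a Poisson map. **Chain and moment maps.** The chain is $\mathfrak{so}(2N+1)\supset\mathfrak{so}(2N-1)\oplus\mathfrak{so}(2)\supset\dots\supset\mathfrak{so}(3)\oplus\mathfrak{so}(2)\supset\mathfrak{so}(2)\supset0$, respectively $\mathfrak{so}(2N)\supset\mathfrak{so}(2N-2)\oplus\mathfrak{so}(2)\supset\dots\supset\mathfrak{so}(4)\oplus\mathfrak{so}(2)\supset\mathfrak{so}(2)\oplus\mathfrak{so}(2)\supset0$. Its $k$-th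 member is $\mathfrak g_k'=\mathfrak{so}(n+2-2k)\oplus\mathfrak{so}(2)\subset\mathfrak{so}(n+2-2(k-1))\subset\mathfrak g_{k-1}'$, embedded block diagonally with $\mathfrak{so}(2)$ in the lowest right block of $\mathfrak{so}(n+2-2(k-1))$ (which is itself the upper left block of $\mathfrak g$); the last one is $\mathfrak g_N'=\mathfrak{so}(2)$ for $n+2=2N+1$ and $\mathfrak g_{N-1}'=\mathfrak{so}(2)\oplus\mathfrak{so}(2)$ for $n+2=2N$. The moment maps $\mu_{\mathfrak{so}(n+2-2k)}$ and $\mu_{\mathfrak{so}(2)}$, $\mathfrak{so}(2)\subset\mathfrak g'_k$, are the corresponding diagonal blocks of the matrix $\mu$ (the upper left block of size $n+2-2k$ and the following $2\times2$ diagonal block). These upper left blocks have rank at most $2$, so their eigenvalues are $\pm ia_k$ with $a_k\in\mathbb R$ (determined up to sign) and zeros. **Collective hamiltonians.** For a chain of subalgebras $\mathfrak k_1\supset\dots\supset\mathfrak k_m$ of $\mathfrak g$, $F(\mathfrak k_1,\dots,\mathfrak k_m)\subset C^\infty(M_\phi)$ is the algebra generated by the coadjoint-invariant functions on each $\mathfrak k_i^*$ pulled back to $M_\phi$ by $M_\phi\to\mathfrak g^*\to\mathfrak k_i^*$. It is Poisson commutative for the KKS bracket; it defines a completely integrable model if it contains $\frac12\dim M_\phi$ functions that are functionally independent on a dense open subset. Here the chain is $\mathfrak g_1'\supset\mathfrak g_2'\supset\cdots$. **Rank and polytope.** Each eigenspace of $N_\phi$ has dimension at least $2$, so $N_\phi$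 has at most $\frac12\dim M_\phi$ distinct eigenvalues at each point; $N_\phi$ is of maximal rank if it has exactly $\frac12\dim M_\phi=n$ distinct eigenvalues on a dense open set. The bihamiltonian polytope $\mathcal C(N_\phi)$ is the image of the map sending a point of $M_\phi$ to the list of eigenvalues of $N_\phi$; the description by $(a_k,b_k)$ means that a point of $\mathbb R^n$ belongs to it iff it is the list $(\lambda_\pm^{(k)})$ (and $\lambda^{(N)}$ if $n+2=2N+1$) given by the formulas of the claim for some real $(a_k,b_k)$ satisfying the inequalities. *)

theory Defs
  imports "HOL-Analysis.Analysis"
begin

type_synonym 'n rmat = "real^'n^'n"
type_synonym 'n cmat = "complex^'n^'n"

text \<open>
  The size \<open>n + 2\<close> of the matrices is \<open>CARD('n)\<close>. A linear order on the index type
  makes it possible to speak of block diagonal matrices; \<open>pos i \<in> {0..<CARD('n)}\<close> is the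
  (zero-based) number of the row or column \<open>i\<close>.
\<close>

definition pos :: "'n::{finite,linorder} \<Rightarrow> nat" where
  "pos i = card {j. j < i}"

definition idx :: "nat \<Rightarrow> 'n::{finite,linorder}" where
  "idx q = (THE i. pos i = q)"

definition cplx :: "'n::finite rmat \<Rightarrow> 'n cmat" where
  "cplx A = (\<chi> i j. complex_of_real (A $ i $ j))"

definition cscale :: "complex \<Rightarrow> 'n::finite cmat \<Rightarrow> 'n cmat" where
  "cscale z A = (\<chi> i j. z * A $ i $ j)"

definition lie :: "'a::ring_1^'n^'n \<Rightarrow> 'a^'n^'n \<Rightarrow> 'a^'n^'n" where
  "lie X Y = X ** Y - Y ** X"

text \<open>At type \<^typ>\<open>real\<close> this is the Lie algebra \<open>so(n+2)\<close>, at type \<^typ>\<open>complex\<close> its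
  complexification.\<close>

definition so :: "('a::ring_1^'n^'n) set" where
  "so = {A. transpose A = - A}"

definition complex_ideal :: "'n::finite cmat set \<Rightarrow> 'n cmat set \<Rightarrow> bool" where
  "complex_ideal I g \<longleftrightarrow> I \<subseteq> g \<and> 0 \<in> I \<and> (\<forall>X\<in>I. \<forall>Y\<in>I. X + Y \<in> I) \<and>
     (\<forall>z. \<forall>X\<in>I. cscale z X \<in> I) \<and> (\<forall>X\<in>g. \<forall>Y\<in>I. lie X Y \<in> I)"

definition simple_lie :: "'n::finite cmat set \<Rightarrow> bool" where
  "simple_lie g \<longleftrightarrow> (\<exists>X\<in>g. \<exists>Y\<in>g. lie X Y \<noteq> 0) \<and>
     (\<forall>I. complex_ideal I g \<longrightarrow> I = {0} \<or> I = g)"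

text \<open>The matrix with the block \<open>((0, 1), (-1, 0))\<close> in the rows and columns number
  \<open>q, q+1\<close> and zeros elsewhere.\<close>

definition sigma_at :: "nat \<Rightarrow> 'a::ring_1^'n::{finite,linorder}^'n::{finite,linorder}" where
  "sigma_at q = (\<chi> i j. if pos i = q \<and> pos j = q + 1 then 1
                         else if pos i = q + 1 \<and> pos j = q then - 1 else 0)"

definition rho_phi :: "'n::{finite,linorder} rmat" where
  "rho_phi = sigma_at (CARD('n) - 2)"


subsection \<open>The orbit, its tangent and cotangent spaces, the KKS bivector\<close>

text \<open>The group \<open>SO(n+2)\<close> is the set of \<^const>\<open>rotation_matrix\<close> matrices, for which the
  inverse is the transpose.\<close>

definition orb :: "'n::{finite,linorder} rmat \<Rightarrow> 'n rmat" where
  "orb g = g ** rho_phi ** transpose g"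

definition M_phi :: "'n::{finite,linorder} rmat set" where
  "M_phi = orb ` {g. rotation_matrix g}"

definition tangent :: "'n::finite rmat \<Rightarrow> 'n rmat set" where
  "tangent p = {lie X p | X. X \<in> so}"

text \<open>
  A covector at \<open>p\<close> is given by a linear functional on the space of all matrices, of which
  only the restriction to \<open>tangent p\<close> matters. A bivector \<open>P\<close> at \<open>p\<close> is given by its values
  \<open>P \<alpha> \<beta> = \<langle>P, \<alpha> \<and> \<beta>\<rangle>\<close> on covectors.

  \<open>kks p \<alpha> \<beta>\<close> is determined by \<open>{\<mu>(X), \<mu>(Y)} = \<mu>([X, Y])\<close>, where \<open>\<mu>(X) = Tr(\<mu> X)\<close>: the
  differentials of the functions \<open>\<mu>(X)\<close> exhaust the covectors at each point.
\<close>

definition kks ::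
  "'n::finite rmat \<Rightarrow> ('n rmat \<Rightarrow> real) \<Rightarrow> ('n rmat \<Rightarrow> real) \<Rightarrow> real" where
  "kks p \<alpha> \<beta> = (THE c. \<forall>X\<in>so. \<forall>Y\<in>so.
      (\<forall>v\<in>tangent p. \<alpha> v = trace (v ** X)) \<longrightarrow> (\<forall>v\<in>tangent p. \<beta> v = trace (v ** Y)) \<longrightarrow>
      c = trace (p ** lie X Y))"

definition sharp ::
  "(('n::finite rmat \<Rightarrow> real) \<Rightarrow> ('n rmat \<Rightarrow> real) \<Rightarrow> real) \<Rightarrow> 'n rmat \<Rightarrow> ('n rmat \<Rightarrow> real) \<Rightarrow> 'n rmat"
  where
  "sharp P p \<alpha> = (THE v. v \<in> tangent p \<and> (\<forall>\<beta>. linear \<beta> \<longrightarrow> \<beta> v = P \<alpha> \<beta>))"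

text \<open>The inverse of \<open>sharp (kks p) p\<close>; the choice concerns only the extension of the covector
  from \<open>tangent p\<close> to all matrices.\<close>

definition Omega_kks :: "'n::finite rmat \<Rightarrow> 'n rmat \<Rightarrow> ('n rmat \<Rightarrow> real)" where
  "Omega_kks p v = (SOME \<alpha>. linear \<alpha> \<and> sharp (kks p) p \<alpha> = v)"


subsection \<open>The standard Poisson-Lie structure and the Bruhat-Poisson structure\<close>

text \<open>With \<open>N = CARD('n) div 2\<close>, \<open>cartan t\<close> is \<open>diag(t\<^sub>1\<sigma>, \<dots>, t\<^sub>N\<sigma>)\<close>, preceded by a
  zero if \<open>CARD('n)\<close> is odd. Complex parameters give the complexified Cartan subalgebra.\<close>

definition cartan :: "(nat \<Rightarrow> complex) \<Rightarrow> 'n::{finite,linorder} cmat" where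
  "cartan t = (\<Sum>j=1..CARD('n) div 2. cscale (t j) (sigma_at (CARD('n) mod 2 + 2 * (j - 1))))"

definition eps :: "nat \<Rightarrow> (nat \<Rightarrow> complex) \<Rightarrow> complex" where
  "eps j t = \<i> * t j"

text \<open>The positive roots for matrices of size \<open>d\<close>, as functions of the parameters of
  \<^const>\<open>cartan\<close>.\<close>

definition pos_roots :: "nat \<Rightarrow> ((nat \<Rightarrow> complex) \<Rightarrow> complex) set" where
  "pos_roots d =
     {\<lambda>t. eps i t + eps j t | i j. 1 \<le> j \<and> j < i \<and> i \<le> d div 2} \<union>
     {\<lambda>t. eps i t - eps j t | i j. 1 \<le> j \<and> j < i \<and> i \<le> d div 2} \<union>
     (if odd d then {eps i | i. 1 \<le> i \<and> i \<le> d div 2} else {})"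

definition root_space ::
  "((nat \<Rightarrow> complex) \<Rightarrow> complex) \<Rightarrow> 'n::{finite,linorder} cmat set" where
  "root_space \<alpha> = {E \<in> so. \<forall>t. lie (cartan t) E = cscale (\<alpha> t) E}"

text \<open>Root spaces are closed under complex scalars, so the real spans below are complex
  subspaces.\<close>

definition nil_plus :: "'n::{finite,linorder} cmat set" where
  "nil_plus = span (\<Union>\<alpha>\<in>pos_roots CARD('n). root_space \<alpha>)"

definition nil_minus :: "'n::{finite,linorder} cmat set" where
  "nil_minus = span (\<Union>\<alpha>\<in>pos_roots CARD('n). root_space (\<lambda>t. - \<alpha> t))"

text \<open>The linear map that is \<open>0\<close> on the Cartan subalgebra, \<open>i\<close> on positive and \<open>-i\<close> on
  negative root vectors.\<close>

definition J :: "'n::{finite,linorder} cmat \<Rightarrow> 'n cmat" where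
  "J X = (THE Y. \<exists>h\<in>range cartan. \<exists>u\<in>nil_plus. \<exists>v\<in>nil_minus.
            X = h + u + v \<and> Y = cscale \<i> u - cscale \<i> v)"

definition C_minus :: "'n::{finite,linorder} rmat \<Rightarrow> 'n cmat" where
  "C_minus X = cscale \<i> (cplx X) - J (cplx X)"

definition b_minus :: "'n::{finite,linorder} cmat set" where
  "b_minus = C_minus ` so"

definition pr_g :: "'n::{finite,linorder} cmat \<Rightarrow> 'n cmat" where
  "pr_g Z = (THE A. A \<in> cplx ` so \<and> Z - A \<in> b_minus)"

definition pr_b :: "'n::{finite,linorder} cmat \<Rightarrow> 'n cmat" where
  "pr_b Z = (THE B. B \<in> b_minus \<and> Z - B \<in> cplx ` so)"

definition Ad_inv :: "'n::{finite,linorder} rmat \<Rightarrow> 'n cmat \<Rightarrow> 'n cmat" where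
  "Ad_inv g Z = cplx (transpose g) ** Z ** cplx g"

text \<open>\<open>pi_G g \<xi> \<eta>\<close> is the value of \<open>\<pi>\<^sub>G(g)\<close>, right translated to the identity, on \<open>\<xi> \<and> \<eta>\<close>.\<close>

definition pi_G ::
  "'n::{finite,linorder} rmat \<Rightarrow> 'n rmat \<Rightarrow> 'n rmat \<Rightarrow> real" where
  "pi_G g \<xi> \<eta> = Im (trace (pr_g (Ad_inv g (C_minus \<xi>)) ** pr_b (Ad_inv g (C_minus \<eta>))))"

text \<open>The element of \<open>so(n+2)\<close> that represents a functional via the trace form.\<close>

definition trace_dual :: "('n::finite rmat \<Rightarrow> real) \<Rightarrow> 'n rmat" where
  "trace_dual f = (THE \<xi>. \<xi> \<in> so \<and> (\<forall>X\<in>so. trace (\<xi> ** X) = f X))"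

text \<open>
  The differential of \<^const>\<open>orb\<close> at \<open>g\<close> maps the right translate \<open>X g\<close> of \<open>X \<in> so(n+2)\<close> to
  \<open>lie X (orb g)\<close>. Hence \<open>pull_back (orb g) \<alpha>\<close> is the pull-back of the covector \<open>\<alpha>\<close>,
  right translated to the identity, and the condition in \<open>pi_0\<close> says that \<^const>\<open>orb\<close> is
  a Poisson map from \<open>\<pi>\<^sub>G\<close> to \<open>\<pi>\<^sub>0\<close>.
\<close>

definition pull_back :: "'n::finite rmat \<Rightarrow> ('n rmat \<Rightarrow> real) \<Rightarrow> 'n rmat" where
  "pull_back p \<alpha> = trace_dual (\<lambda>X. \<alpha> (lie X p))"

definition pi_0 ::
  "'n::{finite,linorder} rmat \<Rightarrow> ('n rmat \<Rightarrow> real) \<Rightarrow> ('n rmat \<Rightarrow> real) \<Rightarrow> real" where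
  "pi_0 p \<alpha> \<beta> = (THE c. \<forall>g. rotation_matrix g \<and> orb g = p \<longrightarrow>
                        c = pi_G g (pull_back p \<alpha>) (pull_back p \<beta>))"


subsection \<open>The Nijenhuis tensor and its eigenvalues\<close>

definition N_phi :: "'n::{finite,linorder} rmat \<Rightarrow> 'n rmat \<Rightarrow> 'n rmat" where
  "N_phi p v = sharp (pi_0 p) p (Omega_kks p v)"

definition N_eigenvalues :: "'n::{finite,linorder} rmat \<Rightarrow> real set" where
  "N_eigenvalues p = {x. \<exists>v\<in>tangent p. v \<noteq> 0 \<and> N_phi p v = x *\<^sub>R v}"

definition N_gen_eigenspace :: "'n::{finite,linorder} rmat \<Rightarrow> real \<Rightarrow> 'n rmat set" where
  "N_gen_eigenspace p x =
     {v \<in> tangent p. \<exists>k. ((\<lambda>u. N_phi p u - x *\<^sub>R u) ^^ k) v = 0}"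

text \<open>
  The list of eigenvalues of \<open>N_phi\<close> at \<open>p\<close>, a point of \<open>\<real>\<^sup>n\<close>, in decreasing order. Each
  eigenvalue is repeated half its algebraic multiplicity many times (multiplicities are even).
  The multiplicity has to be the algebraic one: \<open>N_phi\<close> fails to be diagonalizable at some
  points outside the dense subset where it has \<open>n\<close> distinct eigenvalues.
\<close>

definition N_eigenvalue_list :: "'n::{finite,linorder} rmat \<Rightarrow> real list \<Rightarrow> bool" where
  "N_eigenvalue_list p L \<longleftrightarrow> length L = dim (tangent p) div 2 \<and> sorted_wrt (\<ge>) L \<and>
     (\<forall>x. dim (N_gen_eigenspace p x) = 2 * count_list L x)"

definition dense_open_in :: "'a::topological_space set \<Rightarrow> 'a set \<Rightarrow> bool" where
  "dense_open_in M U \<longleftrightarrow> openin (top_of_set M) U \<and> M \<subseteq> closure U"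

definition N_maximal_rank :: "'n::{finite,linorder} itself \<Rightarrow> bool" where
  "N_maximal_rank TYPE('n) \<longleftrightarrow> (\<exists>U. dense_open_in (M_phi :: 'n rmat set) U \<and>
     (\<forall>p\<in>U. card (N_eigenvalues p) = dim (tangent p) div 2))"

definition bihamiltonian_polytope :: "'n::{finite,linorder} itself \<Rightarrow> real list set" where
  "bihamiltonian_polytope TYPE('n) = {L. \<exists>p\<in>(M_phi :: 'n rmat set). N_eigenvalue_list p L}"


subsection \<open>Collective hamiltonians\<close>

text \<open>\<open>g_sub k\<close> is the subalgebra \<open>so(n+2-2k) \<oplus> so(2)\<close> of \<open>so(n+2)\<close>, for
  \<open>1 \<le> k\<close> and \<open>2 k \<le> n + 2\<close>.\<close>

definition g_sub :: "nat \<Rightarrow> 'n::{finite,linorder} rmat set" where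
  "g_sub k = (let m = CARD('n) - 2 * k in
     {X \<in> so. \<forall>i j. X $ i $ j \<noteq> 0 \<longrightarrow>
        (pos i < m \<and> pos j < m) \<or> (pos i \<in> {m, m + 1} \<and> pos j \<in> {m, m + 1})})"

definition so_chain :: "'n::{finite,linorder} rmat set set" where
  "so_chain = g_sub ` {1..(if even CARD('n) then CARD('n) div 2 - 1 else CARD('n) div 2)}"

text \<open>A function is smooth if it belongs to a class of differentiable functions that is closed
  under directional derivatives.\<close>

definition smooth :: "('a::real_normed_vector \<Rightarrow> real) \<Rightarrow> bool" where
  "smooth f \<longleftrightarrow> (\<exists>S. f \<in> S \<and> (\<forall>h\<in>S. (\<forall>x. h differentiable (at x)) \<and>
     (\<forall>v. (\<lambda>x. frechet_derivative h (at x) v) \<in> S)))"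

text \<open>The restriction of functionals from \<open>so(n+2)\<close> to a subalgebra \<open>k\<close>, in terms of the
  trace forms.\<close>

definition trace_proj :: "'n::finite rmat set \<Rightarrow> 'n rmat \<Rightarrow> 'n rmat" where
  "trace_proj k x = (THE y. y \<in> k \<and> (\<forall>z\<in>k. trace (y ** z) = trace (x ** z)))"

text \<open>Invariance of (the restriction of) \<open>h\<close> under the coadjoint action of \<open>k\<close> on
  \<open>k\<^sup>* \<cong> k\<close>.\<close>

definition coadjoint_invariant :: "'n::finite rmat set \<Rightarrow> ('n rmat \<Rightarrow> real) \<Rightarrow> bool" where
  "coadjoint_invariant k h \<longleftrightarrow> (\<forall>x\<in>k. \<forall>y\<in>k. frechet_derivative h (at x) (lie y x) = 0)"

text \<open>Functions on \<^const>\<open>M_phi\<close> are given by functions on the ambient space of matrices. The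
  elements of the algebra below are smooth there, so that their differentials on
  \<^const>\<open>M_phi\<close> are the restrictions of the Frechet derivatives to the tangent spaces.\<close>

inductive_set collective :: "'n::finite rmat set set \<Rightarrow> ('n rmat \<Rightarrow> real) set"
  for K :: "'n::finite rmat set set" where
  gen: "k \<in> K \<Longrightarrow> smooth h \<Longrightarrow> coadjoint_invariant k h \<Longrightarrow>
          (\<lambda>x. h (trace_proj k x)) \<in> collective K"
| const: "(\<lambda>x. c) \<in> collective K"
| add: "f \<in> collective K \<Longrightarrow> h \<in> collective K \<Longrightarrow> (\<lambda>x. f x + h x) \<in> collective K"
| mult: "f \<in> collective K \<Longrightarrow> h \<in> collective K \<Longrightarrow> (\<lambda>x. f x * h x) \<in> collective K"

definition functionally_independent_at ::
  "'n::finite rmat \<Rightarrow> nat \<Rightarrow> (nat \<Rightarrow> 'n rmat \<Rightarrow> real) \<Rightarrow> bool" where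
  "functionally_independent_at p m f \<longleftrightarrow>
     (\<forall>c :: nat \<Rightarrow> real.
        (\<forall>v\<in>tangent p. (\<Sum>i<m. c i * frechet_derivative (f i) (at p) v) = 0) \<longrightarrow>
        (\<forall>i<m. c i = 0))"

definition completely_integrable ::
  "('n::{finite,linorder} rmat \<Rightarrow> real) set \<Rightarrow> bool" where
  "completely_integrable F \<longleftrightarrow>
     (\<forall>f\<in>F. \<forall>h\<in>F. \<forall>p\<in>M_phi.
        kks p (frechet_derivative f (at p)) (frechet_derivative h (at p)) = 0) \<and>
     (\<exists>f U. (\<forall>i < dim (tangent (rho_phi :: 'n rmat)) div 2. f i \<in> F) \<and>
        dense_open_in M_phi U \<and>
        (\<forall>p\<in>U. functionally_independent_at p (dim (tangent (rho_phi :: 'n rmat)) div 2) f))"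


subsection \<open>The parameters of the polytope\<close>

text \<open>The eigenvalues of the upper left block of size \<open>m\<close>; vectors of length \<open>m\<close> are
  vectors supported in the first \<open>m\<close> coordinates.\<close>

definition block_eigenvalues :: "nat \<Rightarrow> 'n::{finite,linorder} rmat \<Rightarrow> complex set" where
  "block_eigenvalues m A = {z. \<exists>v. v \<noteq> 0 \<and> (\<forall>i. m \<le> pos i \<longrightarrow> v $ i = 0) \<and>
     (\<forall>i. pos i < m \<longrightarrow> (cplx A *v v) $ i = z * v $ i)}"

text \<open>\<open>\<plusminus>i a\<close> are the eigenvalues of the upper left block of size \<open>m\<close>, the remaining ones
  being zero.\<close>

definition block_param :: "nat \<Rightarrow> 'n::{finite,linorder} rmat \<Rightarrow> real \<Rightarrow> bool" where
  "block_param m A a \<longleftrightarrow>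
     {\<i> * of_real a, - (\<i> * of_real a)} \<subseteq> block_eigenvalues m A \<and>
     block_eigenvalues m A \<subseteq> {\<i> * of_real a, - (\<i> * of_real a), 0}"

text \<open>The Pfaffian \<open>b\<close> of the diagonal block \<open>b\<sigma>\<close> in the rows and columns number \<open>q, q+1\<close>.\<close>

definition block_pf :: "nat \<Rightarrow> 'n::{finite,linorder} rmat \<Rightarrow> real" where
  "block_pf q A = A $ idx q $ idx (q + 1)"

definition lam_plus :: "(nat \<Rightarrow> real) \<Rightarrow> (nat \<Rightarrow> real) \<Rightarrow> nat \<Rightarrow> real" where
  "lam_plus a b k = \<bar>a k\<bar> - (\<Sum>j=1..k. b j) + 1"

definition lam_minus :: "(nat \<Rightarrow> real) \<Rightarrow> (nat \<Rightarrow> real) \<Rightarrow> nat \<Rightarrow> real" where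
  "lam_minus a b k = - \<bar>a k\<bar> - (\<Sum>j=1..k. b j) + 1"

definition lam_last :: "(nat \<Rightarrow> real) \<Rightarrow> nat \<Rightarrow> real" where
  "lam_last b N = 1 - (\<Sum>j=1..N. b j)"

text \<open>The inequalities for \<open>(a\<^sub>k, b\<^sub>k)\<close> put the eigenvalues in this order:
  \<open>\<lambda>\<^sub>+\<close> with \<open>k = 1, \<dots>, N-1\<close>, then the last eigenvalue if \<open>n\<close> is odd, then \<open>\<lambda>\<^sub>-\<close> with
  \<open>k = N-1, \<dots>, 1\<close>.\<close>

definition lam_list :: "nat \<Rightarrow> nat \<Rightarrow> (nat \<Rightarrow> real) \<Rightarrow> (nat \<Rightarrow> real) \<Rightarrow> real list" where
  "lam_list n N a b = map (lam_plus a b) [1..<N] @ (if n + 2 = 2 * N + 1 then [lam_last b N] else [])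
     @ map (lam_minus a b) (rev [1..<N])"

end

theory Submission
  imports Defs
begin

text \<open>
  On the tangent space \<open>T\<close> at \<open>p\<close>, the operator \<open>ad p\<close> is a complex structure and \<open>N\<^sub>\<phi> v = v + [p, J v]\<close>.
  The points of the orbit are the real antisymmetric matrices of norm \<open>\<surd>2\<close> that satisfy the Pluecker
  relations. Together with the polarized relations for tangent vectors, these give
  \<open>d(a\<^sup>2) \<circ> N\<^sub>\<phi> = (1 - s) d(a\<^sup>2) - 2 a\<^sup>2 ds\<close> and \<open>ds \<circ> N\<^sub>\<phi> = (1 - s) ds - d(a\<^sup>2) / 2\<close>, where \<open>a = a\<^sub>k\<close> and
  \<open>s = b\<^sub>1 + \<dots> + b\<^sub>k\<close>. Hence \<open>d(s \<mp> a)\<close> is an eigencovector with eigenvalue \<open>1 \<plusminus> a - s\<close>. Since \<open>N\<^sub>\<phi>\<close> is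
  self-adjoint for the symplectic form, its eigenspaces have even dimension; at generic points
  this accounts for all of \<open>T\<close>. The algebraic multiplicities at the remaining points follow by
  semicontinuity, because generic points are dense: two points \<open>x \<and> y\<close> and \<open>x' \<and> y'\<close> are joined by a
  curve that is polynomial up to normalization.
\<close>

subsection \<open>Blocks of indices\<close>

text \<open>The formula for \<open>N_phi\<close> rests on a grading: tangent vectors at
  \<open>rho_phi\<close> live between the top block and the lower ones, where \<open>Jb\<close> is
  ad \<open>rho_phi\<close>. After conjugation by g the Poisson-Lie bivector becomes ad p -
  \<open>Jb\<close>, which depends on g only through p. Both differential formulas come from one
  contraction: summing a polarized Pluecker relation against sigma over the blocks above c reduces
  the part of [p, J v] that leaves the upper left corner to multiples of p and v. For d(a^2)
  antisymmetry of J v kills the remainder; for ds a downward induction telescopes. The discriminant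
  \<open>disc\<close> of an off-diagonal block measures strictness of the interlacing inequality. It
  governs distinctness of the eigenvalues and nonvanishing of the eigencovectors alike, so one
  genericity condition serves maximal rank and functional independence. Tangent spaces vary with p.
  To pass to limits, kernels of products of N - x on them are written as kernels of maps on the full
  matrix space; the total dimension then turns lower bounds into equalities. For even size block 0
  is empty and the innermost Pfaffian is plus or minus a_{N-1}, whereas the statement sets b_N =
  0.\<close>

text \<open>Blocks are numbered like the parameters of \<^const>\<open>cartan\<close>; if the size is odd, block \<open>0\<close>
  consists of the first index only. \<open>pr i\<close> is the other index in the block of \<open>i\<close>, and \<open>sg i\<close> is the entry
  of \<open>diag(\<sigma>, \<dots>, \<sigma>)\<close> at \<open>(i, pr i)\<close>.\<close>

definition blk :: "'n::{finite,linorder} \<Rightarrow> nat" where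
  "blk i = (pos i + 2 - CARD('n) mod 2) div 2"

definition pr :: "'n::{finite,linorder} \<Rightarrow> 'n" where
  "pr i = (if blk i = 0 then i
     else if even (pos i + CARD('n)) then idx (pos i + 1) else idx (pos i - 1))"

definition sg :: "'n::{finite,linorder} \<Rightarrow> 'a::ring_1" where
  "sg i = (if blk i = 0 then 0 else if even (pos i + CARD('n)) then 1 else - 1)"

lemma pos_less: "pos (i::'n::{finite,linorder}) < CARD('n)"
  unfolding pos_def by (rule psubset_card_mono) auto

lemma pos_strict_mono: "i < j \<Longrightarrow> pos (i::'n::{finite,linorder}) < pos j"
  unfolding pos_def by (rule psubset_card_mono) auto

lemma pos_inject [simp]: "pos (i::'n::{finite,linorder}) = pos j \<longleftrightarrow> i = j"
  by (metis neq_iff pos_strict_mono)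

lemma pos_idx:
  assumes "q < CARD('n)"
  shows "pos (idx q :: 'n::{finite,linorder}) = q"
proof -
  have "inj (pos :: 'n \<Rightarrow> nat)" by (auto simp: inj_def)
  then have "card (range (pos :: 'n \<Rightarrow> nat)) = CARD('n)"
    by (simp add: card_image)
  moreover have "range (pos :: 'n \<Rightarrow> nat) \<subseteq> {..<CARD('n)}" using pos_less by auto
  ultimately have "range (pos :: 'n \<Rightarrow> nat) = {..<CARD('n)}"
    by (simp add: card_subset_eq)
  then obtain i :: 'n where "pos i = q" using assms by (metis imageE lessThan_iff)
  then show ?thesis unfolding idx_def by (metis (mono_tags, lifting) pos_inject theI)
qed

lemma idx_pos [simp]: "idx (pos i) = (i::'n::{finite,linorder})"
  by (metis pos_idx pos_inject pos_less)

lemma pos_pr: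
  "pos (pr i) = (if blk (i::'n::{finite,linorder}) = 0 then pos i
     else if even (pos i + CARD('n)) then pos i + 1 else pos i - 1)"
proof -
  have "pos i + 1 < CARD('n)" if "even (pos i + CARD('n))"
    using pos_less[of i] that by (metis Suc_eq_plus1 Suc_lessI even_Suc odd_add)
  then show ?thesis using pos_less[of i] unfolding pr_def by (auto simp: pos_idx)
qed

lemma blk_even: "even CARD('n) \<Longrightarrow> blk (i::'n::{finite,linorder}) = pos i div 2 + 1"
  unfolding blk_def by (simp add: even_iff_mod_2_eq_zero)

lemma blk_odd: "odd CARD('n) \<Longrightarrow> blk (i::'n::{finite,linorder}) = (pos i + 1) div 2"
  unfolding blk_def by (simp add: odd_iff_mod_2_eq_one)

lemma blk_pr [simp]: "blk (pr i) = blk (i::'n::{finite,linorder})"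
proof (cases "even (CARD('n))")
  case True
  have "(if even q then q + 1 else q - 1) div 2 = q div 2" for q :: nat
    by (cases "even q") (auto elim!: evenE oddE)
  with True show ?thesis
    using pos_pr[of i] unfolding blk_even[OF True] by (auto split: if_splits)
next
  case False
  have "((if even q then q - 1 else q + 1) + 1) div 2 = (q + 1) div 2" if "q > 0" for q :: nat
    using that by (cases "even q") (auto elim!: evenE oddE)
  with False show ?thesis
    using pos_pr[of i] unfolding blk_odd[OF False] by (auto split: if_splits)
qed

lemma pr_pr [simp]: "pr (pr i) = (i::'n::{finite,linorder})"
proof -
  have "pos i > 0" if "blk i \<noteq> 0" "odd (pos i + CARD('n))"
    using that by (cases "pos i") (auto simp: blk_odd)
  then have "pos (pr (pr i)) = pos i"
    using pos_pr[of i] pos_pr[of "pr i"] by auto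
  then show ?thesis by simp
qed

lemma sg_pr [simp]: "sg (pr i) = - (sg (i::'n::{finite,linorder}) :: 'a::ring_1)"
proof -
  have "pos i > 0" if "blk i \<noteq> 0" "odd (pos i + CARD('n))"
    using that by (cases "pos i") (auto simp: blk_odd)
  then show ?thesis
    using pos_pr[of i] unfolding sg_def by auto
qed

lemma sg_zero: "blk (i::'n::{finite,linorder}) = 0 \<Longrightarrow> sg i = 0"
  by (simp add: sg_def)

lemma sg_sq: "blk (i::'n::{finite,linorder}) \<noteq> 0 \<Longrightarrow> sg i * sg i = 1"
  by (simp add: sg_def)

lemma pr_neq:
  assumes "blk (i::'n::{finite,linorder}) \<noteq> 0" shows "pr i \<noteq> i"
proof
  assume "pr i = i"
  then have "sg i = - (sg i :: int)" by (metis sg_pr)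
  then show False using assms by (simp add: sg_def split: if_splits)
qed

lemma blk_eqD: "blk i = blk (j::'n::{finite,linorder}) \<Longrightarrow> j = i \<or> j = pr i"
proof -
  assume a: "blk i = blk j"
  have *: "q = p \<or> q = (if even p then p + 1 else p - 1)" if "p div 2 = q div 2" for p q :: nat
    using that by (cases "even p"; cases "even q") (auto elim!: evenE oddE)
  have **: "q = p \<or> q = (if even p then p - 1 else p + 1)"
    if "(p + 1) div 2 = (q + 1) div 2" for p q :: nat
    using that by (cases "even p"; cases "even q") (auto elim!: evenE oddE)
  have "pos j = pos i \<or> pos j = pos (pr i)"
  proof (cases "even (CARD('n))")
    case True then show ?thesis
      using a *[of "pos i" "pos j"] unfolding pos_pr blk_even[OF True] by auto
  next
    case False
    then show ?thesis
      using a **[of "pos i" "pos j"] unfolding pos_pr blk_odd[OF False]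
      by (cases "pos i = 0") (auto split: if_splits)
  qed
  then show ?thesis by auto
qed

lemma blk_le: "blk (i::'n::{finite,linorder}) \<le> CARD('n) div 2"
  using pos_less[of i] by (cases "even CARD('n)") (auto simp: blk_even blk_odd elim!: evenE oddE)

text \<open>The position is the argument of \<open>sigma_at\<close> in \<open>cartan\<close>.
  Because of truncated subtraction, c = 0 yields the head of block 1; all uses as a block head
  assume 1 \<le> c.\<close>

definition hd_idx :: "nat \<Rightarrow> 'n::{finite,linorder}" where
  "hd_idx c = idx (CARD('n) mod 2 + 2 * (c - 1))"

lemma pos_hd:
  assumes "1 \<le> c" "c \<le> CARD('n) div 2"
  shows "pos (hd_idx c :: 'n::{finite,linorder}) = CARD('n) mod 2 + 2 * (c - 1)"
proof -
  have "CARD('n) mod 2 + 2 * (CARD('n) div 2) = CARD('n)" by simp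
  then have "CARD('n) mod 2 + 2 * (c - 1) < CARD('n)" using assms by linarith
  then show ?thesis unfolding hd_idx_def by (rule pos_idx)
qed

lemma blk_hd:
  assumes "1 \<le> c" "c \<le> CARD('n) div 2"
  shows "blk (hd_idx c :: 'n::{finite,linorder}) = c" "sg (hd_idx c :: 'n::{finite,linorder}) = 1"
proof -
  show 1: "blk (hd_idx c :: 'n::{finite,linorder}) = c"
    unfolding blk_def pos_hd[OF assms] using assms by (cases "even CARD('n)") (auto simp: odd_iff_mod_2_eq_one)
  have "even (CARD('n) mod 2 + 2 * (c - 1) + CARD('n))" by simp
  then show "sg (hd_idx c :: 'n::{finite,linorder}) = 1"
    unfolding sg_def 1 pos_hd[OF assms] using assms by simp
qed

lemma block_eq:
  assumes "1 \<le> c" "c \<le> CARD('n) div 2"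
  shows "{i :: 'n::{finite,linorder}. blk i = c} = {hd_idx c, pr (hd_idx c)}"
  using blk_eqD[of "hd_idx c :: 'n"] blk_hd[OF assms] by auto

lemma sigma_block:
  assumes "1 \<le> c" "c \<le> CARD('n) div 2"
  shows "(sigma_at (CARD('n) mod 2 + 2 * (c - 1)) :: 'a::ring_1^'n::{finite,linorder}^'n::{finite,linorder}) $ i $ j =
    (if blk i = c \<and> j = pr i then sg i else 0)"
proof -
  define q where "q = CARD('n) mod 2 + 2 * (c - 1)"
  define h :: 'n where "h = hd_idx c"
  have h: "blk h = c" "sg h = (1::'a)" "pos h = q"
    using blk_hd[OF assms] pos_hd[OF assms] unfolding h_def q_def by auto
  have e: "even (q + CARD('n))" unfolding q_def by simp
  have p: "pos (pr h) = q + 1"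
    using h e assms unfolding pos_pr[of h] by auto
  have 1: "pos k = q \<longleftrightarrow> k = h" "pos k = q + 1 \<longleftrightarrow> k = pr h" for k :: 'n
    using h p pos_inject by metis+
  have 2: "blk k = c \<longleftrightarrow> k = h \<or> k = pr h" for k :: 'n
    using block_eq[OF assms] unfolding h_def by auto
  have "h \<noteq> pr h" using p h(3) by auto
  then show ?thesis unfolding sigma_at_def q_def[symmetric] 1 2 using h(2)
    by (cases "i = h"; cases "i = pr h") auto
qed

text \<open>Dictionary between the corner sizes n + 2 - 2k of the definitions and block numbers,
  with c = N - k. For odd size the single index of block 0 accounts for the extra 1.\<close>

lemma pos_less_blk:
  assumes "c \<le> CARD('n) div 2"
  shows "pos (i::'n::{finite,linorder}) < CARD('n) - 2 * (CARD('n) div 2 - c) \<longleftrightarrow> blk i \<le> c"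
proof (cases "even (CARD('n))")
  case True
  then have "CARD('n) - 2 * (CARD('n) div 2 - c) = 2 * c" using assms by auto
  then show ?thesis unfolding blk_even[OF True] by auto
next
  case False
  then have "CARD('n) - 2 * (CARD('n) div 2 - c) = 2 * c + 1" using assms by (auto elim!: oddE)
  then show ?thesis unfolding blk_odd[OF False] by auto
qed

lemma sum_pr: "(\<Sum>l | P (blk l). f (pr l)) = (\<Sum>l::'n::{finite,linorder} | P (blk l). f l)"
  by (rule sum.reindex_bij_witness[where i=pr and j=pr]) auto

subsection \<open>The operator \<open>J\<close>\<close>

text \<open>\<open>J\<close> multiplies by \<open>\<sigma>\<close> on the index that lies in the higher block, because the positive
  roots \<open>\<epsilon>\<^sub>i \<plusminus> \<epsilon>\<^sub>j\<close> have \<open>i > j\<close>.\<close>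

definition Jb :: "'a::ring_1^'n::{finite,linorder}^'n::{finite,linorder} \<Rightarrow> 'a^'n::{finite,linorder}^'n::{finite,linorder}" where
  "Jb X = (\<chi> i j. if blk j < blk i then sg i * X $ pr i $ j
                 else if blk i < blk j then sg j * X $ i $ pr j else 0)"

lemma mat_mult_nth: "(A ** B) $ i $ j = (\<Sum>l\<in>UNIV. A $ i $ l * B $ l $ j)"
  by (simp add: matrix_matrix_mult_def)

lemma so_iff: "A \<in> so \<longleftrightarrow> (\<forall>i j. A $ i $ j = - A $ j $ i)"
  unfolding so_def by (auto simp: vec_eq_iff transpose_def)

lemma so_nth: "A \<in> so \<Longrightarrow> A $ i $ j = - A $ j $ i"
  unfolding so_iff by blast

lemma so_diag: "A \<in> so \<Longrightarrow> A $ i $ i = (0::'a::{ring_1, ring_char_0, idom})"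
proof -
  assume "A \<in> so"
  then have "2 * A $ i $ i = 0"
    using so_nth[of A i i] unfolding mult_2 by (metis ab_left_minus)
  then show ?thesis by simp
qed

lemma cscale_nth [simp]: "cscale z A $ i $ j = z * A $ i $ j"
  by (simp add: cscale_def)

lemma cplx_nth [simp]: "cplx A $ i $ j = complex_of_real (A $ i $ j)"
  by (simp add: cplx_def)

text \<open>Arbitrary coefficients t cover both the complex Cartan elements and the real
  \<open>rho_phi\<close>, where t is the indicator of the top block. The second sign is plus because
  sigma is antisymmetric.\<close>

lemma lie_block_diag:
  fixes E :: "'a::comm_ring_1^'n::{finite,linorder}^'n::{finite,linorder}"
  assumes M: "\<And>i j. M $ i $ j = (if j = pr i then t (blk i) * sg i else 0)"
  shows "lie M E $ i $ j = t (blk i) * sg i * E $ pr i $ j + t (blk j) * sg j * E $ i $ pr j"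
proof -
  have "l = pr j \<longleftrightarrow> pr l = j" for l by auto
  then have M': "M $ l $ j = (if l = pr j then - (t (blk j) * sg j) else 0)" for l
    using M[of l j] by auto
  have "(M ** E) $ i $ j = t (blk i) * sg i * E $ pr i $ j"
    unfolding mat_mult_nth M by (simp add: if_distrib[of "\<lambda>x. x * _"] cong: if_cong)
  moreover have "(E ** M) $ i $ j = - (t (blk j) * sg j * E $ i $ pr j)"
    unfolding mat_mult_nth M' by (simp add: if_distrib[of "\<lambda>x. _ * x"] mult.commute cong: if_cong)
  ultimately show ?thesis by (simp add: lie_def)
qed

lemma cartan_nth:
  "(cartan t :: 'n::{finite,linorder} cmat) $ i $ j = (if j = pr i then t (blk i) * sg i else 0)"
proof -
  have "(cartan t :: 'n cmat) $ i $ j = (\<Sum>c=1..CARD('n) div 2.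
      t c * (sigma_at (CARD('n) mod 2 + 2 * (c - 1)) :: 'n cmat) $ i $ j)"
    unfolding cartan_def by simp
  also have "\<dots> = (\<Sum>c=1..CARD('n) div 2.
      if c = blk i then (if j = pr i then t (blk i) * sg i else 0) else 0)"
  proof (intro sum.cong refl)
    fix c assume "c \<in> {1..CARD('n) div 2}"
    then have "(sigma_at (CARD('n) mod 2 + 2 * (c - 1)) :: 'n cmat) $ i $ j =
        (if blk i = c \<and> j = pr i then sg i else 0)"
      by (intro sigma_block) auto
    then show "t c * (sigma_at (CARD('n) mod 2 + 2 * (c - 1)) :: 'n cmat) $ i $ j =
        (if c = blk i then (if j = pr i then t (blk i) * sg i else 0) else 0)"
      unfolding \<open>sigma_at _ $ i $ j = _\<close> by auto
  qed
  also have "\<dots> = (if j = pr i then t (blk i) * sg i else 0)"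
    using blk_le[of i] by (auto simp: sg_zero not_less_eq_eq)
  finally show ?thesis .
qed

lemma lie_cartan:
  "lie (cartan t) E $ i $ j = t (blk i) * sg i * E $ pr i $ j + t (blk j) * sg j * E $ i $ pr j"
  by (rule lie_block_diag) (rule cartan_nth)

section \<open>Root spaces as eigenspaces of \<open>Jb\<close>\<close>

abbreviation kdelta :: "nat \<Rightarrow> nat \<Rightarrow> complex" where
  "kdelta c \<equiv> \<lambda>k. if k = c then 1 else 0"

text \<open>Testing the root on coordinate vectors of the Cartan subalgebra locates E: the value at
  a forces one index into block a, the zero values above a exclude higher blocks, and within a block
  only vanishing diagonal entries would contribute. On the remaining pairs the bracket with
  coordinate a is sigma acting on the higher index, which is \<open>Jb\<close>. The sign s is 1 for
  positive and -1 for negative roots.\<close>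

lemma Jb_root_vector:
  fixes E :: "'n::{finite,linorder} cmat"
  assumes E: "E \<in> root_space \<alpha>" and a: "\<alpha> (kdelta a) = s * \<i>" "1 \<le> a"
    and s: "s \<noteq> 0" and top: "\<And>c. c > a \<Longrightarrow> \<alpha> (kdelta c) = 0"
  shows "Jb E = cscale (s * \<i>) E"
proof -
  have so: "E \<in> so" and root: "\<And>t. lie (cartan t) E = cscale (\<alpha> t) E"
    using E by (auto simp: root_space_def)
  have R: "t (blk i) * sg i * E $ pr i $ j + t (blk j) * sg j * E $ i $ pr j = \<alpha> t * E $ i $ j" for t i j
    using root[of t] lie_cartan[of t E i j] by simp
  have Z1: "E $ i $ j = 0" if "blk i \<noteq> a" "blk j \<noteq> a" for i j
    using R[of "kdelta a" i j] that a s by simp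
  have Z2: "E $ i $ j = 0" if "blk i > a" "blk i \<noteq> blk j" for i j
    using R[of "kdelta (blk i)" "pr i" j] that a top[of "blk i"] by (auto simp: sg_def split: if_splits)
  have Z3: "E $ i $ j = 0" if "blk i = blk j" for i j
  proof (cases "j = i")
    case False
    with that have j: "j = pr i" using blk_eqD by blast
    show ?thesis
    proof (cases "blk i = a")
      case True
      then show ?thesis
        using R[of "kdelta a" i j] j a s so_diag[OF so] by simp
    qed (use Z1 that in auto)
  qed (simp add: so_diag[OF so])
  have "Jb E $ i $ j = s * \<i> * E $ i $ j" for i j
  proof -
    consider "blk i = blk j" | "blk j < blk i" "blk i = a" | "blk j < blk i" "blk i > a"
      | "blk j < blk i" "blk i < a" | "blk i < blk j" "blk j = a" | "blk i < blk j" "blk j > a"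
      | "blk i < blk j" "blk j < a" by linarith
    then show ?thesis
    proof cases
      case 2 then show ?thesis using R[of "kdelta a" i j] a by (auto simp: Jb_def)
    next
      case 5 then show ?thesis using R[of "kdelta a" i j] a by (auto simp: Jb_def)
    next
      case 6 then show ?thesis using Z2[of j i] Z2[of "pr j" i] so_nth[OF so, of i j] so_nth[OF so, of i "pr j"]
        by (simp add: Jb_def)
    qed (use Z1 Z2 Z3 in \<open>auto simp: Jb_def\<close>)
  qed
  then show ?thesis by (simp add: vec_eq_iff)
qed

lemma pos_roots_top:
  assumes "\<alpha> \<in> pos_roots d"
  obtains a where "1 \<le> a" "\<alpha> (kdelta a) = \<i>" "\<And>c. c > a \<Longrightarrow> \<alpha> (kdelta c) = 0"
proof -
  from assms consider i j where "\<alpha> = (\<lambda>t. eps i t + eps j t)" "1 \<le> j" "j < i"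
    | i j where "\<alpha> = (\<lambda>t. eps i t - eps j t)" "1 \<le> j" "j < i"
    | i where "\<alpha> = eps i" "1 \<le> i"
    unfolding pos_roots_def by (auto split: if_splits)
  then show thesis
  proof cases
    case 1
    show thesis by (rule that[of i]) (use 1 in \<open>auto simp: eps_def\<close>)
  next
    case 2
    show thesis by (rule that[of i]) (use 2 in \<open>auto simp: eps_def\<close>)
  next
    case 3
    show thesis by (rule that[of i]) (use 3 in \<open>auto simp: eps_def\<close>)
  qed
qed

lemma subspace_Jb_eigen: "subspace {E :: 'n::{finite,linorder} cmat. Jb E = cscale z E}"
proof -
  have "Jb (x + y) = Jb x + Jb y" for x y :: "'n cmat"
    by (auto simp: Jb_def vec_eq_iff algebra_simps)
  moreover have "Jb (c *\<^sub>R x) = c *\<^sub>R Jb x" for c and x :: "'n cmat"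
    by (auto simp: Jb_def vec_eq_iff)
  moreover have "Jb 0 = (0 :: 'n cmat)"
    by (simp add: Jb_def vec_eq_iff)
  ultimately show ?thesis
    by (simp add: subspace_def vec_eq_iff algebra_simps)
qed

lemma Jb_nil_plus:
  assumes "u \<in> (nil_plus :: 'n::{finite,linorder} cmat set)"
  shows "Jb u = cscale \<i> u"
proof -
  have "(\<Union>\<alpha>\<in>pos_roots CARD('n). root_space \<alpha>) \<subseteq> {E :: 'n cmat. Jb E = cscale \<i> E}"
  proof safe
    fix \<alpha> and E :: "'n cmat" assume *: "\<alpha> \<in> pos_roots CARD('n)" "E \<in> root_space \<alpha>"
    show "Jb E = cscale \<i> E"
      using pos_roots_top[OF *(1)] Jb_root_vector[OF *(2), of _ 1] by auto
  qed
  then have "nil_plus \<subseteq> {E :: 'n cmat. Jb E = cscale \<i> E}"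
    unfolding nil_plus_def by (rule span_minimal[OF _ subspace_Jb_eigen])
  with assms show ?thesis by auto
qed

lemma Jb_nil_minus:
  assumes "u \<in> (nil_minus :: 'n::{finite,linorder} cmat set)"
  shows "Jb u = cscale (- \<i>) u"
proof -
  have "(\<Union>\<alpha>\<in>pos_roots CARD('n). root_space (\<lambda>t. - \<alpha> t)) \<subseteq> {E :: 'n cmat. Jb E = cscale (- \<i>) E}"
  proof safe
    fix \<alpha> and E :: "'n cmat" assume *: "\<alpha> \<in> pos_roots CARD('n)" "E \<in> root_space (\<lambda>t. - \<alpha> t)"
    show "Jb E = cscale (- \<i>) E"
      using pos_roots_top[OF *(1)] Jb_root_vector[OF *(2), of _ "-1"] by auto
  qed
  then have "nil_minus \<subseteq> {E :: 'n cmat. Jb E = cscale (- \<i>) E}"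
    unfolding nil_minus_def by (rule span_minimal[OF _ subspace_Jb_eigen])
  with assms show ?thesis by auto
qed

lemma Jb_cartan: "Jb (cartan t :: 'n::{finite,linorder} cmat) = 0"
proof -
  have "j \<noteq> pr i \<and> pr j \<noteq> pr i \<and> j \<noteq> i \<and> pr j \<noteq> i" if "blk i \<noteq> blk j" for i j :: 'n
    using that by (metis blk_pr)
  then show ?thesis by (simp add: Jb_def vec_eq_iff cartan_nth)
qed

definition block_pair :: "nat \<Rightarrow> nat \<Rightarrow> 'n::{finite,linorder} cmat \<Rightarrow> 'n cmat" where
  "block_pair a b X = (\<chi> i j.
     if (blk i = a \<and> blk j = b) \<or> (blk i = b \<and> blk j = a) then X $ i $ j else 0)"

text \<open>The part of a block pair on which \<open>\<sigma>\<close> acts on the lower index as \<open>k \<i>\<close>.\<close>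

definition block_pair_part :: "complex \<Rightarrow> nat \<Rightarrow> nat \<Rightarrow> 'n::{finite,linorder} cmat \<Rightarrow> 'n cmat" where
  "block_pair_part k a b X = (\<chi> i j.
     if blk i = a \<and> blk j = b then (X $ i $ j - k * \<i> * (sg j * X $ i $ pr j)) / 2
     else if blk i = b \<and> blk j = a then (X $ i $ j - k * \<i> * (sg i * X $ pr i $ j)) / 2 else 0)"

text \<open>The eigenvalue of \<open>Jb\<close> fixes the action of sigma on the higher index. On
  the lower index sigma squares to -1, so (1 - k \<i> sigma) / 2 projects to its eigenvalue k \<i>.
  If the lower block is block 0, sigma acts there as 0 and the root is a single s
  \<open>eps a\<close>.\<close>

lemma
  fixes u :: "'n::{finite,linorder} cmat"
  assumes so: "u \<in> so" and J: "Jb u = cscale (s * \<i>) u" and b: "b < a"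
  shows block_pair_part_root: "1 \<le> b \<Longrightarrow> k * k = 1 \<Longrightarrow>
      block_pair_part k a b u \<in> root_space (\<lambda>t. s * eps a t + k * eps b t)"
    and block_pair_root: "b = 0 \<Longrightarrow> block_pair a b u \<in> root_space (\<lambda>t. s * eps a t)"
proof -
  have J1: "sg i * u $ pr i $ j = s * \<i> * u $ i $ j" if "blk j < blk i" for i j
    using arg_cong[OF J, of "\<lambda>X. X $ i $ j"] that by (simp add: Jb_def)
  have J2: "sg j * u $ i $ pr j = s * \<i> * u $ i $ j" if "blk i < blk j" for i j
    using arg_cong[OF J, of "\<lambda>X. X $ i $ j"] that by (simp add: Jb_def)
  {
    assume b1: "1 \<le> b" and k: "k * k = 1"
    let ?E = "block_pair_part k a b u"
    have "?E \<in> so"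
      unfolding so_iff
    proof (intro allI)
      fix i j
      have "u $ i $ j = - u $ j $ i" "u $ i $ pr j = - u $ pr j $ i" "u $ pr i $ j = - u $ j $ pr i"
        by (rule so_nth[OF so])+
      then show "?E $ i $ j = - ?E $ j $ i"
        using b unfolding block_pair_part_def by (simp add: field_simps)
    qed
    moreover have "lie (cartan t) ?E = cscale (s * eps a t + k * eps b t) ?E" for t
    proof -
      have "lie (cartan t) ?E $ i $ j = (s * eps a t + k * eps b t) * ?E $ i $ j" for i j
      proof -
        consider (ab) "blk i = a" "blk j = b" | (ba) "blk i = b" "blk j = a"
          | (no) "\<not> (blk i = a \<and> blk j = b)" "\<not> (blk i = b \<and> blk j = a)" by blast
        then show ?thesis
        proof cases
          case ab
          have q: "sg j * sg j = (1::complex)" using ab b1 by (intro sg_sq) auto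
          have 1: "sg i * u $ pr i $ j = s * \<i> * u $ i $ j"
            "sg i * u $ pr i $ pr j = s * \<i> * u $ i $ pr j" using J1 ab b by auto
          have "sg i * ?E $ pr i $ j = (sg i * u $ pr i $ j - k * \<i> * sg j * (sg i * u $ pr i $ pr j)) / 2"
            using ab b by (simp add: block_pair_part_def field_simps)
          also have "\<dots> = s * \<i> * ?E $ i $ j"
            unfolding 1 using ab b by (simp add: block_pair_part_def field_simps)
          finally have A: "sg i * ?E $ pr i $ j = s * \<i> * ?E $ i $ j" .
          have "sg j * ?E $ i $ pr j = (sg j * u $ i $ pr j + k * \<i> * (sg j * sg j) * u $ i $ j) / 2"
            using ab b by (simp add: block_pair_part_def field_simps)
          also have "\<dots> = ((k * k) * sg j * u $ i $ pr j + k * \<i> * u $ i $ j) / 2"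
            unfolding q k by simp
          also have "\<dots> = k * \<i> * ?E $ i $ j"
            using ab b by (simp add: block_pair_part_def field_simps)
          finally have B: "sg j * ?E $ i $ pr j = k * \<i> * ?E $ i $ j" .
          show ?thesis unfolding lie_cartan using ab A B
            by (simp add: eps_def mult.assoc) (simp add: algebra_simps)
        next
          case ba
          have q: "sg i * sg i = (1::complex)" using ba b1 by (intro sg_sq) auto
          have 1: "sg j * u $ i $ pr j = s * \<i> * u $ i $ j"
            "sg j * u $ pr i $ pr j = s * \<i> * u $ pr i $ j" using J2 ba b by auto
          have "sg j * ?E $ i $ pr j = (sg j * u $ i $ pr j - k * \<i> * sg i * (sg j * u $ pr i $ pr j)) / 2"
            using ba b by (simp add: block_pair_part_def field_simps)
          also have "\<dots> = s * \<i> * ?E $ i $ j"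
            unfolding 1 using ba b by (simp add: block_pair_part_def field_simps)
          finally have A: "sg j * ?E $ i $ pr j = s * \<i> * ?E $ i $ j" .
          have "sg i * ?E $ pr i $ j = (sg i * u $ pr i $ j + k * \<i> * (sg i * sg i) * u $ i $ j) / 2"
            using ba b by (simp add: block_pair_part_def field_simps)
          also have "\<dots> = ((k * k) * sg i * u $ pr i $ j + k * \<i> * u $ i $ j) / 2"
            unfolding q k by simp
          also have "\<dots> = k * \<i> * ?E $ i $ j"
            using ba b by (simp add: block_pair_part_def field_simps)
          finally have B: "sg i * ?E $ pr i $ j = k * \<i> * ?E $ i $ j" .
          show ?thesis unfolding lie_cartan using ba A B
            by (simp add: eps_def mult.assoc) (simp add: algebra_simps)
        next
          case no
          then have "?E $ i $ j = 0" "?E $ pr i $ j = 0" "?E $ i $ pr j = 0"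
            by (simp_all only: block_pair_part_def vec_lambda_beta blk_pr if_False)
          then show ?thesis unfolding lie_cartan by simp
        qed
      qed
      then show ?thesis by (simp add: vec_eq_iff)
    qed
    ultimately show "block_pair_part k a b u \<in> root_space (\<lambda>t. s * eps a t + k * eps b t)"
      by (simp add: root_space_def)
  }
  {
    assume b0: "b = 0"
    let ?E = "block_pair a b u"
    have "?E \<in> so"
      unfolding so_iff
    proof (intro allI)
      fix i j
      have "u $ i $ j = - u $ j $ i" by (rule so_nth[OF so])
      then show "?E $ i $ j = - ?E $ j $ i" unfolding block_pair_def by simp
    qed
    moreover have "lie (cartan t) ?E = cscale (s * eps a t) ?E" for t
    proof -
      have "lie (cartan t) ?E $ i $ j = (s * eps a t) * ?E $ i $ j" for i j
        unfolding lie_cartan using b J1[of j i] J2[of i j]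
        by (auto simp: block_pair_def b0 sg_zero eps_def mult.assoc)
      then show ?thesis by (simp add: vec_eq_iff)
    qed
    ultimately show "block_pair a b u \<in> root_space (\<lambda>t. s * eps a t)"
      by (simp add: root_space_def)
  }
qed

lemma block_pair_in_span:
  fixes u :: "'n::{finite,linorder} cmat"
  assumes so: "u \<in> so" and J: "Jb u = cscale (s * \<i>) u" and s: "s * s = 1"
    and ab: "b < a" "a \<le> CARD('n) div 2"
  shows "block_pair a b u \<in> span (\<Union>\<alpha>\<in>pos_roots CARD('n). root_space (\<lambda>t. s * \<alpha> t))"
proof (cases "b = 0")
  case True
  show ?thesis
  proof (cases "odd CARD('n)")
    case odd: True
    then have "eps a \<in> pos_roots CARD('n)" using ab unfolding pos_roots_def by auto
    then show ?thesis using block_pair_root[OF so J ab(1) True] by (intro span_base) auto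
  next
    case False
    then have "\<not> blk i = 0" for i :: 'n by (simp add: blk_even)
    then have "block_pair a b u = 0" using True by (auto simp: block_pair_def vec_eq_iff, metis+)
    then show ?thesis by (simp add: span_zero)
  qed
next
  case False
  have ss: "s * (s * x) = x" for x using s by (metis mult.assoc mult_1)
  have "(\<lambda>t. eps a t + eps b t) \<in> pos_roots CARD('n)" "(\<lambda>t. eps a t - eps b t) \<in> pos_roots CARD('n)"
    using ab False unfolding pos_roots_def by auto
  \<comment> \<open>Taking k = s and k = -s makes both roots s times a positive root, and the two
    complementary projections add up to the whole block pair.\<close>
  moreover have "block_pair_part s a b u \<in> root_space (\<lambda>t. s * (eps a t + eps b t))"
    "block_pair_part (- s) a b u \<in> root_space (\<lambda>t. s * (eps a t - eps b t))"
    using block_pair_part_root[OF so J ab(1), of s] block_pair_part_root[OF so J ab(1), of "- s"] s False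
    by (auto simp: algebra_simps)
  ultimately have "block_pair_part s a b u + block_pair_part (- s) a b u \<in>
    span (\<Union>\<alpha>\<in>pos_roots CARD('n). root_space (\<lambda>t. s * \<alpha> t))"
    by (intro span_add span_base) blast+
  moreover have "block_pair a b u = block_pair_part s a b u + block_pair_part (- s) a b u"
    using ab by (auto simp: vec_eq_iff block_pair_def block_pair_part_def field_simps)
  ultimately show ?thesis by simp
qed

text \<open>Converse of \<open>Jb_root_vector\<close>: an eigenvector with nonzero eigenvalue has no
  entries inside a block, hence is the sum of its block pairs, each of which splits into root
  vectors.\<close>

lemma eigen_in_span:
  fixes u :: "'n::{finite,linorder} cmat"
  assumes so: "u \<in> so" and J: "Jb u = cscale (s * \<i>) u" and s: "s * s = 1"
  shows "u \<in> span (\<Union>\<alpha>\<in>pos_roots CARD('n). root_space (\<lambda>t. s * \<alpha> t))"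
proof -
  let ?I = "{(a, b). b < a \<and> a \<le> CARD('n) div 2}"
  have fin: "finite ?I" by (rule finite_subset[of _ "{..CARD('n) div 2} \<times> {..CARD('n) div 2}"]) auto
  have "u = (\<Sum>(a, b)\<in>?I. block_pair a b u)"
  proof -
    have "u $ i $ j = (\<Sum>(a, b)\<in>?I. block_pair a b u) $ i $ j" for i j
    proof -
      let ?ab = "(max (blk i) (blk j), min (blk i) (blk j))"
      have s0: "s \<noteq> 0" using s by auto
      have *: "block_pair a b u $ i $ j = (if (a, b) = ?ab then u $ i $ j else 0)"
        if "(a, b) \<in> ?I" for a b
      proof (cases "(a, b) = ?ab")
        case True
        then show ?thesis by (auto simp: block_pair_def max_def min_def)
      next
        case False
        then have "\<not> ((blk i = a \<and> blk j = b) \<or> (blk i = b \<and> blk j = a))"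
          using that by auto
        with False show ?thesis by (simp only: block_pair_def vec_lambda_beta if_False)
      qed
      then have *: "(case ab of (a, b) \<Rightarrow> block_pair a b u) $ i $ j = (if ab = ?ab then u $ i $ j else 0)"
        if "ab \<in> ?I" for ab
        using *[of "fst ab" "snd ab"] that unfolding case_prod_beta prod.collapse by simp
      have "(\<Sum>(a, b)\<in>?I. block_pair a b u) $ i $ j = (\<Sum>ab\<in>?I. if ab = ?ab then u $ i $ j else 0)"
        unfolding sum_component by (intro sum.cong refl *)
      also have "\<dots> = (if ?ab \<in> ?I then u $ i $ j else 0)"
        using fin by simp
      also have "\<dots> = u $ i $ j"
      proof (cases "blk i = blk j")
        case True
        then show ?thesis using arg_cong[OF J, of "\<lambda>X. X $ i $ j"] s0 by (simp add: Jb_def)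
      next
        case False
        then show ?thesis using blk_le[of i] blk_le[of j] by auto
      qed
      finally show ?thesis by simp
    qed
    then show ?thesis by (simp add: vec_eq_iff)
  qed
  also have "\<dots> \<in> span (\<Union>\<alpha>\<in>pos_roots CARD('n). root_space (\<lambda>t. s * \<alpha> t))"
    by (intro span_sum) (use block_pair_in_span[OF so J s] in auto)
  finally show ?thesis .
qed

text \<open>Every admissible decomposition gives the same value, since \<open>Jb\<close> kills the
  Cartan part and is \<i> or -\<i> on the nilpotent parts. This settles uniqueness in the definite
  description without proving that the decomposition itself is unique.\<close>

lemma J_eq_Jb:
  fixes X :: "'n::{finite,linorder} cmat"
  assumes X: "X \<in> so"
  shows "J X = Jb X"
  unfolding J_def
proof (rule the_equality)
  fix Y
  assume "\<exists>h\<in>range cartan. \<exists>u\<in>nil_plus. \<exists>v\<in>nil_minus. X = h + u + v \<and> Y = cscale \<i> u - cscale \<i> v"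
  then obtain t u v where *: "u \<in> nil_plus" "v \<in> nil_minus" "X = cartan t + u + v"
    "Y = cscale \<i> u - cscale \<i> v" by auto
  have "Jb X = Jb (cartan t) + Jb u + Jb v" unfolding *(3)
    by (auto simp: Jb_def vec_eq_iff algebra_simps)
  then show "Y = Jb X"
    using Jb_nil_plus[OF *(1)] Jb_nil_minus[OF *(2)] Jb_cartan[of t] *(4)
    by (simp add: vec_eq_iff)
next
  \<comment> \<open>Spectral projections of \<open>Jb\<close>, whose square is -1 off the diagonal
    blocks: s = 1 gives the nilpotent part for \<i>, s = -1 the one for -\<i>.\<close>
  define u where "u s = (\<chi> i j. if blk i = blk j then 0 else (X $ i $ j - s * \<i> * Jb X $ i $ j) / 2)" for s
  have u_so: "u s \<in> so" for s
    unfolding so_iff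
  proof (intro allI)
    fix i j
    have "X $ i $ j = - X $ j $ i" "X $ i $ pr j = - X $ pr j $ i" "X $ pr i $ j = - X $ j $ pr i"
      by (rule so_nth[OF X])+
    then show "u s $ i $ j = - u s $ j $ i"
      unfolding u_def Jb_def by (simp add: field_simps)
  qed
  have sq: "sg i * (sg i * x) = x" if "blk j < blk i" for i j :: 'n and x :: complex
    using sg_sq[of i, where 'a=complex] that by (metis mult.assoc mult_1 not_less0)
  have Ju: "Jb (u s) = cscale (s * \<i>) (u s)" if "s * s = 1" for s
  proof -
    have ss: "s * (s * x) = x" for x using that by (metis mult.assoc mult_1)
    have "Jb (u s) $ i $ j = s * \<i> * u s $ i $ j" for i j
      using sq[of j i] sq[of i j] by (auto simp: Jb_def u_def field_simps ss)
    then show ?thesis by (simp add: vec_eq_iff)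
  qed
  have up: "u 1 \<in> nil_plus" using eigen_in_span[OF u_so Ju, of 1] by (simp add: nil_plus_def)
  have um: "u (- 1) \<in> nil_minus" using eigen_in_span[OF u_so Ju, of "-1"] by (simp add: nil_minus_def)
  define t where "t c = X $ hd_idx c $ pr (hd_idx c)" for c
  have "X = cartan t + u 1 + u (- 1)"
  proof -
    have "X $ i $ j = (cartan t + u 1 + u (- 1)) $ i $ j" for i j
    proof (cases "blk i = blk j")
      case True
      then consider "j = i" | "j = pr i" "blk i \<noteq> 0" using blk_eqD pr_def by metis
      then show ?thesis
      proof cases
        case 1
        then have "cartan t $ i $ j = 0" using pr_neq[of i] by (auto simp: cartan_nth sg_def)
        then show ?thesis using 1 so_diag[OF X] by (simp add: u_def)
      next
        case 2
        let ?c = "blk i"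
        have c: "1 \<le> ?c" "?c \<le> CARD('n) div 2" using 2 blk_le[of i] by auto
        have "i = hd_idx ?c \<or> i = pr (hd_idx ?c)" using block_eq[OF c] by auto
        moreover have "X $ hd_idx ?c $ pr (hd_idx ?c) = - X $ pr (hd_idx ?c) $ hd_idx ?c" by (rule so_nth[OF X])
        moreover have "cartan t $ i $ j = t ?c * sg i" using 2 by (simp add: cartan_nth)
        moreover have "(sg (hd_idx ?c :: 'n) :: complex) = 1" using blk_hd[OF c] by simp
        ultimately have "X $ i $ j = cartan t $ i $ j"
          unfolding 2 t_def by (metis (no_types, lifting) sg_pr pr_pr mult.right_neutral mult_minus_right minus_minus)
        then show ?thesis using True by (simp add: u_def)
      qed
    next
      case False
      then have "j \<noteq> pr i" by auto
      with False show ?thesis by (simp add: cartan_nth u_def field_simps)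
    qed
    then show ?thesis by (simp add: vec_eq_iff)
  qed
  moreover have "Jb X = cscale \<i> (u 1) - cscale \<i> (u (- 1))"
    by (auto simp: vec_eq_iff u_def field_simps) (simp add: Jb_def)
  ultimately show "\<exists>h\<in>range cartan. \<exists>u\<in>nil_plus. \<exists>v\<in>nil_minus. X = h + u + v \<and> Jb X = cscale \<i> u - cscale \<i> v"
    using up um by blast
qed

subsection \<open>The orbit and its tangent spaces\<close>

type_synonym 'n rvec = "real^'n"

lemma subspace_so: "subspace (so :: (real^'n::finite^'n::finite) set)"
proof (rule subspaceI)
  fix x y :: "real^'n::finite^'n::finite" assume "x \<in> so" "y \<in> so"
  note * = so_nth[OF this(1)] so_nth[OF this(2)]
  show "x + y \<in> so"
    unfolding so_iff
  proof (intro allI)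
    fix i j show "(x + y) $ i $ j = - (x + y) $ j $ i" using *(1)[of i j] *(2)[of i j] by simp
  qed
next
  fix c and x :: "real^'n::finite^'n::finite" assume "x \<in> so"
  note * = so_nth[OF this]
  show "c *\<^sub>R x \<in> so"
    unfolding so_iff
  proof (intro allI)
    fix i j show "(c *\<^sub>R x) $ i $ j = - (c *\<^sub>R x) $ j $ i" using *[of i j] by simp
  qed
qed (simp add: so_iff)

lemma so_diff: "A \<in> so \<Longrightarrow> B \<in> so \<Longrightarrow> A - B \<in> (so :: (real^'n::finite^'n::finite) set)"
  and so_add: "A \<in> so \<Longrightarrow> B \<in> so \<Longrightarrow> A + B \<in> (so :: (real^'n::finite^'n::finite) set)"
  and so_uminus: "A \<in> so \<Longrightarrow> - A \<in> (so :: (real^'n::finite^'n::finite) set)"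
  by (simp_all add: subspace_so subspace_diff subspace_add subspace_neg)

lemma so_lie:
  fixes A :: "'a::comm_ring_1^'n::finite^'n::finite"
  assumes "A \<in> so" "B \<in> so" shows "lie A B \<in> so"
proof -
  have "transpose (A ** B) = B ** A" "transpose (B ** A) = A ** B"
    using assms by (simp_all add: so_def matrix_transpose_mul)
     (simp_all add: matrix_matrix_mult_def sum_negf)
  then show ?thesis by (simp add: so_def lie_def transpose_def vec_eq_iff)
qed

lemma so_Jb:
  fixes A :: "real^'n::{finite,linorder}^'n::{finite,linorder}"
  assumes "A \<in> so" shows "Jb A \<in> so"
  unfolding so_iff
proof (intro allI)
  fix i j
  have "A $ i $ pr j = - A $ pr j $ i" "A $ pr i $ j = - A $ j $ pr i"
    by (rule so_nth[OF assms])+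
  then show "Jb A $ i $ j = - Jb A $ j $ i" by (simp add: Jb_def)
qed

lemma inner_mat: "(A :: real^'n^'m) \<bullet> B = (\<Sum>i\<in>UNIV. \<Sum>j\<in>UNIV. A $ i $ j * B $ i $ j)"
  by (simp add: inner_vec_def)

text \<open>The trace form is minus the Euclidean inner product, so orthogonal projections and
  complements are available from here on.\<close>

lemma trace_so:
  fixes A :: "real^'n::finite^'n::finite"
  assumes "B \<in> so" shows "trace (A ** B) = - (A \<bullet> B)"
proof -
  have "trace (A ** B) = (\<Sum>i\<in>UNIV. \<Sum>j\<in>UNIV. A $ i $ j * B $ j $ i)"
    by (simp add: trace_def mat_mult_nth)
  also have "\<dots> = (\<Sum>i\<in>UNIV. \<Sum>j\<in>UNIV. - (A $ i $ j * B $ i $ j))"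
    by (intro sum.cong refl) (metis so_nth[OF assms] mult_minus_right)
  finally show ?thesis by (simp add: inner_mat sum_negf)
qed

text \<open>Invariance of the trace form. Only X has to be antisymmetric; A and B are arbitrary
  matrices.\<close>

lemma inner_lie:
  fixes X :: "real^'n::finite^'n::finite"
  assumes "X \<in> so"
  shows "lie X A \<bullet> B = - (A \<bullet> lie X B)"
proof -
  have X: "X $ i $ j = - X $ j $ i" for i j by (rule so_nth[OF assms])
  have "(X ** A) \<bullet> B = (\<Sum>i\<in>UNIV. \<Sum>j\<in>UNIV. \<Sum>k\<in>UNIV. X $ i $ k * A $ k $ j * B $ i $ j)"
    by (simp add: inner_mat mat_mult_nth sum_distrib_right)
  also have "\<dots> = (\<Sum>k\<in>UNIV. \<Sum>j\<in>UNIV. \<Sum>i\<in>UNIV. X $ i $ k * A $ k $ j * B $ i $ j)"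
    by (subst (2) sum.swap, subst sum.swap, subst (2) sum.swap) (rule refl)
  also have "\<dots> = (\<Sum>k\<in>UNIV. \<Sum>j\<in>UNIV. \<Sum>i\<in>UNIV. - (A $ k $ j * (X $ k $ i * B $ i $ j)))"
    by (intro sum.cong refl, subst X) simp
  also have "\<dots> = - (A \<bullet> (X ** B))"
    by (simp add: inner_mat mat_mult_nth sum_distrib_left sum_negf)
  finally have 1: "(X ** A) \<bullet> B = - (A \<bullet> (X ** B))" .
  have "(A ** X) \<bullet> B = (\<Sum>i\<in>UNIV. \<Sum>j\<in>UNIV. \<Sum>k\<in>UNIV. A $ i $ k * X $ k $ j * B $ i $ j)"
    by (simp add: inner_mat mat_mult_nth sum_distrib_right)
  also have "\<dots> = (\<Sum>i\<in>UNIV. \<Sum>k\<in>UNIV. \<Sum>j\<in>UNIV. A $ i $ k * X $ k $ j * B $ i $ j)"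
    by (subst (2) sum.swap) (rule refl)
  also have "\<dots> = (\<Sum>i\<in>UNIV. \<Sum>k\<in>UNIV. \<Sum>j\<in>UNIV. - (A $ i $ k * (B $ i $ j * X $ j $ k)))"
    by (intro sum.cong refl, subst X) simp
  also have "\<dots> = - (A \<bullet> (B ** X))"
    by (simp add: inner_mat mat_mult_nth sum_distrib_left sum_negf)
  finally have 2: "(A ** X) \<bullet> B = - (A \<bullet> (B ** X))" .
  show ?thesis by (simp add: lie_def inner_diff_left inner_diff_right 1 2)
qed

lemma lie_anti: "lie X Y = - lie Y X"
  by (simp add: lie_def)

lemma lie_add_right: "lie X (Y + Z) = lie X Y + lie X Z"
  and lie_add_left: "lie (X + Y) Z = lie X Z + lie Y Z"
  by (simp_all add: lie_def vec_eq_iff mat_mult_nth sum.distrib algebra_simps)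

lemma lie_scaleR_right: "lie X (c *\<^sub>R Y) = c *\<^sub>R lie X (Y :: real^'n^'n)"
  and lie_scaleR_left: "lie (c *\<^sub>R X) Y = c *\<^sub>R lie X Y"
  by (simp_all add: lie_def vec_eq_iff mat_mult_nth sum_distrib_left algebra_simps)

lemma lie_minus_right: "lie X (- Y) = - lie X (Y :: real^'n^'n)"
  and lie_minus_left: "lie (- X) Y = - lie X Y"
  using lie_scaleR_right[of X "-1" Y] lie_scaleR_left[of "-1" X Y] by simp_all

lemma lie_diff_right: "lie X (Y - Z) = lie X Y - lie X (Z :: real^'n^'n)"
  using lie_add_right[of X Y "- Z"] by (simp add: lie_minus_right)

lemma linear_lie: "linear (lie (X :: real^'n^'n))"
  by (rule linearI) (simp_all add: lie_add_right lie_scaleR_right)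

lemma linear_Jb: "linear (Jb :: real^'n::{finite,linorder}^'n::{finite,linorder} \<Rightarrow> _)"
  by (rule linearI) (auto simp: Jb_def vec_eq_iff algebra_simps)

lemma so_zero_inner:
  assumes "A \<in> so" "\<And>X. X \<in> so \<Longrightarrow> A \<bullet> X = (0::real)" shows "A = 0"
  using assms by force

lemma gradient_exists:
  fixes f :: "'a::euclidean_space \<Rightarrow> real"
  assumes "linear f" obtains G where "\<And>v. f v = v \<bullet> G"
proof -
  have "f v = v \<bullet> (\<Sum>b\<in>Basis. f b *\<^sub>R b)" for v
  proof -
    have "f v = f (\<Sum>b\<in>Basis. (v \<bullet> b) *\<^sub>R b)" by (simp add: euclidean_representation)
    also have "\<dots> = (\<Sum>b\<in>Basis. (v \<bullet> b) * f b)" using assms by (simp add: linear_sum linear_cmul)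
    finally show ?thesis by (simp add: inner_sum_right mult.commute)
  qed
  then show thesis using that by blast
qed

text \<open>On antisymmetric matrices only the antisymmetric part of the gradient a matters; its
  sign is reversed because the trace form is minus the inner product.\<close>

lemma functional_so:
  fixes \<alpha> :: "real^'n::finite^'n::finite \<Rightarrow> real"
  assumes "linear \<alpha>"
  obtains X where "X \<in> so" "\<And>v. v \<in> so \<Longrightarrow> \<alpha> v = trace (v ** X)"
proof -
  obtain a where a: "\<And>v. \<alpha> v = v \<bullet> a" by (rule gradient_exists[OF assms]) blast
  define X where "X = (1/2) *\<^sub>R (transpose a - a)"
  have X: "X \<in> so" by (simp add: X_def so_iff transpose_def field_simps)
  moreover have "\<alpha> v = trace (v ** X)" if v: "v \<in> so" for v
  proof -
    have "v \<bullet> transpose a = (\<Sum>i\<in>UNIV. \<Sum>j\<in>UNIV. v $ i $ j * a $ j $ i)"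
      by (simp add: inner_mat transpose_def)
    also have "\<dots> = (\<Sum>i\<in>UNIV. \<Sum>j\<in>UNIV. - (v $ j $ i * a $ j $ i))"
      by (intro sum.cong refl) (metis so_nth[OF v] mult_minus_left)
    also have "\<dots> = - (v \<bullet> a)"
      unfolding inner_mat by (subst sum.swap) (simp add: sum_negf)
    finally show ?thesis
      using X by (simp add: trace_so a) (simp add: X_def inner_diff_right)
  qed
  ultimately show thesis using that by blast
qed

section \<open>Decomposable bivectors and transitivity on orthonormal frames\<close>

definition wedge :: "real^'n::finite \<Rightarrow> real^'n::finite \<Rightarrow> 'n rmat" where
  "wedge x y = (\<chi> i j. x $ i * y $ j - x $ j * y $ i)"

definition pluecker :: "'n::finite rmat \<Rightarrow> bool" where
  "pluecker p \<longleftrightarrow> (\<forall>i j k l. p $ i $ j * p $ k $ l - p $ i $ k * p $ j $ l + p $ i $ l * p $ j $ k = 0)"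

lemma wedge_nth: "wedge x y $ i $ j = x $ i * y $ j - x $ j * y $ i"
  by (simp add: wedge_def)

lemma wedge_so: "wedge x y \<in> so"
  by (simp add: so_iff wedge_nth)

lemma wedge_pluecker: "pluecker (wedge x y)"
  by (simp add: pluecker_def wedge_nth algebra_simps)

lemma wedge_mult: "wedge a b *v z = (b \<bullet> z) *\<^sub>R a - (a \<bullet> z) *\<^sub>R b"
  by (simp add: vec_eq_iff wedge_def matrix_vector_mult_def inner_vec_def
      sum_distrib_left sum_distrib_right sum_subtractf algebra_simps)

lemma wedge_self [simp]: "wedge x x = 0"
  by (simp add: wedge_def vec_eq_iff)

lemma wedge_simps:
  "wedge (x + x') y = wedge x y + wedge x' y" "wedge x (y + y') = wedge x y + wedge x y'"
  "wedge (c *\<^sub>R x) y = c *\<^sub>R wedge x y" "wedge x (c *\<^sub>R y) = c *\<^sub>R wedge x y"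
  "wedge (x - x') y = wedge x y - wedge x' y" "wedge x (y - y') = wedge x y - wedge x y'"
  "wedge 0 y = 0" "wedge x 0 = 0" "wedge (- x) y = - wedge x y" "wedge x (- y) = - wedge x y"
  by (simp_all add: wedge_def vec_eq_iff algebra_simps)

lemma wedge_anti: "wedge x y = - wedge y x"
  by (simp add: wedge_def vec_eq_iff)

lemma wedge_inner: "wedge x y \<bullet> wedge x y = 2 * ((x \<bullet> x) * (y \<bullet> y) - (x \<bullet> y)\<^sup>2)"
proof -
  have "wedge x y \<bullet> wedge x y =
    (\<Sum>i\<in>UNIV. \<Sum>j\<in>UNIV. (x $ i * x $ i) * (y $ j * y $ j)) + (\<Sum>i\<in>UNIV. \<Sum>j\<in>UNIV. (y $ i * y $ i) * (x $ j * x $ j))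
     - 2 * (\<Sum>i\<in>UNIV. \<Sum>j\<in>UNIV. (x $ i * y $ i) * (x $ j * y $ j))"
    unfolding inner_mat wedge_nth sum_distrib_left sum.distrib[symmetric] sum_subtractf[symmetric]
    by (intro sum.cong refl) (simp add: algebra_simps)
  also have "\<dots> = (x \<bullet> x) * (y \<bullet> y) + (y \<bullet> y) * (x \<bullet> x) - 2 * ((x \<bullet> y) * (x \<bullet> y))"
    by (simp only: inner_vec_def sum_product inner_real_def)
  finally show ?thesis
    by (simp add: power2_eq_square)
qed

lemma lie_wedge:
  fixes X :: "'n::finite rmat"
  assumes "X \<in> so"
  shows "lie X (wedge a b) = wedge (X *v a) b + wedge a (X *v b)"
proof -
  have X: "X $ k $ j = - X $ j $ k" for k j by (rule so_nth[OF assms])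
  have "lie X (wedge a b) $ i $ j = (wedge (X *v a) b + wedge a (X *v b)) $ i $ j" for i j
  proof -
    have "lie X (wedge a b) $ i $ j = (\<Sum>k\<in>UNIV. X $ i $ k * (a $ k * b $ j - a $ j * b $ k))
      + (\<Sum>k\<in>UNIV. (a $ i * b $ k - a $ k * b $ i) * X $ j $ k)"
      by (simp add: lie_def mat_mult_nth wedge_nth X[of _ j] sum_negf)
    then show ?thesis
      by (simp add: wedge_nth matrix_vector_mult_def sum_distrib_left sum_distrib_right
          sum_subtractf algebra_simps)
  qed
  then show ?thesis by (simp add: vec_eq_iff)
qed

lemma conj_wedge: "g ** wedge x y ** transpose g = wedge (g *v x) (g *v y)"
proof -
  have "(g ** wedge x y ** transpose g) $ i $ j = wedge (g *v x) (g *v y) $ i $ j" for i j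
  proof -
    have "(g ** wedge x y ** transpose g) $ i $ j =
      (\<Sum>l\<in>UNIV. \<Sum>k\<in>UNIV. g $ i $ k * x $ k * (g $ j $ l * y $ l)) -
      (\<Sum>l\<in>UNIV. \<Sum>k\<in>UNIV. g $ i $ k * y $ k * (g $ j $ l * x $ l))"
      unfolding mat_mult_nth transpose_def wedge_def sum_subtractf[symmetric]
      by (simp add: sum_distrib_left sum_distrib_right sum_subtractf algebra_simps)
    also have "\<dots> = (\<Sum>k\<in>UNIV. \<Sum>l\<in>UNIV. g $ i $ k * x $ k * (g $ j $ l * y $ l)) -
      (\<Sum>k\<in>UNIV. \<Sum>l\<in>UNIV. g $ i $ k * y $ k * (g $ j $ l * x $ l))"
      by (subst (1 2) sum.swap) (rule refl)
    also have "\<dots> = wedge (g *v x) (g *v y) $ i $ j"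
      unfolding wedge_nth matrix_vector_mult_def vec_lambda_beta sum_product[symmetric]
      by simp
    finally show ?thesis .
  qed
  then show ?thesis by (simp add: vec_eq_iff)
qed

definition frame :: "real^'n::finite \<Rightarrow> real^'n::finite \<Rightarrow> bool" where
  "frame x y \<longleftrightarrow> x \<bullet> x = 1 \<and> y \<bullet> y = 1 \<and> x \<bullet> y = 0"

lemma rho_phi_wedge:
  assumes "CARD('n::{finite,linorder}) \<ge> 2"
  defines "h \<equiv> hd_idx (CARD('n) div 2) :: 'n"
  shows "rho_phi = wedge (axis h 1) (axis (pr h) 1)" "pr h \<noteq> h"
proof -
  let ?N = "CARD('n) div 2"
  have N: "1 \<le> ?N" "?N \<le> CARD('n) div 2" using assms by auto
  have q: "CARD('n) mod 2 + 2 * (?N - 1) = CARD('n) - 2"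
    using assms(1) by (cases "even CARD('n)") (auto elim!: evenE oddE)
  have b: "blk h = ?N" "sg h = (1::real)" using blk_hd[OF N] by (auto simp: h_def)
  show n: "pr h \<noteq> h" using b N by (intro pr_neq) auto
  have "(rho_phi :: 'n rmat) $ i $ j = wedge (axis h 1) (axis (pr h) 1) $ i $ j" for i j
  proof -
    have *: "blk i = ?N \<longleftrightarrow> i = h \<or> i = pr h" using block_eq[OF N] by (auto simp: h_def)
    have "(rho_phi :: 'n rmat) $ i $ j = (if blk i = ?N \<and> j = pr i then sg i else 0)"
      unfolding rho_phi_def using sigma_block[OF N, of i j] q by simp
    then show ?thesis using n b unfolding * by (auto simp: wedge_nth axis_def)
  qed
  then show "rho_phi = wedge (axis h 1) (axis (pr h) 1)" by (simp add: vec_eq_iff)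
qed

lemma orthogonal_matrix_inner:
  fixes g :: "'n::finite rmat"
  assumes "orthogonal_matrix g" shows "(g *v x) \<bullet> (g *v y) = x \<bullet> y"
  using assms by (metis orthogonal_transformation_def orthogonal_transformation_matrix
      matrix_of_matrix_vector_mul matrix_vector_mul_linear)

lemma M_phi_frameD:
  assumes "CARD('n::{finite,linorder}) \<ge> 2" "(p :: 'n rmat) \<in> M_phi"
  obtains x y where "frame x y" "p = wedge x y"
proof -
  obtain g where g: "rotation_matrix g" "p = orb g" using assms by (auto simp: M_phi_def)
  let ?h = "hd_idx (CARD('n) div 2) :: 'n"
  let ?x = "axis ?h 1 :: 'n rvec" and ?y = "axis (pr ?h) 1 :: 'n rvec"
  have "p = wedge (g *v ?x) (g *v ?y)"
    unfolding g orb_def rho_phi_wedge(1)[OF assms(1)] by (rule conj_wedge)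
  moreover have "frame (g *v ?x) (g *v ?y)"
    using g rho_phi_wedge(2)[OF assms(1)]
    by (auto simp: rotation_matrix_def frame_def orthogonal_matrix_inner inner_axis_axis)
  ultimately show thesis using that by blast
qed

lemma det_diag_flip:
  "det (\<chi> i j. if i = j then (if i = k then - 1 else 1) else 0 :: real^'n::finite^'n::finite) = - 1"
  by (subst det_diagonal) (auto simp: prod.If_cases)

text \<open>A carries the first frame vector to x, and B fixes that vector while carrying the second
  one to the preimage of y under A. If A ** B has determinant -1, precomposing with the reflection
  of a third axis repairs it without moving the frame; this is where size at least 3 enters.\<close>

lemma frame_M_phi:
  assumes d: "CARD('n::{finite,linorder}) \<ge> 3" and fr: "frame x y"
  shows "wedge x y \<in> (M_phi :: 'n rmat set)"
proof -
  let ?h = "hd_idx (CARD('n) div 2) :: 'n"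
  have d2: "CARD('n) \<ge> 2" using d by simp
  have ne: "pr ?h \<noteq> ?h" by (rule rho_phi_wedge(2)[OF d2])
  let ?e = "axis ?h 1 :: 'n rvec" and ?f = "axis (pr ?h) 1 :: 'n rvec"
  have "norm x = 1" using fr by (simp add: frame_def norm_eq_1)
  then obtain A where A: "orthogonal_matrix A" "A *v ?e = x"
    using orthogonal_matrix_exists_basis by metis
  define z where "z = transpose A *v y"
  have At: "orthogonal_matrix (transpose A)" "transpose A ** A = mat 1" "A ** transpose A = mat 1"
    using A by (auto simp: orthogonal_matrix_def)
  have Az: "A *v z = y" unfolding z_def matrix_vector_mul_assoc At by simp
  have "transpose A *v x = ?e" unfolding A(2)[symmetric] matrix_vector_mul_assoc At by simp
  then have z: "z \<bullet> z = 1" "z \<bullet> ?e = 0"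
    using fr orthogonal_matrix_inner[OF At(1), of y y] orthogonal_matrix_inner[OF At(1), of y x]
    by (auto simp: z_def frame_def inner_commute)
  have f: "?f \<bullet> ?f = 1" "?f \<bullet> ?e = 0" using ne by (auto simp: inner_axis_axis)
  obtain B where B: "orthogonal_matrix B" "B *v ?e = ?e" "B *v ?f = z"
  proof (cases "z = ?f")
    case True
    then show ?thesis using that[of "mat 1"] by (simp add: orthogonal_matrix_def)
  next
    case False
    \<comment> \<open>R is the Householder reflection exchanging \<open>?f\<close> and z. Both are
      orthogonal to \<open>?e\<close>, so w is as well and \<open>?e\<close> stays fixed.\<close>
    define w where "w = z - ?f"
    define c where "c = 2 / (w \<bullet> w)"
    have w0: "w \<bullet> w \<noteq> 0" using False by (simp add: w_def)
    have ww: "w \<bullet> w = 2 - 2 * (z \<bullet> ?f)"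
      using z f by (simp add: w_def inner_diff_left inner_diff_right inner_commute)
    define R where "R = (\<lambda>v. v - (c * (w \<bullet> v)) *\<^sub>R w)"
    have lin: "linear R" unfolding R_def
      by (rule linearI) (simp_all add: inner_add_right algebra_simps)
    have cw: "c * (w \<bullet> w) = 2" using w0 by (simp add: c_def)
    have "R u \<bullet> R v = u \<bullet> v" for u v
    proof -
      have "R u \<bullet> R v = u \<bullet> v - 2 * c * (w \<bullet> u) * (w \<bullet> v) + (c * (w \<bullet> w)) * c * (w \<bullet> u) * (w \<bullet> v)"
        by (simp add: R_def inner_diff_left inner_diff_right inner_commute algebra_simps)
      then show ?thesis unfolding cw by simp
    qed
    then have "orthogonal_transformation R" using lin by (simp add: orthogonal_transformation_def)
    then have O: "orthogonal_matrix (matrix R)" by (simp add: orthogonal_transformation_matrix)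
    have "R ?e = ?e" using z f by (simp add: R_def w_def inner_diff_left)
    moreover have "R ?f = z"
    proof -
      have "w \<bullet> ?f = - (w \<bullet> w) / 2" unfolding ww using f by (simp add: w_def inner_diff_left)
      then have "c * (w \<bullet> ?f) = - 1" using cw by simp
      then show ?thesis by (simp add: R_def w_def)
    qed
    ultimately show ?thesis using that[OF O] lin by (simp add: matrix_works)
  qed
  have AB: "orthogonal_matrix (A ** B)" using A B by (simp add: orthogonal_matrix_mul)
  have ABe: "(A ** B) *v ?e = x" "(A ** B) *v ?f = y"
    using A B Az by (simp_all add: matrix_vector_mul_assoc[symmetric])
  obtain g where g: "rotation_matrix g" "g *v ?e = x" "g *v ?f = y"
  proof (cases "det (A ** B) = 1")
    case True
    then show ?thesis using that AB ABe by (simp add: rotation_matrix_def)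
  next
    case False
    then have det: "det (A ** B) = - 1" using det_orthogonal_matrix[OF AB] by simp
    have "card {?h, pr ?h} < CARD('n)" using d ne by simp
    then have "{?h, pr ?h} \<noteq> UNIV" by (metis less_irrefl)
    then obtain k where k: "k \<noteq> ?h" "k \<noteq> pr ?h" by blast
    define D where "D = (\<chi> i j. if i = j then (if i = k then - 1 else 1) else 0 :: 'n rmat)"
    have "(D ** D) $ i $ j = (mat 1 :: 'n rmat) $ i $ j" for i j
    proof -
      have "(D ** D) $ i $ j = (\<Sum>l\<in>UNIV. if l = i then (if i = j then 1 else 0) else 0)"
        unfolding mat_mult_nth by (intro sum.cong refl) (auto simp: D_def)
      then show ?thesis by (simp add: mat_def)
    qed
    then have "D ** D = mat 1" by (simp add: vec_eq_iff)
    moreover have "transpose D = D" by (auto simp: D_def transpose_def vec_eq_iff)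
    ultimately have "D ** D = mat 1" "transpose D = D" .
    then have "orthogonal_matrix D" by (simp add: orthogonal_matrix_def)
    moreover have "det D = - 1" unfolding D_def by (rule det_diag_flip)
    moreover have "D *v ?e = ?e" "D *v ?f = ?f"
      using k by (auto simp: D_def matrix_vector_mult_def axis_def vec_eq_iff if_distrib cong: if_cong)
    ultimately show ?thesis
      using that[of "(A ** B) ** D"] AB ABe det
      by (simp add: rotation_matrix_def orthogonal_matrix_mul det_mul matrix_vector_mul_assoc[symmetric])
  qed
  have "wedge x y = orb g" unfolding orb_def rho_phi_wedge(1)[OF d2] conj_wedge g by simp
  then show ?thesis using g by (auto simp: M_phi_def)
qed

lemma wedge_normal_form:
  assumes "x \<noteq> 0"
  shows "wedge x y = wedge (x /\<^sub>R norm x) (norm x *\<^sub>R (y - ((x \<bullet> y) / (x \<bullet> x)) *\<^sub>R x))"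
  using assms by (simp add: wedge_simps)

text \<open>Gram-Schmidt does not change the bivector if x and y are rescaled reciprocally; the norm
  then forces the second vector to be a unit vector. So any nonzero decomposable bivector reaches
  the orbit by scaling, which the constructions of points and curves exploit.\<close>

lemma wedge_M_phi:
  assumes d: "CARD('n::{finite,linorder}) \<ge> 3" and n: "wedge x y \<bullet> wedge x y = 2"
  shows "wedge x y \<in> (M_phi :: 'n rmat set)"
proof -
  have x0: "x \<noteq> 0" using n by (auto simp: wedge_simps)
  define X where "X = x /\<^sub>R norm x"
  define Y where "Y = norm x *\<^sub>R (y - ((x \<bullet> y) / (x \<bullet> x)) *\<^sub>R x)"
  have XY: "wedge x y = wedge X Y" unfolding X_def Y_def by (rule wedge_normal_form[OF x0])
  have X: "X \<bullet> X = 1" using x0 by (simp add: X_def dot_square_norm power2_eq_square)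
  have "X \<bullet> Y = 0" using x0 by (simp add: X_def Y_def inner_diff_right)
  moreover from this have "Y \<bullet> Y = 1" using n X unfolding XY wedge_inner by simp
  ultimately show ?thesis unfolding XY using X by (intro frame_M_phi[OF d]) (simp add: frame_def)
qed

text \<open>Solving the Pluecker relation for an entry next to a nonzero pivot p_ab exhibits p as
  the wedge of its rows a and b, divided by p_ab.\<close>

lemma pluecker_wedge:
  assumes p: "p \<in> so" "pluecker p"
  shows "\<exists>x y. p = wedge x y"
proof (cases "p = 0")
  case True
  then have "p = wedge 0 0" by (simp add: wedge_simps)
  then show ?thesis by blast
next
  case False
  then obtain a b where ab: "p $ a $ b \<noteq> 0" by (auto simp: vec_eq_iff)
  have "p $ i $ j = wedge ((1 / p $ a $ b) *\<^sub>R (p $ a)) (p $ b) $ i $ j" for i j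
  proof -
    have "p $ a $ b * p $ i $ j - p $ a $ i * p $ b $ j + p $ a $ j * p $ b $ i = 0"
      using p(2) unfolding pluecker_def by blast
    then have "p $ i $ j * p $ a $ b = p $ a $ i * p $ b $ j - p $ a $ j * p $ b $ i"
      by (simp add: mult.commute)
    then have "p $ i $ j = (p $ a $ i * p $ b $ j - p $ a $ j * p $ b $ i) / p $ a $ b"
      using ab by (rule eq_divide_imp[rotated])
    then show ?thesis by (simp add: wedge_nth diff_divide_distrib)
  qed
  then have "p = wedge ((1 / p $ a $ b) *\<^sub>R (p $ a)) (p $ b)" unfolding vec_eq_iff by blast
  then show ?thesis by blast
qed

lemma M_phi_iff:
  assumes d: "CARD('n::{finite,linorder}) \<ge> 3"
  shows "(p :: 'n rmat) \<in> M_phi \<longleftrightarrow> p \<in> so \<and> pluecker p \<and> p \<bullet> p = 2"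
proof
  assume "p \<in> M_phi"
  then obtain x y where xy: "frame x y" "p = wedge x y" using d by (elim M_phi_frameD[rotated]) auto
  then show "p \<in> so \<and> pluecker p \<and> p \<bullet> p = 2"
    by (auto simp: wedge_so wedge_pluecker wedge_inner frame_def)
next
  assume "p \<in> so \<and> pluecker p \<and> p \<bullet> p = 2"
  then show "p \<in> M_phi" using pluecker_wedge[of p] wedge_M_phi[OF d] by auto
qed

section \<open>Tangent spaces of the orbit and their complex structure\<close>

lemma tangent_subset_so: "p \<in> so \<Longrightarrow> tangent p \<subseteq> so"
  by (auto simp: tangent_def so_lie)

lemma lie_in_tangent: "A \<in> so \<Longrightarrow> lie p A \<in> tangent (p :: 'n::finite rmat)"
proof -
  assume "A \<in> so"
  then have "- A \<in> so" by (rule so_uminus)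
  moreover have "lie p A = lie (- A) p" by (simp add: lie_anti[of p A] lie_minus_left)
  ultimately show ?thesis unfolding tangent_def by blast
qed

lemma subspace_tangent: "subspace (tangent (p :: 'n::finite rmat))"
proof -
  have "tangent p = (\<lambda>X. lie X p) ` so" by (auto simp: tangent_def)
  moreover have "linear (\<lambda>X. lie X p)" by (rule linearI) (simp_all add: lie_add_left lie_scaleR_left)
  ultimately show ?thesis using linear_subspace_image[OF _ subspace_so] by metis
qed

text \<open>w and u are the displacements of x and y. Their components in the plane of the frame
  drop out: X x has no x-component and X y no y-component by antisymmetry, while the cross
  components are wedged with themselves. Thus the tangent space is two copies of the orthogonal
  complement of the plane.\<close>

lemma frame_tangent:
  assumes fr: "frame x y"
  shows "tangent (wedge x y) = {wedge w y + wedge x u | w u. w \<bullet> x = 0 \<and> w \<bullet> y = 0 \<and> u \<bullet> x = 0 \<and> u \<bullet> y = 0}"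
    (is "?L = ?R")
proof
  show "?L \<subseteq> ?R"
  proof
    fix v assume "v \<in> ?L"
    then obtain X where X: "X \<in> so" "v = lie X (wedge x y)" by (auto simp: tangent_def)
    let ?a = "(X *v x) \<bullet> y" and ?b = "(X *v y) \<bullet> x"
    define w where "w = X *v x - ?a *\<^sub>R y"
    define u where "u = X *v y - ?b *\<^sub>R x"
    have skew: "(X *v z) \<bullet> z = 0" for z
    proof -
      have "(X *v z) \<bullet> z = z \<bullet> (transpose X *v z)"
        by (metis dot_lmul_matrix inner_commute transpose_transpose vector_transpose_matrix)
      also have "transpose X = - X" using X by (simp add: so_def)
      also have "z \<bullet> (- X *v z) = - ((X *v z) \<bullet> z)"
        by (simp add: matrix_vector_mult_def inner_vec_def sum_negf mult.commute)
      finally show ?thesis by simp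
    qed
    have "v = wedge w y + wedge x u"
      unfolding X(2) lie_wedge[OF X(1)] w_def u_def by (simp add: wedge_simps)
    moreover have "w \<bullet> x = 0" "w \<bullet> y = 0" "u \<bullet> x = 0" "u \<bullet> y = 0"
      using fr skew by (auto simp: w_def u_def frame_def inner_diff_left inner_diff_right inner_commute)
    ultimately show "v \<in> ?R" by blast
  qed
  show "?R \<subseteq> ?L"
  proof
    fix v assume "v \<in> ?R"
    then obtain w u where *: "w \<bullet> x = 0" "w \<bullet> y = 0" "u \<bullet> x = 0" "u \<bullet> y = 0" "v = wedge w y + wedge x u" by auto
    \<comment> \<open>An infinitesimal rotation that sends x to w and y to u.\<close>
    let ?X = "wedge w x + wedge u y"
    have "?X \<in> so" by (simp add: so_add wedge_so)
    moreover have "?X *v x = w" "?X *v y = u"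
      using * fr by (auto simp: matrix_vector_mult_add_rdistrib wedge_mult frame_def inner_commute)
    ultimately show "v \<in> ?L" unfolding tangent_def *(5) by (force simp: lie_wedge)
  qed
qed

text \<open>In the coordinates (w, u) the map ad p is the quarter turn (w, u) to (u, -w), whence its
  square is -1 on the tangent space.\<close>

lemma frame_lie:
  assumes fr: "frame x y" and wu: "w \<bullet> x = 0" "w \<bullet> y = 0" "u \<bullet> x = 0" "u \<bullet> y = 0"
  shows "lie (wedge x y) (wedge w y + wedge x u) = wedge u y + wedge x (- w)"
  using assms unfolding lie_add_right lie_wedge[OF wedge_so] wedge_mult
  by (simp add: frame_def wedge_simps inner_commute wedge_anti[of x w] wedge_anti[of y u])

lemma lie_lie_frame:
  assumes fr: "frame x y" and v: "v \<in> tangent (wedge x y)"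
  shows "lie (wedge x y) (lie (wedge x y) v) = - v"
proof -
  obtain w u where *: "w \<bullet> x = 0" "w \<bullet> y = 0" "u \<bullet> x = 0" "u \<bullet> y = 0" "v = wedge w y + wedge x u"
    using v unfolding frame_tangent[OF fr] by auto
  then show ?thesis using frame_lie[OF fr, of w u] frame_lie[OF fr, of u "- w"]
    by (simp add: wedge_simps)
qed

lemma dim_frame_tangent:
  fixes x y :: "real^'n::finite"
  assumes fr: "frame x y"
  shows "dim (tangent (wedge x y)) = 2 * (CARD('n) - 2)"
proof -
  let ?W = "{w. w \<bullet> x = 0 \<and> w \<bullet> y = 0}"
  let ?f = "\<lambda>(w, u). wedge w y + wedge x u"
  have W: "subspace ?W" by (rule subspaceI) (auto simp: inner_add_left)
  have WW: "subspace (?W \<times> ?W)" by (rule subspaceI) (auto simp: inner_add_left zero_prod_def)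
  have lin: "linear ?f" by (rule linearI) (auto simp: wedge_simps scaleR_right_distrib)
  have "inj_on ?f (?W \<times> ?W)"
  proof -
    have "w = 0 \<and> u = 0" if *: "w \<in> ?W" "u \<in> ?W" "wedge w y + wedge x u = 0" for w u
    proof -
      \<comment> \<open>The displacements are recovered by applying the matrix to the frame
        vectors.\<close>
      have "(wedge w y + wedge x u) *v y = w" "(wedge w y + wedge x u) *v x = - u"
        using * fr unfolding matrix_vector_mult_add_rdistrib wedge_mult
        by (auto simp: frame_def inner_commute)
      then show ?thesis using *(3) by simp
    qed
    then have "\<forall>z\<in>?W \<times> ?W. ?f z = 0 \<longrightarrow> z = 0" by (auto simp: zero_prod_def)
    then show ?thesis by (simp add: linear_injective_on_subspace_0[OF lin WW])
  qed
  then have "inj_on ?f (span (?W \<times> ?W))" using WW by (simp only: span_eq_iff[THEN iffD2])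
  then have "dim (?f ` (?W \<times> ?W)) = dim (?W \<times> ?W)" by (rule dim_image_eq[OF lin])
  moreover have "tangent (wedge x y) = ?f ` (?W \<times> ?W)" unfolding frame_tangent[OF fr] by auto
  ultimately have "dim (tangent (wedge x y)) = dim (?W \<times> ?W)" by simp
  also have "\<dots> = 2 * dim ?W" using dim_Times[OF W W] by simp
  also have "dim ?W = CARD('n) - 2"
  proof -
    have xy: "x \<noteq> y" "x \<noteq> 0" "y \<noteq> 0" using fr by (auto simp: frame_def)
    have "independent {x, y}"
      by (rule pairwise_orthogonal_independent)
        (use fr xy in \<open>auto simp: pairwise_def orthogonal_def frame_def inner_commute\<close>)
    then have "dim (span {x, y}) = 2" using xy by (simp add: dim_eq_card_independent)
    moreover have "{z \<in> UNIV. \<forall>a\<in>span {x, y}. orthogonal a z} = ?W"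
    proof -
      have "(\<forall>a\<in>span {x, y}. orthogonal a z) \<longleftrightarrow> z \<bullet> x = 0 \<and> z \<bullet> y = 0" for z
      proof
        assume "\<forall>a\<in>span {x, y}. orthogonal a z"
        then show "z \<bullet> x = 0 \<and> z \<bullet> y = 0"
          using span_base[of x "{x, y}"] span_base[of y "{x, y}"] by (auto simp: orthogonal_def inner_commute)
      next
        assume "z \<bullet> x = 0 \<and> z \<bullet> y = 0"
        then show "\<forall>a\<in>span {x, y}. orthogonal a z"
          using orthogonal_to_span[of _ "{x, y}" z] by (auto simp: orthogonal_def inner_commute)
      qed
      then show ?thesis by auto
    qed
    ultimately show ?thesis
      using dim_subspace_orthogonal_to_vectors[of "span {x, y}" UNIV] by simp
  qed
  finally show ?thesis .
qed

text \<open>The orthogonal complement of the tangent space in \<open>so\<close> lies in the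
  centralizer of p. Hence [p, X] depends only on the covector represented by X.\<close>

lemma frame_orthogonal_tangent:
  fixes A p :: "'n::finite rmat"
  assumes p: "p \<in> so" and A: "A \<in> so" "\<And>v. v \<in> tangent p \<Longrightarrow> v \<bullet> A = 0"
  shows "lie p A = 0"
proof (rule so_zero_inner[OF so_lie[OF p A(1)]])
  fix X :: "'n rmat" assume "X \<in> so"
  then have "lie p X \<bullet> A = 0" by (intro A lie_in_tangent)
  then show "lie p A \<bullet> X = 0" using inner_lie[OF p, of A X] by (simp add: inner_commute)
qed

lemma tangent_pluecker:
  fixes x y :: "real^'n::finite"
  assumes "v \<in> tangent (wedge x y)"
  defines "p \<equiv> wedge x y"
  shows "p $ i $ j * v $ k $ l - p $ i $ k * v $ j $ l + p $ i $ l * v $ j $ k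
       + v $ i $ j * p $ k $ l - v $ i $ k * p $ j $ l + v $ i $ l * p $ j $ k = 0"
proof -
  obtain X where X: "X \<in> so" "v = lie X p" using assms by (auto simp: tangent_def)
  show ?thesis unfolding X p_def lie_wedge[OF X(1)] vector_add_component wedge_nth
    by (simp add: algebra_simps)
qed

lemma tangent_inner:
  assumes "v \<in> tangent p" "p \<in> so" shows "p \<bullet> v = 0"
proof -
  obtain X where X: "X \<in> so" "v = lie X p" using assms by (auto simp: tangent_def)
  have "lie X p \<bullet> p = - (p \<bullet> lie X p)" by (rule inner_lie[OF X(1)])
  then show ?thesis by (simp add: X inner_commute)
qed

subsection \<open>The bivectors as maps\<close>

lemma functional_eqI:
  fixes v w :: "'a::real_inner"
  assumes *: "\<And>\<beta> :: 'a \<Rightarrow> real. linear \<beta> \<Longrightarrow> \<beta> v = \<beta> w"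
  shows "v = w"
proof -
  have "linear (\<lambda>z. z \<bullet> (v - w))" by (rule linearI) (simp_all add: inner_add_left)
  from *[OF this] have "(v - w) \<bullet> (v - w) = 0" by (simp add: inner_diff_left)
  then show ?thesis by simp
qed

lemma sharp_eq:
  fixes p :: "'n::finite rmat"
  assumes "v \<in> tangent p" "\<And>\<beta>. linear \<beta> \<Longrightarrow> \<beta> v = P \<alpha> \<beta>"
  shows "sharp P p \<alpha> = v"
  unfolding sharp_def
proof (rule the_equality)
  fix w assume "w \<in> tangent p \<and> (\<forall>\<beta>. linear \<beta> \<longrightarrow> \<beta> w = P \<alpha> \<beta>)"
  then have "\<beta> w = \<beta> v" if "linear \<beta>" for \<beta> :: "'n rmat \<Rightarrow> real" using assms(2)[OF that] that by simp
  then show "w = v" by (rule functional_eqI)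
qed (use assms in auto)

text \<open>Two representatives of one covector differ by an element commuting with p, so the value
  in the definite description is independent of the choice; invariance of the trace form rewrites it
  as \<beta> applied to [p, X].\<close>

lemma kks_eq:
  fixes p :: "'n::finite rmat"
  assumes p: "p \<in> so" and X: "X \<in> so" "\<And>v. v \<in> tangent p \<Longrightarrow> \<alpha> v = trace (v ** X)"
    and \<beta>: "linear \<beta>"
  shows "kks p \<alpha> \<beta> = \<beta> (lie p X)"
proof -
  have T: "v \<in> so" if "v \<in> tangent p" for v using tangent_subset_so[OF p] that by auto
  obtain Y where Y: "Y \<in> so" "\<And>v. v \<in> so \<Longrightarrow> \<beta> v = trace (v ** Y)" by (rule functional_so[OF \<beta>]) blast
  have key: "trace (p ** lie X' Y') = \<beta> (lie p X)"
    if *: "X' \<in> so" "Y' \<in> so" "\<forall>v\<in>tangent p. \<alpha> v = trace (v ** X')" "\<forall>v\<in>tangent p. \<beta> v = trace (v ** Y')" for X' Y'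
  proof -
    have "lie p (X - X') = 0"
    proof (rule frame_orthogonal_tangent[OF p so_diff[OF X(1) *(1)]])
      fix v assume "v \<in> tangent p"
      then have "trace (v ** X) = trace (v ** X')" using X(2) *(3) by metis
      then show "v \<bullet> (X - X') = 0" using X(1) *(1) by (simp add: trace_so inner_diff_right)
    qed
    then have eq: "lie p X = lie p X'" by (simp add: lie_diff_right)
    have "trace (p ** lie X' Y') = - (p \<bullet> lie X' Y')" using * by (intro trace_so so_lie) auto
    also have "\<dots> = lie X' p \<bullet> Y'" using inner_lie[OF *(1), of p Y'] by simp
    also have "\<dots> = - (lie p X' \<bullet> Y')" by (subst lie_anti) simp
    also have "\<dots> = trace (lie p X' ** Y')" using * by (simp add: trace_so)
    also have "\<dots> = \<beta> (lie p X)" using *(4) lie_in_tangent[OF *(1), of p] eq by simp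
    finally show ?thesis .
  qed
  show ?thesis unfolding kks_def
  proof (rule the_equality)
    fix c assume "\<forall>X\<in>so. \<forall>Y\<in>so. (\<forall>v\<in>tangent p. \<alpha> v = trace (v ** X)) \<longrightarrow>
      (\<forall>v\<in>tangent p. \<beta> v = trace (v ** Y)) \<longrightarrow> c = trace (p ** lie X Y)"
    then have "c = trace (p ** lie X Y)" using X Y T by blast
    then show "c = \<beta> (lie p X)" using key[of X Y] X Y T by simp
  qed (use key in auto)
qed

lemma sharp_kks:
  fixes p :: "'n::finite rmat"
  assumes p: "p \<in> so" and X: "X \<in> so" "\<And>v. v \<in> tangent p \<Longrightarrow> \<alpha> v = trace (v ** X)"
  shows "sharp (kks p) p \<alpha> = lie p X"
  by (rule sharp_eq) (simp_all add: lie_in_tangent X kks_eq[OF p X])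

text \<open>The witness that the choice operator has a candidate is -[p, v], since ad p squares to
  -1. The covector actually chosen is only known up to its values off the tangent space, so its
  representative X is pinned down only by [p, X] = v, which is all that later steps use.\<close>

lemma Omega_kks_rep:
  fixes x y :: "real^'n::finite"
  assumes fr: "frame x y" and v: "v \<in> tangent (wedge x y)"
  defines "p \<equiv> wedge x y"
  obtains X where "X \<in> so" "\<And>z. z \<in> so \<Longrightarrow> Omega_kks p v z = trace (z ** X)" "lie p X = v"
proof -
  have p: "p \<in> so" by (simp add: p_def wedge_so)
  have T: "v \<in> so" if "v \<in> tangent p" for v using tangent_subset_so[OF p] that by auto
  let ?X = "- lie p v"
  have X: "?X \<in> so" using p T v by (simp add: so_lie so_uminus p_def)
  have "linear (\<lambda>z. trace (z ** ?X))" unfolding trace_so[OF X]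
    by (rule linearI) (simp_all add: inner_add_left)
  moreover have "sharp (kks p) p (\<lambda>z. trace (z ** ?X)) = v"
    using sharp_kks[OF p X] lie_lie_frame[OF fr v] by (simp add: lie_minus_right p_def)
  ultimately have *: "linear (Omega_kks p v)" "sharp (kks p) p (Omega_kks p v) = v"
    unfolding Omega_kks_def by (metis (mono_tags, lifting) someI_ex)+
  obtain X where "X \<in> so" "\<And>z. z \<in> so \<Longrightarrow> Omega_kks p v z = trace (z ** X)"
    by (rule functional_so[OF *(1)]) blast
  moreover from this have "lie p X = v" using sharp_kks[OF p, of X "Omega_kks p v"] *(2) T by simp
  ultimately show thesis using that by blast
qed

lemma pull_back_eq:
  fixes p :: "'n::finite rmat"
  assumes p: "p \<in> so" and X: "X \<in> so" "\<And>z. z \<in> so \<Longrightarrow> \<alpha> z = trace (z ** X)"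
  shows "pull_back p \<alpha> = lie p X"
  unfolding pull_back_def trace_dual_def
proof (rule the_equality)
  have *: "trace (lie p X ** Z) = \<alpha> (lie Z p)" if "Z \<in> so" for Z
  proof -
    have "\<alpha> (lie Z p) = - (lie Z p \<bullet> X)" using X(2)[of "lie Z p"] that p X(1) by (simp add: so_lie trace_so)
    also have "\<dots> = lie p Z \<bullet> X" by (subst lie_anti) simp
    also have "\<dots> = - (lie p X \<bullet> Z)" using inner_lie[OF p, of Z X] by (simp add: inner_commute)
    finally show ?thesis using that by (simp add: trace_so)
  qed
  then show "lie p X \<in> so \<and> (\<forall>Xa\<in>so. trace (lie p X ** Xa) = \<alpha> (lie Xa p))"
    using p X so_lie by blast
  fix \<xi> assume \<xi>: "\<xi> \<in> so \<and> (\<forall>X\<in>so. trace (\<xi> ** X) = \<alpha> (lie X p))"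
  have "\<xi> - lie p X = 0"
  proof (rule so_zero_inner)
    show "\<xi> - lie p X \<in> so" using \<xi> p X by (simp add: so_diff so_lie)
    fix Z :: "'n rmat" assume Z: "Z \<in> so"
    then have "trace (\<xi> ** Z) = trace (lie p X ** Z)" using * \<xi> by simp
    then show "(\<xi> - lie p X) \<bullet> Z = 0" using Z by (simp add: trace_so inner_diff_left)
  qed
  then show "\<xi> = lie p X" by simp
qed

section \<open>The Poisson-Lie bivector in closed form\<close>

lemma cplx_simps:
  "cplx (A + B) = cplx A + cplx B" "cplx (A - B) = cplx A - cplx B" "cplx (- A) = - cplx A"
  "cplx (A ** B) = cplx A ** cplx B"
  by (simp_all add: vec_eq_iff mat_mult_nth)

lemma cplx_Jb: "Jb (cplx A) = cplx (Jb A)"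
  by (simp add: vec_eq_iff Jb_def sg_def)

lemma cplx_so: "A \<in> so \<Longrightarrow> cplx A \<in> so"
  unfolding so_iff by (metis cplx_nth of_real_minus)

lemma C_minus_eq:
  fixes X :: "'n::{finite,linorder} rmat"
  shows "X \<in> so \<Longrightarrow> C_minus X = cscale \<i> (cplx X) - cplx (Jb X)"
  by (simp add: C_minus_def J_eq_Jb cplx_so cplx_Jb)

lemma cplx_decomp_unique:
  assumes "cplx A + cscale \<i> (cplx B) = cplx A' + cscale \<i> (cplx B')"
  shows "A = A' \<and> B = B'"
proof -
  have "A $ i $ j = A' $ i $ j \<and> B $ i $ j = B' $ i $ j" for i j
    using arg_cong[OF assms, of "\<lambda>Z. Z $ i $ j"] by (simp add: complex_eq_iff)
  then show ?thesis by (simp add: vec_eq_iff)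
qed

text \<open>Since \<open>C_minus\<close> B = \<i> B - J B, the imaginary part B determines the
  component in \<open>b_minus\<close>, and the remainder A + J B is real.\<close>

lemma
  fixes A B :: "'n::{finite,linorder} rmat"
  assumes A: "A \<in> so" and B: "B \<in> so"
  shows pr_g_eq: "pr_g (cplx A + cscale \<i> (cplx B)) = cplx (A + Jb B)"
    and pr_b_eq: "pr_b (cplx A + cscale \<i> (cplx B)) = C_minus B"
proof -
  let ?Z = "cplx A + cscale \<i> (cplx B)"
  have eq: "?Z = cplx (A + Jb B) + C_minus B" using C_minus_eq[OF B] by (simp add: cplx_simps)
  have AB: "A + Jb B \<in> so" using A B by (simp add: so_add so_Jb)
  have uniq: "B' = B \<and> A' = A + Jb B" if "A' \<in> so" "B' \<in> so" "?Z = cplx A' + C_minus B'" for A' B'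
  proof -
    have "?Z = cplx (A' - Jb B') + cscale \<i> (cplx B')"
      using that(3) C_minus_eq[OF that(2)] by (simp add: cplx_simps)
    from cplx_decomp_unique[OF this] show ?thesis by auto
  qed
  show "pr_g ?Z = cplx (A + Jb B)" unfolding pr_g_def
  proof (rule the_equality)
    show "cplx (A + Jb B) \<in> cplx ` so \<and> ?Z - cplx (A + Jb B) \<in> b_minus"
      using AB B by (auto simp: b_minus_def eq)
    fix C assume "C \<in> cplx ` so \<and> ?Z - C \<in> b_minus"
    then obtain A' B' where "C = cplx A'" "A' \<in> so" "B' \<in> so" "?Z - C = C_minus B'"
      by (auto simp: b_minus_def)
    moreover from this have "?Z = cplx A' + C_minus B'" by (metis add.commute diff_add_cancel)
    ultimately show "C = cplx (A + Jb B)" using uniq by blast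
  qed
  show "pr_b ?Z = C_minus B" unfolding pr_b_def
  proof (rule the_equality)
    show "C_minus B \<in> b_minus \<and> ?Z - C_minus B \<in> cplx ` so"
      using AB B by (auto simp: b_minus_def eq)
    fix C assume "C \<in> b_minus \<and> ?Z - C \<in> cplx ` so"
    then obtain A' B' where "C = C_minus B'" "A' \<in> so" "B' \<in> so" "?Z - C = cplx A'"
      by (auto simp: b_minus_def)
    moreover from this have "?Z = cplx A' + C_minus B'" by (metis add.commute diff_add_cancel)
    ultimately show "C = C_minus B" using uniq by blast
  qed
qed

lemma so_conj:
  fixes g :: "'n::finite rmat"
  assumes "A \<in> so" shows "transpose g ** A ** g \<in> so"
proof -
  have "transpose (transpose g ** A ** g) = transpose g ** (- A ** g)"
    using assms by (simp add: so_def matrix_transpose_mul matrix_mul_assoc)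
  also have "\<dots> = - (transpose g ** A ** g)"
    unfolding matrix_mul_assoc[symmetric] by (simp add: matrix_matrix_mult_def sum_negf vec_eq_iff)
  finally show ?thesis by (simp add: so_def)
qed

lemma Ad_inv_C_minus:
  fixes g :: "'n::{finite,linorder} rmat"
  assumes "X \<in> so"
  shows "Ad_inv g (C_minus X) = cplx (- (transpose g ** Jb X ** g)) + cscale \<i> (cplx (transpose g ** X ** g))"
proof -
  have "Ad_inv g (C_minus X) = cscale \<i> (cplx (transpose g) ** cplx X ** cplx g) - cplx (transpose g) ** cplx (Jb X) ** cplx g"
    unfolding Ad_inv_def C_minus_eq[OF assms]
    by (simp add: vec_eq_iff mat_mult_nth sum_distrib_left sum_distrib_right sum_subtractf algebra_simps)
  then show ?thesis by (simp add: cplx_simps)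
qed

text \<open>The familiar expression J o Ad - Ad o J of an r-matrix bracket, with Ad conjugation by
  the inverse of g. In the pairing only the \<i> B part of \<open>C_minus\<close> B contributes an
  imaginary part, because all other matrices are real.\<close>

lemma pi_G_eq:
  fixes g :: "'n::{finite,linorder} rmat"
  assumes \<xi>: "\<xi> \<in> so" and \<eta>: "\<eta> \<in> so"
  shows "pi_G g \<xi> \<eta> = trace ((Jb (transpose g ** \<xi> ** g) - transpose g ** Jb \<xi> ** g) ** (transpose g ** \<eta> ** g))"
proof -
  let ?Ad = "\<lambda>X. transpose g ** X ** g"
  let ?P = "Jb (?Ad \<xi>) - ?Ad (Jb \<xi>)"
  have "pr_g (Ad_inv g (C_minus \<xi>)) = cplx ?P"
    unfolding Ad_inv_C_minus[OF \<xi>] using \<xi> by (subst pr_g_eq) (auto simp: so_conj so_Jb so_uminus)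
  moreover have "pr_b (Ad_inv g (C_minus \<eta>)) = C_minus (?Ad \<eta>)"
    unfolding Ad_inv_C_minus[OF \<eta>] using \<eta> by (subst pr_b_eq) (auto simp: so_conj so_Jb so_uminus)
  moreover have "Im (trace (cplx A ** C_minus B)) = trace (A ** B)" if "B \<in> so" for A B :: "'n rmat"
    unfolding C_minus_eq[OF that] by (simp add: trace_def mat_mult_nth)
  ultimately show ?thesis unfolding pi_G_def using so_conj[OF \<eta>] by simp
qed

text \<open>Tangent vectors at \<open>rho_phi\<close> have entries only between the top block and
  lower blocks. There the higher index is the one in the top block, and sigma acting on it is the
  bracket with \<open>rho_phi\<close>.\<close>

lemma Jb_tangent_rho:
  fixes v :: "'n::{finite,linorder} rmat"
  assumes d: "CARD('n) \<ge> 2" and v: "v \<in> tangent rho_phi"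
  shows "Jb v = lie rho_phi v"
proof -
  let ?N = "CARD('n) div 2"
  have N: "1 \<le> ?N" "?N \<le> CARD('n) div 2" using d by auto
  have q: "CARD('n) mod 2 + 2 * (?N - 1) = CARD('n) - 2"
    using d by (cases "even CARD('n)") (auto elim!: evenE oddE)
  let ?t = "\<lambda>c. if c = ?N then 1 else 0 :: real"
  have rho: "(rho_phi :: 'n rmat) $ i $ j = (if j = pr i then ?t (blk i) * sg i else 0)" for i j
    unfolding rho_phi_def using sigma_block[OF N, of i j] unfolding q by auto
  obtain X where X: "X \<in> so" "v = lie X rho_phi" using v by (auto simp: tangent_def)
  have v': "v = - lie rho_phi X" unfolding X(2) by (rule lie_anti)
  have low: "v $ i $ j = 0" if "blk i \<noteq> ?N" "blk j \<noteq> ?N" for i j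
    unfolding v' using lie_block_diag[OF rho, of X i j] that by simp
  have high: "v $ i $ j = 0" if ij: "blk i = ?N" "blk j = ?N" for i j
  proof -
    have "j = i \<or> j = pr i" using ij blk_eqD by metis
    then have "lie rho_phi X $ i $ j = 0"
    proof
      assume "j = pr i"
      then show ?thesis using lie_block_diag[OF rho, of X i j] ij so_diag[OF X(1)] by simp
    next
      assume "j = i"
      then show ?thesis using lie_block_diag[OF rho, of X i j] ij so_nth[OF X(1), of "pr i" i]
        by simp
    qed
    then show ?thesis by (simp add: v')
  qed
  have "Jb v $ i $ j = lie rho_phi v $ i $ j" for i j
  proof -
    have le: "blk i \<le> ?N" "blk j \<le> ?N" by (rule blk_le)+
    have L: "lie rho_phi v $ i $ j = ?t (blk i) * sg i * v $ pr i $ j + ?t (blk j) * sg j * v $ i $ pr j"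
      by (rule lie_block_diag[OF rho])
    consider "blk i = ?N" "blk j = ?N" | "blk i < ?N" "blk j < ?N" | "blk i = ?N" "blk j < ?N" | "blk i < ?N" "blk j = ?N"
      using le by linarith
    then show ?thesis
    proof cases
      case 1 then show ?thesis unfolding L using high[of "pr i" j] high[of i "pr j"] by (simp add: Jb_def)
    next
      case 2 then show ?thesis unfolding L using low[of "pr i" j] low[of i "pr j"] by (simp add: Jb_def)
    qed (auto simp: L Jb_def)
  qed
  then show ?thesis by (simp add: vec_eq_iff)
qed

text \<open>Conjugating \<open>Jb_tangent_rho\<close> by g turns the term J o Ad into ad p with p =
  \<open>orb g\<close>. The result involves g only through p, which makes \<open>pi_0\<close> well
  defined.\<close>

lemma pi_G_tangent:
  fixes g :: "'n::{finite,linorder} rmat"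
  assumes d: "CARD('n) \<ge> 2" and g: "rotation_matrix g" and \<xi>: "\<xi> \<in> tangent (orb g)" and \<eta>: "\<eta> \<in> so"
  shows "pi_G g \<xi> \<eta> = trace ((lie (orb g) \<xi> - Jb \<xi>) ** \<eta>)"
proof -
  have gg: "transpose g ** g = mat 1" "g ** transpose g = mat 1"
    using g by (auto simp: rotation_matrix_def orthogonal_matrix_def)
  have c1: "transpose g ** (g ** A) = A" "g ** (transpose g ** A) = A" for A
    by (simp_all add: matrix_mul_assoc gg)
  let ?Ad = "\<lambda>X. transpose g ** X ** g"
  have rho: "(rho_phi :: 'n rmat) \<in> so" using rho_phi_wedge(1)[where 'n='n] d wedge_so by metis
  have p: "orb g \<in> so" unfolding orb_def using so_conj[OF rho, of "transpose g"] by simp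
  have \<xi>so: "\<xi> \<in> so" using tangent_subset_so[OF p] \<xi> by auto
  have Adlie: "?Ad (lie A B) = lie (?Ad A) (?Ad B)" for A B
  proof -
    have "?Ad (A ** B - B ** A) = ?Ad (A ** B) - ?Ad (B ** A)"
      by (simp add: vec_eq_iff mat_mult_nth sum_subtractf sum_distrib_left sum_distrib_right algebra_simps)
    then show ?thesis by (simp add: lie_def matrix_mul_assoc[symmetric] c1)
  qed
  have Adp: "?Ad (orb g) = rho_phi" unfolding orb_def by (simp add: matrix_mul_assoc[symmetric] c1 gg)
  obtain X where X: "X \<in> so" "\<xi> = lie X (orb g)" using \<xi> by (auto simp: tangent_def)
  have "?Ad \<xi> \<in> tangent rho_phi" unfolding X(2) Adlie Adp tangent_def using so_conj[OF X(1)] by auto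
  then have "Jb (?Ad \<xi>) = ?Ad (lie (orb g) \<xi>)" using Jb_tangent_rho[OF d] Adlie Adp by metis
  then have "pi_G g \<xi> \<eta> = trace ((?Ad (lie (orb g) \<xi>) - ?Ad (Jb \<xi>)) ** ?Ad \<eta>)"
    using pi_G_eq[OF \<xi>so \<eta>, of g] by simp
  also have "?Ad (lie (orb g) \<xi>) - ?Ad (Jb \<xi>) = ?Ad (lie (orb g) \<xi> - Jb \<xi>)"
    by (simp add: vec_eq_iff mat_mult_nth sum_subtractf sum_distrib_left sum_distrib_right algebra_simps)
  also have "\<dots> ** ?Ad \<eta> = transpose g ** ((lie (orb g) \<xi> - Jb \<xi>) ** \<eta> ** g)"
    by (simp add: matrix_mul_assoc[symmetric] c1)
  also have "trace \<dots> = trace ((lie (orb g) \<xi> - Jb \<xi>) ** \<eta> ** g ** transpose g)" by (rule trace_mul_sym)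
  finally show ?thesis by (simp add: matrix_mul_assoc[symmetric] gg matrix_mul_rid)
qed

text \<open>A linear map on all matrices that agrees with \<open>N_phi\<close> on tangent vectors,
  where alone the latter is controlled; it can therefore be treated with global linear algebra and
  continuity.\<close>

definition N_op :: "'n::{finite,linorder} rmat \<Rightarrow> 'n rmat \<Rightarrow> 'n rmat" where
  "N_op p v = v + lie p (Jb v)"

text \<open>Pulling \<open>Omega_kks p v\<close> back to the group gives v itself, and the pull-back
  of \<beta> is [p, Y]. So \<open>pi_0\<close> pairs [p, v] - J v with [p, Y]; moving ad p across
  yields -[p, [p, v] - J v] = v + [p, J v].\<close>

lemma N_phi_eq:
  fixes p :: "'n::{finite,linorder} rmat"
  assumes d: "CARD('n) \<ge> 2" and M: "p \<in> M_phi" and v: "v \<in> tangent p"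
  shows "N_phi p v = N_op p v"
proof -
  obtain x y where xy: "frame x y" "p = wedge x y" using M_phi_frameD[OF d M] by metis
  have p: "p \<in> so" by (simp add: xy wedge_so)
  have vso: "v \<in> so" using tangent_subset_so[OF p] v by auto
  have wT: "N_op p v \<in> tangent p" unfolding N_op_def
    using v lie_in_tangent[OF so_Jb[OF vso]] subspace_tangent subspace_add by blast
  have wso: "N_op p v \<in> so" using tangent_subset_so[OF p] wT by auto
  obtain X where X: "X \<in> so" "\<And>z. z \<in> so \<Longrightarrow> Omega_kks p v z = trace (z ** X)" "lie p X = v"
    using Omega_kks_rep[OF xy(1)] v unfolding xy(2) by metis
  have pb: "pull_back p (Omega_kks p v) = v" using pull_back_eq[OF p X(1,2)] X(3) by simp
  show ?thesis unfolding N_phi_def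
  proof (rule sharp_eq[OF wT])
    fix \<beta> :: "'n rmat \<Rightarrow> real" assume \<beta>: "linear \<beta>"
    obtain Y where Y: "Y \<in> so" "\<And>v. v \<in> so \<Longrightarrow> \<beta> v = trace (v ** Y)" by (rule functional_so[OF \<beta>]) blast
    have pb2: "pull_back p \<beta> = lie p Y" using pull_back_eq[OF p Y] by simp
    have "trace ((lie p v - Jb v) ** lie p Y) = - ((lie p v - Jb v) \<bullet> lie p Y)"
      using p Y by (simp add: trace_so so_lie)
    also have "\<dots> = lie p (lie p v - Jb v) \<bullet> Y" using inner_lie[OF p, of "lie p v - Jb v" Y] by simp
    also have "lie p (lie p v - Jb v) = - N_op p v"
      using lie_lie_frame[OF xy(1)] v xy(2) by (simp add: lie_diff_right N_op_def)
    also have "- N_op p v \<bullet> Y = \<beta> (N_op p v)" using Y wso by (simp add: trace_so)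
    finally have eq: "trace ((lie p v - Jb v) ** lie p Y) = \<beta> (N_op p v)" .
    have all: "pi_G g v (lie p Y) = \<beta> (N_op p v)" if "rotation_matrix g" "orb g = p" for g
      using pi_G_tangent[OF d that(1), of v "lie p Y"] that v p Y eq by (simp add: so_lie)
    obtain g where g: "rotation_matrix g" "orb g = p" using M by (auto simp: M_phi_def)
    show "\<beta> (N_op p v) = pi_0 p (Omega_kks p v) \<beta>"
      unfolding pi_0_def pb pb2 by (rule the_equality[symmetric]) (use all g in auto)
  qed
qed

subsection \<open>The parameters and their differentials\<close>

text \<open>With \<open>c = N - k\<close>: \<open>ip c p p / 2 = a\<^sub>k\<^sup>2\<close>, \<open>ss c p = b\<^sub>1 + \<dots> + b\<^sub>k\<close>, and \<open>bb (c + 1) p = b\<^sub>k\<close>.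
  The squared norm of the block of \<open>p\<close> in the two rows of block \<open>c + 1\<close> and the columns \<open>low c\<close>
  is \<open>cc c p p\<close>.\<close>

definition low :: "nat \<Rightarrow> 'n::{finite,linorder} set" where "low c = {l. blk l \<le> c}"
definition high :: "nat \<Rightarrow> 'n::{finite,linorder} set" where "high c = {l. c < blk l}"

definition ip :: "nat \<Rightarrow> 'n::{finite,linorder} rmat \<Rightarrow> 'n rmat \<Rightarrow> real" where
  "ip c p v = (\<Sum>i\<in>low c. \<Sum>j\<in>low c. p $ i $ j * v $ i $ j)"

definition ss :: "nat \<Rightarrow> 'n::{finite,linorder} rmat \<Rightarrow> real" where
  "ss c v = (\<Sum>l\<in>high c. sg l * v $ l $ pr l) / 2"

definition bb :: "nat \<Rightarrow> 'n::{finite,linorder} rmat \<Rightarrow> real" where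
  "bb c v = v $ hd_idx c $ pr (hd_idx c)"

definition cc :: "nat \<Rightarrow> 'n::{finite,linorder} rmat \<Rightarrow> 'n rmat \<Rightarrow> real" where
  "cc c p v = (\<Sum>l\<in>low c. p $ hd_idx (Suc c) $ l * v $ hd_idx (Suc c) $ l +
                         p $ pr (hd_idx (Suc c)) $ l * v $ pr (hd_idx (Suc c)) $ l)"

definition pl_polar :: "'n::finite rmat \<Rightarrow> 'n rmat \<Rightarrow> bool" where
  "pl_polar p v \<longleftrightarrow> (\<forall>i j k l.
     p $ i $ j * v $ k $ l - p $ i $ k * v $ j $ l + p $ i $ l * v $ j $ k
     + v $ i $ j * p $ k $ l - v $ i $ k * p $ j $ l + v $ i $ l * p $ j $ k = 0)"

lemma sum_high_pr: "(\<Sum>l\<in>high c. f (pr l)) = (\<Sum>l\<in>high c. f l)"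
  unfolding high_def by (rule sum_pr)

text \<open>Exchanging l with its partner and adding doubles the sum. For each l the four terms are
  then the part of the polarized Pluecker relation with indices i, j, l, \<open>pr l\<close> in
  which i and j are separated; the other two terms, contracted with sigma, give
  \<open>ss\<close>.\<close>

lemma high_contraction:
  fixes p v :: "'n::{finite,linorder} rmat"
  assumes p: "p \<in> so" and v: "v \<in> so" and pv: "pl_polar p v"
  shows "(\<Sum>l\<in>high c. sg l * (p $ i $ l * v $ pr l $ j - v $ i $ pr l * p $ l $ j)) =
    - (p $ i $ j * ss c v + v $ i $ j * ss c p)"
proof -
  let ?S1 = "\<Sum>l\<in>high c. sg l * (p $ i $ l * v $ pr l $ j)"
  let ?S2 = "\<Sum>l\<in>high c. sg l * (v $ i $ pr l * p $ l $ j)"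
  have 1: "?S1 = (\<Sum>l\<in>high c. - (sg l * (p $ i $ pr l * v $ l $ j)))"
    using sum_high_pr[of "\<lambda>l. sg l * (p $ i $ l * v $ pr l $ j)" c] by simp
  have 2: "?S2 = (\<Sum>l\<in>high c. - (sg l * (v $ i $ l * p $ pr l $ j)))"
    using sum_high_pr[of "\<lambda>l. sg l * (v $ i $ pr l * p $ l $ j)" c] by simp
  have "2 * (?S1 - ?S2) = (\<Sum>l\<in>high c. sg l * (p $ i $ l * v $ pr l $ j) + - (sg l * (p $ i $ pr l * v $ l $ j))
      - (sg l * (v $ i $ pr l * p $ l $ j) + - (sg l * (v $ i $ l * p $ pr l $ j))))"
    unfolding sum_subtractf sum.distrib 1[symmetric] 2[symmetric] by simp
  also have "\<dots> = (\<Sum>l\<in>high c. - (p $ i $ j * (sg l * v $ l $ pr l) + v $ i $ j * (sg l * p $ l $ pr l)))"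
  proof (intro sum.cong refl)
    fix l
    have "p $ i $ j * v $ l $ pr l - p $ i $ l * v $ j $ pr l + p $ i $ pr l * v $ j $ l
     + v $ i $ j * p $ l $ pr l - v $ i $ l * p $ j $ pr l + v $ i $ pr l * p $ j $ l = 0"
      using pv unfolding pl_polar_def by blast
    moreover have "v $ j $ pr l = - v $ pr l $ j" "v $ j $ l = - v $ l $ j" by (rule so_nth[OF v])+
    moreover have "p $ j $ pr l = - p $ pr l $ j" "p $ j $ l = - p $ l $ j" by (rule so_nth[OF p])+
    ultimately have "p $ i $ l * v $ pr l $ j - p $ i $ pr l * v $ l $ j
      - (v $ i $ pr l * p $ l $ j - v $ i $ l * p $ pr l $ j) = - (p $ i $ j * v $ l $ pr l + v $ i $ j * p $ l $ pr l)"
      by simp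
    from arg_cong[OF this, of "\<lambda>x. sg l * x"]
    show "sg l * (p $ i $ l * v $ pr l $ j) + - (sg l * (p $ i $ pr l * v $ l $ j))
      - (sg l * (v $ i $ pr l * p $ l $ j) + - (sg l * (v $ i $ l * p $ pr l $ j)))
      = - (p $ i $ j * (sg l * v $ l $ pr l) + v $ i $ j * (sg l * p $ l $ pr l))"
      by (simp add: algebra_simps)
  qed
  also have "\<dots> = - 2 * (p $ i $ j * ss c v + v $ i $ j * ss c p)"
    unfolding sum_negf sum.distrib sum_distrib_left[symmetric] by (simp add: ss_def field_simps)
  finally show ?thesis by (simp add: sum_subtractf right_diff_distrib)
qed

lemma UNIV_low_high: "(UNIV :: 'n::{finite,linorder} set) = low c \<union> high c" "low c \<inter> high c = {}"
  by (auto simp: low_def high_def)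

text \<open>For i and j in the corner and l outside, l lies in the higher block, so
  \<open>Jb\<close> acts on l alone and \<open>high_contraction\<close> applies. Up to the
  \<open>ss\<close> terms, the corner of [p, J v] is thus the bracket of the corners.\<close>

lemma lie_Jb_low:
  fixes p v :: "'n::{finite,linorder} rmat"
  assumes p: "p \<in> so" and v: "v \<in> so" and pv: "pl_polar p v" and ij: "i \<in> low c" "j \<in> low c"
  shows "lie p (Jb v) $ i $ j = (\<Sum>l\<in>low c. p $ i $ l * Jb v $ l $ j - Jb v $ i $ l * p $ l $ j)
    - (p $ i $ j * ss c v + v $ i $ j * ss c p)"
proof -
  have "lie p (Jb v) $ i $ j = (\<Sum>l\<in>UNIV. p $ i $ l * Jb v $ l $ j - Jb v $ i $ l * p $ l $ j)"
    by (simp add: lie_def mat_mult_nth sum_subtractf)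
  also have "\<dots> = (\<Sum>l\<in>low c. p $ i $ l * Jb v $ l $ j - Jb v $ i $ l * p $ l $ j)
     + (\<Sum>l\<in>high c. p $ i $ l * Jb v $ l $ j - Jb v $ i $ l * p $ l $ j)"
    unfolding UNIV_low_high(1)[of c] by (rule sum.union_disjoint) (auto simp: UNIV_low_high(2))
  also have "(\<Sum>l\<in>high c. p $ i $ l * Jb v $ l $ j - Jb v $ i $ l * p $ l $ j) =
     (\<Sum>l\<in>high c. sg l * (p $ i $ l * v $ pr l $ j - v $ i $ pr l * p $ l $ j))"
    using ij by (intro sum.cong refl) (auto simp: low_def high_def Jb_def algebra_simps)
  finally show ?thesis unfolding high_contraction[OF p v pv] by simp
qed

lemma skew_sum_zero:
  fixes w :: "'n::finite rmat"
  assumes "w \<in> so"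
  shows "(\<Sum>j\<in>A. \<Sum>l\<in>A. a j * a l * w $ l $ j) = 0"
proof -
  have "(\<Sum>j\<in>A. \<Sum>l\<in>A. a j * a l * w $ l $ j) = (\<Sum>j\<in>A. \<Sum>l\<in>A. a l * a j * w $ j $ l)"
    by (rule sum.swap)
  also have "\<dots> = (\<Sum>j\<in>A. \<Sum>l\<in>A. - (a j * a l * w $ l $ j))"
    by (intro sum.cong refl) (metis so_nth[OF assms] mult.commute mult_minus_right)
  finally show ?thesis by (simp add: sum_negf)
qed

text \<open>In the bracket of the corners each of the two triple sums pairs a symmetric product of
  entries of p with the antisymmetric \<open>Jb v\<close>, hence vanishes; only the
  \<open>ss\<close> terms survive.\<close>

lemma ip_N_op:
  fixes p v :: "'n::{finite,linorder} rmat"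
  assumes p: "p \<in> so" and v: "v \<in> so" and pv: "pl_polar p v"
  shows "ip c p (lie p (Jb v)) = - (ip c p p * ss c v + ip c p v * ss c p)"
proof -
  have w: "Jb v \<in> so" by (rule so_Jb[OF v])
  have "ip c p (lie p (Jb v)) = (\<Sum>i\<in>low c. \<Sum>j\<in>low c. p $ i $ j *
     ((\<Sum>l\<in>low c. p $ i $ l * Jb v $ l $ j - Jb v $ i $ l * p $ l $ j)
    - (p $ i $ j * ss c v + v $ i $ j * ss c p)))"
    unfolding ip_def by (intro sum.cong refl) (simp add: lie_Jb_low[OF p v pv])
  also have "\<dots> = (\<Sum>i\<in>low c. \<Sum>j\<in>low c. \<Sum>l\<in>low c. p $ i $ j * p $ i $ l * Jb v $ l $ j)
     - (\<Sum>i\<in>low c. \<Sum>j\<in>low c. \<Sum>l\<in>low c. p $ i $ j * p $ l $ j * Jb v $ i $ l)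
     - (ip c p p * ss c v + ip c p v * ss c p)"
    unfolding ip_def sum_distrib_right sum_distrib_left sum_subtractf[symmetric] sum.distrib[symmetric]
    by (intro sum.cong refl) (simp add: algebra_simps sum_distrib_left sum_subtractf)
  also have "(\<Sum>i\<in>low c. \<Sum>j\<in>low c. \<Sum>l\<in>low c. p $ i $ j * p $ i $ l * Jb v $ l $ j) = 0"
    by (intro sum.neutral ballI skew_sum_zero w)
  also have "(\<Sum>i\<in>low c. \<Sum>j\<in>low c. \<Sum>l\<in>low c. p $ i $ j * p $ l $ j * Jb v $ i $ l)
    = (\<Sum>j\<in>low c. \<Sum>l\<in>low c. \<Sum>i\<in>low c. p $ l $ j * p $ i $ j * Jb v $ i $ l)"
  proof -
    have "(\<Sum>j\<in>low c. \<Sum>l\<in>low c. p $ i $ j * p $ l $ j * Jb v $ i $ l) =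
      (\<Sum>l\<in>low c. \<Sum>j\<in>low c. p $ i $ j * p $ l $ j * Jb v $ i $ l)" for i
      by (rule sum.swap)
    then have "(\<Sum>i\<in>low c. \<Sum>j\<in>low c. \<Sum>l\<in>low c. p $ i $ j * p $ l $ j * Jb v $ i $ l) =
      (\<Sum>i\<in>low c. \<Sum>l\<in>low c. \<Sum>j\<in>low c. p $ i $ j * p $ l $ j * Jb v $ i $ l)" by simp
    also have "\<dots> = (\<Sum>l\<in>low c. \<Sum>i\<in>low c. \<Sum>j\<in>low c. p $ i $ j * p $ l $ j * Jb v $ i $ l)"
      by (rule sum.swap)
    also have "\<dots> = (\<Sum>l\<in>low c. \<Sum>j\<in>low c. \<Sum>i\<in>low c. p $ i $ j * p $ l $ j * Jb v $ i $ l)"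
      by (intro sum.cong refl sum.swap)
    also have "\<dots> = (\<Sum>j\<in>low c. \<Sum>l\<in>low c. \<Sum>i\<in>low c. p $ l $ j * p $ i $ j * Jb v $ i $ l)"
      by (subst sum.swap) (simp add: mult.commute)
    finally show ?thesis .
  qed
  also have "\<dots> = 0"
    by (intro sum.neutral ballI skew_sum_zero w)
  finally show ?thesis by simp
qed

lemma low_Suc:
  assumes "Suc c \<le> CARD('n::{finite,linorder}) div 2"
  defines "q \<equiv> hd_idx (Suc c) :: 'n"
  shows "low (Suc c) = insert q (insert (pr q) (low c))" "q \<notin> low c" "pr q \<notin> low c" "q \<noteq> pr q"
    "blk q = Suc c" "sg q = (1::'a::ring_1)" "high c = insert q (insert (pr q) (high (Suc c)))"
    "q \<notin> high (Suc c)" "pr q \<notin> high (Suc c)"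
proof -
  have c: "1 \<le> Suc c" "Suc c \<le> CARD('n) div 2" using assms by auto
  have b: "{i :: 'n. blk i = Suc c} = {q, pr q}" unfolding q_def by (rule block_eq[OF c])
  show bq: "blk q = Suc c" "sg q = (1::'a)" unfolding q_def using blk_hd[OF c] by auto
  show "q \<notin> low c" "pr q \<notin> low c" "q \<notin> high (Suc c)" "pr q \<notin> high (Suc c)"
    by (auto simp: low_def high_def bq)
  show "q \<noteq> pr q" using pr_neq[of q] bq by auto
  have "blk i \<le> Suc c \<longleftrightarrow> blk i = Suc c \<or> blk i \<le> c" "c < blk i \<longleftrightarrow> blk i = Suc c \<or> Suc c < blk i" for i :: 'n by auto
  then show "low (Suc c) = insert q (insert (pr q) (low c))" "high c = insert q (insert (pr q) (high (Suc c)))"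
    using b unfolding low_def high_def by blast+
qed

lemma ip_Suc:
  fixes p v :: "'n::{finite,linorder} rmat"
  assumes c: "Suc c \<le> CARD('n) div 2" and p: "p \<in> so" and v: "v \<in> so"
  shows "ip (Suc c) p v = ip c p v + 2 * cc c p v + 2 * bb (Suc c) p * bb (Suc c) v"
proof -
  let ?q = "hd_idx (Suc c) :: 'n"
  have q: "low (Suc c) = insert ?q (insert (pr ?q) (low c))" "?q \<notin> low c" "pr ?q \<notin> low c" "?q \<noteq> pr ?q"
    using low_Suc[OF c] by auto
  have s: "(\<Sum>i\<in>low (Suc c). f i) = f ?q + f (pr ?q) + (\<Sum>i\<in>low c. f i)" for f :: "'n \<Rightarrow> real"
    unfolding q(1) using q(2-4) by simp
  have sym: "p $ i $ j * v $ i $ j = p $ j $ i * v $ j $ i" for i j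
    using so_nth[OF p, of i j] so_nth[OF v, of i j] by simp
  have "ip (Suc c) p v = ip c p v +
     (\<Sum>l\<in>low c. p $ ?q $ l * v $ ?q $ l) + (\<Sum>l\<in>low c. p $ pr ?q $ l * v $ pr ?q $ l)
     + (\<Sum>l\<in>low c. p $ l $ ?q * v $ l $ ?q) + (\<Sum>l\<in>low c. p $ l $ pr ?q * v $ l $ pr ?q)
     + p $ ?q $ pr ?q * v $ ?q $ pr ?q + p $ pr ?q $ ?q * v $ pr ?q $ ?q"
    unfolding ip_def s by (simp add: sum.distrib so_diag[OF p])
  moreover have "(\<Sum>l\<in>low c. p $ l $ r * v $ l $ r) = (\<Sum>l\<in>low c. p $ r $ l * v $ r $ l)" for r
    by (intro sum.cong refl sym)
  moreover note sym[of "pr ?q" ?q]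
  ultimately show ?thesis by (simp add: cc_def bb_def sum.distrib)
qed

lemma ss_Suc:
  fixes v :: "'n::{finite,linorder} rmat"
  assumes c: "Suc c \<le> CARD('n) div 2" and v: "v \<in> so"
  shows "ss c v = ss (Suc c) v + bb (Suc c) v"
proof -
  let ?q = "hd_idx (Suc c) :: 'n"
  have q: "high c = insert ?q (insert (pr ?q) (high (Suc c)))" "?q \<notin> high (Suc c)" "pr ?q \<notin> high (Suc c)" "?q \<noteq> pr ?q"
     "sg ?q = (1::real)"
    using low_Suc[OF c] by auto
  have "v $ pr ?q $ ?q = - v $ ?q $ pr ?q" by (rule so_nth[OF v])
  then show ?thesis
    unfolding ss_def q(1) bb_def using q(2-5) by simp
qed

text \<open>The corner formula at \<open>Suc c\<close> for the single entry in block c + 1: inside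
  that block \<open>Jb\<close> vanishes, and on the lower columns it turns one row of the block into
  the other, producing \<open>cc\<close>.\<close>

lemma bb_N_op:
  fixes p v :: "'n::{finite,linorder} rmat"
  assumes c: "Suc c \<le> CARD('n) div 2" and p: "p \<in> so" and v: "v \<in> so" and pv: "pl_polar p v"
  shows "bb (Suc c) (lie p (Jb v)) = cc c p v - (bb (Suc c) p * ss (Suc c) v + bb (Suc c) v * ss (Suc c) p)"
proof -
  let ?q = "hd_idx (Suc c) :: 'n"
  have q: "low (Suc c) = insert ?q (insert (pr ?q) (low c))" "?q \<notin> low c" "pr ?q \<notin> low c" "?q \<noteq> pr ?q"
    "blk ?q = Suc c" "sg ?q = (1::real)"
    using low_Suc[OF c] by auto
  have s: "(\<Sum>i\<in>low (Suc c). f i) = f ?q + f (pr ?q) + (\<Sum>i\<in>low c. f i)" for f :: "'n \<Rightarrow> real"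
    unfolding q(1) using q(2-4) by simp
  have "?q \<in> low (Suc c)" "pr ?q \<in> low (Suc c)" using q by auto
  from lie_Jb_low[OF p v pv this] have "bb (Suc c) (lie p (Jb v)) =
     (\<Sum>l\<in>low (Suc c). p $ ?q $ l * Jb v $ l $ pr ?q - Jb v $ ?q $ l * p $ l $ pr ?q)
     - (bb (Suc c) p * ss (Suc c) v + bb (Suc c) v * ss (Suc c) p)"
    by (simp add: bb_def)
  also have "(\<Sum>l\<in>low (Suc c). p $ ?q $ l * Jb v $ l $ pr ?q - Jb v $ ?q $ l * p $ l $ pr ?q) =
     (\<Sum>l\<in>low c. p $ ?q $ l * Jb v $ l $ pr ?q - Jb v $ ?q $ l * p $ l $ pr ?q)"
    unfolding s by (simp add: Jb_def)
  also have "\<dots> = cc c p v"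
    unfolding cc_def
  proof (intro sum.cong refl)
    fix l :: 'n assume "l \<in> low c"
    then have l: "blk l < blk ?q" using q(5) by (simp add: low_def)
    have "Jb v $ l $ pr ?q = v $ ?q $ l" "Jb v $ ?q $ l = v $ pr ?q $ l"
      using l q(6) so_nth[OF v, of ?q l] by (simp_all add: Jb_def)
    moreover have "p $ l $ pr ?q = - p $ pr ?q $ l" by (rule so_nth[OF p])
    ultimately show "p $ ?q $ l * Jb v $ l $ pr ?q - Jb v $ ?q $ l * p $ l $ pr ?q =
      p $ ?q $ l * v $ ?q $ l + p $ pr ?q $ l * v $ pr ?q $ l" by simp
  qed
  finally show ?thesis .
qed

lemma low_top: "(low (CARD('n) div 2) :: 'n::{finite,linorder} set) = UNIV"
  "(high (CARD('n) div 2) :: 'n::{finite,linorder} set) = {}"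
  using blk_le[where 'n='n] by (auto simp: low_def high_def not_less)

text \<open>Downward induction from the full matrix, where \<open>ss\<close> is 0 and
  \<open>ip\<close> is p \<bullet> v = 0. Each step adds one \<open>bb\<close>, whose
  \<open>cc\<close> term is absorbed by the difference of consecutive \<open>ip\<close>.\<close>

lemma ss_N_op:
  fixes p v :: "'n::{finite,linorder} rmat"
  assumes c: "c \<le> CARD('n) div 2" and p: "p \<in> so" and v: "v \<in> so" and pv: "pl_polar p v" "p \<bullet> v = 0"
  shows "ss c (lie p (Jb v)) = - ip c p v / 2 - ss c p * ss c v"
  using c
proof (induction rule: inc_induct)
  case base
  have "ip (CARD('n) div 2) p v = 0" using pv(2) by (simp add: ip_def low_top inner_mat)
  then show ?case by (simp add: ss_def low_top)
next
  case (step c)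
  then have c: "Suc c \<le> CARD('n) div 2" by simp
  have "lie p (Jb v) \<in> so" using p v by (simp add: so_lie so_Jb)
  then have "ss c (lie p (Jb v)) = ss (Suc c) (lie p (Jb v)) + bb (Suc c) (lie p (Jb v))"
    by (rule ss_Suc[OF c])
  then show ?case unfolding step.IH bb_N_op[OF c p v pv(1)] ip_Suc[OF c p v] ss_Suc[OF c p] ss_Suc[OF c v]
    by (simp add: field_simps)
qed

subsection \<open>Inequalities between the parameters\<close>

lemma ip_nonneg: "ip c p p \<ge> 0"
  unfolding ip_def by (intro sum_nonneg) simp

lemma cc_nonneg: "cc c p p \<ge> 0"
  unfolding cc_def by (intro sum_nonneg add_nonneg_nonneg) simp_all

lemma pluecker_block:
  fixes p :: "'n::finite rmat"
  assumes p: "p \<in> so" "pluecker p"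
  shows "p $ q $ r * p $ i $ j = p $ q $ i * p $ r $ j - p $ r $ i * p $ q $ j"
proof -
  have "p $ q $ r * p $ i $ j - p $ q $ i * p $ r $ j + p $ q $ j * p $ r $ i = 0"
    using p(2) unfolding pluecker_def by blast
  then show ?thesis by (simp add: algebra_simps)
qed

text \<open>With u and w the two rows of block c + 1, the Pluecker relation says that
  \<open>bb\<close> times the corner is the wedge of u and w. Its squared norm is 2 (U W - Z^2), and
  U W is at most (U + W)^2 / 4.\<close>

lemma bb_ip_le_cc:
  fixes p :: "'n::{finite,linorder} rmat"
  assumes p: "p \<in> so" "pluecker p"
  shows "4 * (bb (Suc c) p)\<^sup>2 * (ip c p p / 2) \<le> (cc c p p)\<^sup>2"
proof -
  let ?u = "\<lambda>l. p $ hd_idx (Suc c) $ l" and ?w = "\<lambda>l. p $ pr (hd_idx (Suc c)) $ l"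
  let ?U = "\<Sum>l\<in>low c. ?u l * ?u l" and ?W = "\<Sum>l\<in>low c. ?w l * ?w l" and ?Z = "\<Sum>l\<in>low c. ?u l * ?w l"
  have "(bb (Suc c) p)\<^sup>2 * ip c p p = (\<Sum>i\<in>low c. \<Sum>j\<in>low c. (bb (Suc c) p * p $ i $ j)\<^sup>2)"
    by (simp add: ip_def sum_distrib_left power2_eq_square algebra_simps)
  also have "\<dots> = (\<Sum>i\<in>low c. \<Sum>j\<in>low c. (?u i * ?w j - ?w i * ?u j)\<^sup>2)"
    by (intro sum.cong refl arg_cong[where f="\<lambda>x. x\<^sup>2"]) (simp only: bb_def, rule pluecker_block[OF p])
  also have "\<dots> = (\<Sum>i\<in>low c. \<Sum>j\<in>low c. (?u i * ?u i) * (?w j * ?w j))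
      + (\<Sum>i\<in>low c. \<Sum>j\<in>low c. (?w i * ?w i) * (?u j * ?u j))
      - 2 * (\<Sum>i\<in>low c. \<Sum>j\<in>low c. (?u i * ?w i) * (?u j * ?w j))"
    unfolding sum_distrib_left sum_subtractf[symmetric] sum.distrib[symmetric]
    by (intro sum.cong refl) (simp add: power2_eq_square algebra_simps)
  also have "\<dots> = ?U * ?W + ?W * ?U - 2 * (?Z * ?Z)"
    by (simp only: sum_product)
  also have "\<dots> \<le> (?U + ?W)\<^sup>2 / 2"
  proof -
    have "U * W + W * U - 2 * (Z * Z) \<le> (U + W)\<^sup>2 / 2" for U W Z :: real
    proof -
      have "U * W + W * U - 2 * (Z * Z) = (U + W)\<^sup>2 / 2 - (U - W)\<^sup>2 / 2 - 2 * (Z * Z)"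
        by (simp add: power2_eq_square field_simps)
      also have "\<dots> \<le> (U + W)\<^sup>2 / 2"
        using zero_le_power2[of "U - W"] zero_le_square[of Z] by linarith
      finally show ?thesis .
    qed
    then show ?thesis .
  qed
  also have "?U + ?W = cc c p p" by (simp add: cc_def sum.distrib)
  finally show ?thesis by (simp add: mult.commute mult.left_commute)
qed

definition aa :: "nat \<Rightarrow> 'n::{finite,linorder} rmat \<Rightarrow> real" where
  "aa c p = sqrt (ip c p p / 2)"

lemma aa_nonneg [simp]: "aa c p \<ge> 0"
  by (simp add: aa_def ip_nonneg)

lemma aa_sq: "(aa c p)\<^sup>2 = ip c p p / 2"
  by (simp add: aa_def ip_nonneg)

lemma aa_Suc_sq:
  fixes p :: "'n::{finite,linorder} rmat"
  assumes c: "Suc c \<le> CARD('n) div 2" and p: "p \<in> so"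
  shows "(aa (Suc c) p)\<^sup>2 = (aa c p)\<^sup>2 + cc c p p + (bb (Suc c) p)\<^sup>2"
  unfolding aa_sq ip_Suc[OF c p p] by (simp add: power2_eq_square)

lemma aa_bb_cc:
  fixes p :: "'n::{finite,linorder} rmat"
  assumes p: "p \<in> so" "pluecker p"
  shows "2 * (aa c p * \<bar>bb (Suc c) p\<bar>) \<le> cc c p p"
proof (rule power2_le_imp_le[OF _ cc_nonneg])
  show "(2 * (aa c p * \<bar>bb (Suc c) p\<bar>))\<^sup>2 \<le> (cc c p p)\<^sup>2"
    using bb_ip_le_cc[OF p, of c] by (simp add: power_mult_distrib aa_sq mult.commute)
qed

text \<open>The squared form is a^2 + 2 a |b| + b^2 \<le> a^2 + \<open>cc\<close> + b^2. With c = N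
  - k this is the polytope inequality for b_k.\<close>

lemma interlacing:
  fixes p :: "'n::{finite,linorder} rmat"
  assumes c: "Suc c \<le> CARD('n) div 2" and p: "p \<in> so" "pluecker p"
  shows "\<bar>bb (Suc c) p\<bar> \<le> aa (Suc c) p - aa c p"
proof -
  have "(aa c p + \<bar>bb (Suc c) p\<bar>)\<^sup>2 \<le> (aa (Suc c) p)\<^sup>2"
    unfolding aa_Suc_sq[OF c p(1)] using aa_bb_cc[OF p, of c] by (simp add: power2_sum)
  then have "aa c p + \<bar>bb (Suc c) p\<bar> \<le> aa (Suc c) p" by (rule power2_le_imp_le) simp
  then show ?thesis by simp
qed

text \<open>The squared difference of the squared singular values of the block with squared norm \<open>cc c p p\<close>.\<close>

definition disc :: "nat \<Rightarrow> 'n::{finite,linorder} rmat \<Rightarrow> real" where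
  "disc c p = (cc c p p)\<^sup>2 - 4 * (bb (Suc c) p)\<^sup>2 * (ip c p p / 2)"

lemma interlacing_strict:
  fixes p :: "'n::{finite,linorder} rmat"
  assumes c: "Suc c \<le> CARD('n) div 2" and p: "p \<in> so" "pluecker p" and D: "disc c p \<noteq> 0"
  shows "\<bar>bb (Suc c) p\<bar> < aa (Suc c) p - aa c p"
proof -
  have "2 * (aa c p * \<bar>bb (Suc c) p\<bar>) \<noteq> cc c p p"
  proof
    assume *: "2 * (aa c p * \<bar>bb (Suc c) p\<bar>) = cc c p p"
    have "(cc c p p)\<^sup>2 = 4 * ((aa c p)\<^sup>2 * (bb (Suc c) p)\<^sup>2)"
      unfolding *[symmetric] by (simp add: power_mult_distrib)
    then show False using D by (simp add: disc_def aa_sq)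
  qed
  with aa_bb_cc[OF p, of c] have "2 * (aa c p * \<bar>bb (Suc c) p\<bar>) < cc c p p" by simp
  then have "(aa c p + \<bar>bb (Suc c) p\<bar>)\<^sup>2 < (aa (Suc c) p)\<^sup>2"
    unfolding aa_Suc_sq[OF c p(1)] by (simp add: power2_sum)
  then have "aa c p + \<bar>bb (Suc c) p\<bar> < aa (Suc c) p" by (rule power2_less_imp_less) simp
  then show ?thesis by simp
qed

text \<open>On this vector d(a^2) - 2 s a ds takes the value 2 a (2 a b + s \<open>cc\<close>), with
  a = \<open>aa c p\<close> and b the Pfaffian of block c + 1. For a > 0 and s of square 1 it
  vanishes only if \<open>disc c p\<close> does, so the discriminant controls both eigencovectors at
  once.\<close>

lemma test_vector:
  fixes p :: "'n::{finite,linorder} rmat"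
  assumes c: "Suc c \<le> CARD('n) div 2" and p: "p \<in> so" "pluecker p"
  obtains v where "v \<in> tangent p" "ip c p v = 2 * bb (Suc c) p * ip c p p" "ss c v = - cc c p p"
proof -
  let ?q = "hd_idx (Suc c) :: 'n"
  let ?r = "pr ?q"
  have q: "high c = insert ?q (insert ?r (high (Suc c)))" "?q \<notin> high (Suc c)" "?r \<notin> high (Suc c)"
     "?q \<notin> low c" "?r \<notin> low c" "?q \<noteq> ?r" "sg ?q = (1::real)"
    using low_Suc[OF c] by auto
  \<comment> \<open>the block of \<open>X\<close> in the rows \<open>?q, ?r\<close> is \<open>\<sigma>\<close> times that of \<open>p\<close>\<close>
  define X :: "'n rmat" where "X = (\<chi> i j.
     if i = ?q \<and> j \<in> low c then p $ ?r $ j else if i = ?r \<and> j \<in> low c then - p $ ?q $ j else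
     if j = ?q \<and> i \<in> low c then - p $ ?r $ i else if j = ?r \<and> i \<in> low c then p $ ?q $ i else 0)"
  have X: "X \<in> so" using q(4-6) by (auto simp: so_iff X_def)
  define v where "v = lie X p"
  have v_nth: "v $ i $ j = (\<Sum>l\<in>UNIV. X $ i $ l * p $ l $ j) - (\<Sum>l\<in>UNIV. p $ i $ l * X $ l $ j)" for i j
    by (simp add: v_def lie_def mat_mult_nth)
  have v_low: "v $ i $ j = 2 * bb (Suc c) p * p $ i $ j" if "i \<in> low c" "j \<in> low c" for i j
  proof -
    have "(\<Sum>l\<in>UNIV. X $ i $ l * p $ l $ j) = (\<Sum>l\<in>{?q, ?r}. X $ i $ l * p $ l $ j)"
      using q(4,5) that by (intro sum.mono_neutral_right) (auto simp: X_def)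
    also have "\<dots> = - p $ ?r $ i * p $ ?q $ j + p $ ?q $ i * p $ ?r $ j"
      using q(4-6) that by (auto simp: X_def)
    finally have 1: "(\<Sum>l\<in>UNIV. X $ i $ l * p $ l $ j) = - p $ ?r $ i * p $ ?q $ j + p $ ?q $ i * p $ ?r $ j" .
    have "(\<Sum>l\<in>UNIV. p $ i $ l * X $ l $ j) = (\<Sum>l\<in>{?q, ?r}. p $ i $ l * X $ l $ j)"
      using q(4,5) that by (intro sum.mono_neutral_right) (auto simp: X_def)
    also have "\<dots> = p $ i $ ?q * p $ ?r $ j - p $ i $ ?r * p $ ?q $ j"
      using q(4-6) that by (auto simp: X_def)
    also have "p $ i $ ?q = - p $ ?q $ i" by (rule so_nth[OF p(1)])
    also have "p $ i $ ?r = - p $ ?r $ i" by (rule so_nth[OF p(1)])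
    finally have 2: "(\<Sum>l\<in>UNIV. p $ i $ l * X $ l $ j) = p $ ?r $ i * p $ ?q $ j - p $ ?q $ i * p $ ?r $ j"
      by simp
    show ?thesis unfolding v_nth 1 2 bb_def
      using pluecker_block[OF p, of ?q ?r i j] by (simp add: algebra_simps)
  qed
  have sums: "(\<Sum>l\<in>UNIV. if l \<in> low c then f l else 0) = (\<Sum>l\<in>low c. f l)" for f :: "'n \<Rightarrow> real"
    by (simp add: sum.inter_restrict[symmetric])
  have "v $ ?q $ ?r = - cc c p p"
  proof -
    have "(\<Sum>l\<in>UNIV. X $ ?q $ l * p $ l $ ?r) = (\<Sum>l\<in>low c. - (p $ ?r $ l * p $ ?r $ l))"
      using q(4-6) so_nth[OF p(1), of _ ?r]
      by (subst sums[symmetric]) (intro sum.cong refl, auto simp: X_def)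
    moreover have "(\<Sum>l\<in>UNIV. p $ ?q $ l * X $ l $ ?r) = (\<Sum>l\<in>low c. p $ ?q $ l * p $ ?q $ l)"
      using q(4-6) by (subst sums[symmetric]) (intro sum.cong refl, auto simp: X_def)
    ultimately show ?thesis unfolding v_nth by (simp add: cc_def sum.distrib sum_negf)
  qed
  moreover have vso: "v \<in> so" unfolding v_def by (rule so_lie[OF X p(1)])
  moreover have "v $ ?r $ ?q = - v $ ?q $ ?r" by (rule so_nth[OF vso])
  moreover have "v $ l $ pr l = 0" if "l \<in> high (Suc c)" for l
  proof -
    have l: "l \<noteq> ?q" "l \<noteq> ?r" "pr l \<noteq> ?q" "pr l \<noteq> ?r" "l \<notin> low c" "pr l \<notin> low c"
      using that low_Suc(5)[OF c] unfolding high_def low_def mem_Collect_eq by (metis blk_pr less_irrefl, metis blk_pr less_irrefl,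
        metis blk_pr less_irrefl, metis blk_pr less_irrefl, simp, simp)
    then show ?thesis unfolding v_nth by (simp add: X_def)
  qed
  ultimately have "ss c v = - cc c p p"
    unfolding ss_def q(1) using q(2,3,6,7) by simp
  moreover have "ip c p v = 2 * bb (Suc c) p * ip c p p"
    unfolding ip_def sum_distrib_left
    by (intro sum.cong refl) (simp add: v_low)
  moreover have "v \<in> tangent p" using X by (auto simp: v_def tangent_def)
  ultimately show thesis using that by blast
qed

subsection \<open>Generalized eigenspaces on an invariant subspace\<close>

text \<open>The product of the factors f - x over a list that may contain repetitions. Distinct
  eigenvalues, generalized eigenspaces and limits in which eigenvalues merge are all instances of
  one notion.\<close>

primrec lprod :: "('a::real_vector \<Rightarrow> 'a) \<Rightarrow> real list \<Rightarrow> 'a \<Rightarrow> 'a" where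
  "lprod f [] v = v"
| "lprod f (x # xs) v = lprod f xs (f v - x *\<^sub>R v)"

definition lker :: "('a::real_vector \<Rightarrow> 'a) \<Rightarrow> 'a set \<Rightarrow> real list \<Rightarrow> 'a set" where
  "lker f V xs = {v \<in> V. lprod f xs v = 0}"

lemma linear_shift: "linear f \<Longrightarrow> linear (\<lambda>v. f v - x *\<^sub>R v)"
  by (rule linearI) (simp_all add: linear_add linear_cmul algebra_simps)

lemma linear_lprod: "linear f \<Longrightarrow> linear (lprod f xs)"
proof (induction xs)
  case Nil
  have "lprod f [] = (\<lambda>v. v)" by (simp add: fun_eq_iff)
  then show ?case by (simp add: linear_ident)
next
  case (Cons x xs)
  have "lprod f (x # xs) = lprod f xs \<circ> (\<lambda>v. f v - x *\<^sub>R v)" by (simp add: fun_eq_iff)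
  then show ?case by (simp only: linear_compose[OF linear_shift[OF Cons.prems] Cons.IH[OF Cons.prems]])
qed

lemma lprod_append: "lprod f (xs @ ys) v = lprod f ys (lprod f xs v)"
  by (induction xs arbitrary: v) simp_all

lemma lprod_shift:
  assumes "linear f"
  shows "lprod f xs (f v - x *\<^sub>R v) = f (lprod f xs v) - x *\<^sub>R lprod f xs v"
proof (induction xs arbitrary: v)
  case (Cons y ys)
  have "f (f v - x *\<^sub>R v) - y *\<^sub>R (f v - x *\<^sub>R v) = f (f v - y *\<^sub>R v) - x *\<^sub>R (f v - y *\<^sub>R v)"
    using assms by (simp add: linear_diff linear_cmul algebra_simps)
  then show ?case using Cons by simp
qed simp

lemma lprod_commute: "linear f \<Longrightarrow> lprod f xs (lprod f ys v) = lprod f ys (lprod f xs v)"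
  by (induction ys arbitrary: v) (simp_all add: lprod_shift)

lemma lprod_eigenvector:
  assumes "linear f" "f w = x *\<^sub>R w"
  shows "lprod f ys w = (\<Prod>y\<leftarrow>ys. x - y) *\<^sub>R w"
proof (induction ys)
  case (Cons y ys)
  have "lprod f (y # ys) w = lprod f ys ((x - y) *\<^sub>R w)" by (simp add: assms(2) scaleR_left_diff_distrib)
  also have "\<dots> = (x - y) *\<^sub>R lprod f ys w" using linear_lprod[OF assms(1)] by (rule linear_cmul)
  finally show ?case using Cons by simp
qed simp

lemma lprod_invariant:
  assumes "subspace V" "\<And>v. v \<in> V \<Longrightarrow> f v \<in> V" "v \<in> V" shows "lprod f xs v \<in> V"
  using assms(3)
proof (induction xs arbitrary: v)
  case (Cons x xs)
  then have "f v - x *\<^sub>R v \<in> V" using assms(1,2) by (simp add: subspace_diff subspace_scale)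
  then show ?case using Cons by simp
qed simp

lemma subspace_lker: "linear f \<Longrightarrow> subspace V \<Longrightarrow> subspace (lker f V xs)"
  by (rule subspaceI)
     (auto simp: lker_def linear_0 linear_add linear_cmul linear_lprod subspace_0 subspace_add subspace_scale)

text \<open>Peeling off the root x leaves a vector that is an eigenvector for x or zero. The factors
  for ys multiply it by a nonzero scalar, yet they annihilate it.\<close>

lemma lker_Int:
  assumes f: "linear f" and "set xs \<inter> set ys = {}"
  shows "lker f V xs \<inter> lker f V ys \<subseteq> {0}"
  using assms(2)
proof (induction xs)
  case (Cons x xs)
  have "lprod f xs v = 0" if "lprod f (x # xs) v = 0" "lprod f ys v = 0" for v
  proof -
    let ?w = "lprod f xs v"
    have "f ?w = x *\<^sub>R ?w" using that(1) lprod_shift[OF f, of xs v x] by simp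
    then have "lprod f ys ?w = (\<Prod>y\<leftarrow>ys. x - y) *\<^sub>R ?w" by (rule lprod_eigenvector[OF f])
    moreover have "lprod f ys ?w = 0"
      using that(2) linear_0[OF linear_lprod[OF f, of xs]] lprod_commute[OF f, of ys xs v] by simp
    moreover have "(\<Prod>y\<leftarrow>ys. x - y) \<noteq> 0" using Cons.prems by (auto simp: prod_list_zero_iff)
    ultimately show ?thesis by simp
  qed
  then have "lker f V (x # xs) \<inter> lker f V ys \<subseteq> lker f V xs \<inter> lker f V ys"
    unfolding lker_def by blast
  moreover have "set xs \<inter> set ys = {}" using Cons.prems by auto
  ultimately show ?case using Cons.IH by blast
qed (auto simp: lker_def)

lemma dim_lker_append:
  fixes f :: "'a::euclidean_space \<Rightarrow> 'a"
  assumes f: "linear f" and V: "subspace V" and d: "set xs \<inter> set ys = {}"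
  shows "dim (lker f V xs) + dim (lker f V ys) \<le> dim (lker f V (xs @ ys))"
proof -
  let ?S = "{u + w |u w. u \<in> lker f V xs \<and> w \<in> lker f V ys}"
  have "?S \<subseteq> lker f V (xs @ ys)"
  proof safe
    fix u w assume uw: "u \<in> lker f V xs" "w \<in> lker f V ys"
    have "lprod f ys (lprod f xs w) = 0"
      unfolding lprod_commute[OF f, of ys xs] using uw(2) linear_0[OF linear_lprod[OF f, of xs]]
      by (simp add: lker_def)
    moreover have "lprod f ys (lprod f xs u) = 0"
      using uw(1) linear_0[OF linear_lprod[OF f, of ys]] by (simp add: lker_def)
    ultimately have "lprod f (xs @ ys) (u + w) = 0"
      by (simp add: lprod_append linear_add[OF linear_lprod[OF f]])
    then show "u + w \<in> lker f V (xs @ ys)" using uw V by (simp add: lker_def subspace_add)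
  qed
  then have "dim ?S \<le> dim (lker f V (xs @ ys))" by (rule dim_subset)
  moreover have "dim (lker f V xs \<inter> lker f V ys) = 0"
    using lker_Int[OF f d] by (simp add: dim_eq_0)
  ultimately show ?thesis
    using dim_sums_Int[OF subspace_lker[OF f V, of xs] subspace_lker[OF f V, of ys]] by linarith
qed

lemma sum_dim_lker_replicate:
  fixes f :: "'a::euclidean_space \<Rightarrow> 'a"
  assumes f: "linear f" and V: "subspace V" and "distinct xs"
  shows "(\<Sum>x\<leftarrow>xs. dim (lker f V (replicate (k x) x))) \<le> dim V"
proof -
  have "(\<Sum>x\<leftarrow>xs. dim (lker f V (replicate (k x) x))) \<le> dim (lker f V (concat (map (\<lambda>x. replicate (k x) x) xs)))"
    using assms(3)
  proof (induction xs)
    case (Cons x xs)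
    then have "set (replicate (k x) x) \<inter> set (concat (map (\<lambda>x. replicate (k x) x) xs)) = {}" by auto
    from dim_lker_append[OF f V this] Cons show ?case by simp
  qed simp
  also have "\<dots> \<le> dim V" by (rule dim_subset) (auto simp: lker_def)
  finally show ?thesis .
qed

lemma dim_lker_distinct:
  fixes f :: "'a::euclidean_space \<Rightarrow> 'a"
  assumes f: "linear f" and V: "subspace V" and "distinct xs" "\<And>x. x \<in> set xs \<Longrightarrow> m \<le> dim (lker f V [x])"
  shows "m * length xs \<le> dim (lker f V xs)"
  using assms(3,4)
proof (induction xs)
  case (Cons x xs)
  then have "set [x] \<inter> set xs = {}" by auto
  from dim_lker_append[OF f V this] have "dim (lker f V [x]) + dim (lker f V xs) \<le> dim (lker f V (x # xs))"
    by simp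
  moreover have "m \<le> dim (lker f V [x])" using Cons.prems(2)[of x] by simp
  moreover have "m * length xs \<le> dim (lker f V xs)" using Cons by simp
  ultimately show ?case by simp
qed simp

lemma lprod_replicate: "lprod f (replicate k x) v = ((\<lambda>u. f u - x *\<^sub>R u) ^^ k) v"
proof (induction k arbitrary: v)
  case (Suc k)
  have "((\<lambda>u. f u - x *\<^sub>R u) ^^ Suc k) v = ((\<lambda>u. f u - x *\<^sub>R u) ^^ k) (f v - x *\<^sub>R v)"
    by (simp only: funpow_Suc_right o_def)
  then show ?case using Suc by simp
qed simp

text \<open>The kernels of the powers increase and their dimensions are bounded, so the one of
  maximal dimension already contains all others.\<close>

lemma gen_eigenspace_lker:
  fixes f :: "'a::euclidean_space \<Rightarrow> 'a"
  assumes f: "linear f" and V: "subspace V"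
  obtains k where "k \<ge> k0" "{v \<in> V. \<exists>k. ((\<lambda>u. f u - x *\<^sub>R u) ^^ k) v = 0} = lker f V (replicate k x)"
proof -
  let ?K = "\<lambda>k. lker f V (replicate k x)"
  have mono: "?K k \<subseteq> ?K (k + j)" for k j
    using linear_0[OF linear_lprod[OF f, of "replicate j x"]]
    by (auto simp: lker_def replicate_add lprod_append)
  have "finite (range (\<lambda>k. dim (?K k)))"
    by (rule finite_subset[of _ "{..DIM('a)}"]) (auto simp: dim_subset_UNIV)
  then obtain k where k: "\<And>j. dim (?K j) \<le> dim (?K k)"
    by (metis (no_types, lifting) Max_ge Max_in empty_iff imageE rangeI)
  have big: "?K j \<subseteq> ?K (k + k0)" for j
  proof -
    have "?K k \<subseteq> ?K (k + k0 + j)" using mono[of k "k0 + j"] by (simp add: add.assoc)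
    have "?K (k + k0) = ?K (k + k0 + j)"
      by (rule subspace_dim_equal[OF subspace_lker[OF f V] subspace_lker[OF f V] mono])
        (use k[of "k + k0 + j"] dim_subset[OF mono[of k k0]] in linarith)
    also have "?K j \<subseteq> ?K (k + k0 + j)" using mono[of j "k + k0"] by (simp add: add.commute)
    finally show ?thesis using \<open>?K (k + k0) = ?K (k + k0 + j)\<close> by simp
  qed
  have "{v \<in> V. \<exists>k. ((\<lambda>u. f u - x *\<^sub>R u) ^^ k) v = 0} = (\<Union>j. ?K j)"
    by (auto simp: lker_def lprod_replicate)
  also have "\<dots> = ?K (k + k0)" using big by auto
  finally show thesis using that[of "k + k0"] by simp
qed

subsection \<open>Radicals of alternating forms\<close>

text \<open>Splits off a hyperbolic plane spanned by u and w and inducts on its complement W with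
  respect to B. Linearity is assumed in the first argument; in the second it comes from skewness on
  V.\<close>

lemma even_dim_nondegenerate:
  fixes V :: "'a::euclidean_space set" and B :: "'a \<Rightarrow> 'a \<Rightarrow> real"
  assumes l: "\<And>v. linear (\<lambda>u. B u v)" and skew: "\<And>u v. u \<in> V \<Longrightarrow> v \<in> V \<Longrightarrow> B u v = - B v u"
    and V: "subspace V" and nd: "\<And>u. u \<in> V \<Longrightarrow> (\<And>v. v \<in> V \<Longrightarrow> B u v = 0) \<Longrightarrow> u = 0"
  shows "even (dim V)"
  using V skew nd
proof (induction "dim V" arbitrary: V rule: less_induct)
  case less
  note V = \<open>subspace V\<close> and skew = less.prems(2) and nd = less.prems(3)
  show ?case
  proof (cases "V \<subseteq> {0}")
    case True
    then show ?thesis by (metis dim_eq_0 even_zero)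
  next
    case False
    then obtain u where u: "u \<in> V" "u \<noteq> 0" by auto
    then obtain w where w: "w \<in> V" "B u w \<noteq> 0" using nd by blast
    have alt: "B v v = 0" if "v \<in> V" for v using skew[OF that that] by simp
    define W where "W = {v \<in> V. B v u = 0 \<and> B v w = 0}"
    have B0: "B 0 v = 0" and Badd: "B (a + b) v = B a v + B b v" and Bs: "B (c *\<^sub>R a) v = c * B a v"
      and Bd: "B (a - b) v = B a v - B b v" for a b c v
      using linear_0[OF l[of v]] linear_add[OF l[of v]] linear_cmul[OF l[of v]] linear_diff[OF l[of v]] by simp_all
    have W: "subspace W"
      by (rule subspaceI) (auto simp: W_def B0 Badd Bs subspace_0 subspace_add subspace_scale V)
    have wu: "B w u = - B u w" using skew u w by blast
    have uw: "w \<notin> span {u}"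
    proof
      assume "w \<in> span {u}"
      then obtain c where "w = c *\<^sub>R u" by (auto simp: span_singleton)
      then have "B w u = 0" using alt[OF u(1)] by (simp add: Bs)
      then show False using wu w by simp
    qed
    then have "w \<noteq> u" using span_base[of u "{u}"] by auto
    have "independent {w, u}" using uw u(2) \<open>w \<noteq> u\<close> by (auto simp: independent_insert)
    then have dim2: "dim (span {u, w}) = 2" using \<open>w \<noteq> u\<close>
      by (simp add: dim_eq_card_independent insert_commute)
    have coords: "a = 0 \<and> b = 0" if "B (a *\<^sub>R u + b *\<^sub>R w) u = 0" "B (a *\<^sub>R u + b *\<^sub>R w) w = 0" for a b
      using that wu w alt[OF u(1)] alt[OF w(1)] by (simp add: Badd Bs)
    have elt: "\<exists>a b. x = a *\<^sub>R u + b *\<^sub>R w" if "x \<in> span {u, w}" for x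
      using that by (auto simp: span_insert[of u "{w}"] span_singleton)
         (metis add.commute diff_add_cancel)
    have spV: "span {u, w} \<subseteq> V" using u w V by (intro span_minimal) auto
    have int: "span {u, w} \<inter> W \<subseteq> {0}"
    proof
      fix x assume x: "x \<in> span {u, w} \<inter> W"
      then obtain a b where ab: "x = a *\<^sub>R u + b *\<^sub>R w" using elt by blast
      then have "a = 0 \<and> b = 0" using coords[of a b] x by (simp add: W_def)
      then show "x \<in> {0}" using ab by simp
    qed
    have dec: "\<exists>x y. v = x + y \<and> x \<in> span {u, w} \<and> y \<in> W" if v: "v \<in> V" for v
    proof -
      define x where "x = (B v w / B u w) *\<^sub>R u + (B v u / B w u) *\<^sub>R w"
      have "x \<in> span {u, w}" unfolding x_def by (intro span_add span_scale span_base) auto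
      moreover from this have "v - x \<in> V" using spV V v by (auto intro: subspace_diff)
      then have "v - x \<in> W" using w wu alt[OF u(1)] alt[OF w(1)]
        by (simp add: W_def Bd x_def Badd Bs)
      ultimately show ?thesis by (metis add.commute diff_add_cancel)
    qed
    have "{x + y |x y. x \<in> span {u, w} \<and> y \<in> W} = V"
      using dec spV V by (fastforce simp: W_def intro: subspace_add)
    then have "dim V = 2 + dim W"
    proof -
      have "dim (span {u, w} \<inter> W) = 0" unfolding dim_eq_0 by (rule int)
      then show ?thesis using dim_sums_Int[OF subspace_span[of "{u, w}"] W] dim2
        unfolding \<open>_ = V\<close> by linarith
    qed
    moreover have "even (dim W)"
    proof (rule less.hyps[OF _ W])
      show "dim W < dim V" using \<open>dim V = 2 + dim W\<close> by simp
      show "B a b = - B b a" if "a \<in> W" "b \<in> W" for a b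
        by (rule skew) (use that in \<open>simp_all add: W_def\<close>)
      show "a = 0" if a: "a \<in> W" "\<And>b. b \<in> W \<Longrightarrow> B a b = 0" for a
      proof (rule nd)
        show "a \<in> V" using a by (simp add: W_def)
        fix v assume "v \<in> V"
        then obtain x y where xy: "v = x + y" "x \<in> span {u, w}" "y \<in> W" using dec by blast
        obtain c e where ce: "x = c *\<^sub>R u + e *\<^sub>R w" using elt xy by blast
        have "B x a = 0"
          using a(1) u w skew[of u a] skew[of w a] by (simp add: ce Badd Bs W_def)
        moreover have "B y a = 0" using a(2)[OF xy(3)] skew[of y a] xy(3) a(1) by (auto simp: W_def)
        ultimately show "B a v = 0" using skew[of a v] \<open>a \<in> V\<close> \<open>v \<in> V\<close> by (simp add: xy(1) Badd)
      qed
    qed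
    ultimately show ?thesis by simp
  qed
qed

text \<open>The Euclidean complement of the radical serves as the quotient by it: the form is
  nondegenerate there, since a vector pairing to zero with the complement also does so with the
  radical, and thus lies in both.\<close>

lemma even_dim_radical:
  fixes V :: "'a::euclidean_space set" and B :: "'a \<Rightarrow> 'a \<Rightarrow> real"
  assumes l: "\<And>v. linear (\<lambda>u. B u v)" and skew: "\<And>u v. u \<in> V \<Longrightarrow> v \<in> V \<Longrightarrow> B u v = - B v u"
    and V: "subspace V" and ev: "even (dim V)"
  shows "even (dim {u \<in> V. \<forall>v\<in>V. B u v = 0})"
proof -
  let ?R = "{u \<in> V. \<forall>v\<in>V. B u v = 0}"
  let ?W = "{y \<in> V. \<forall>x\<in>?R. orthogonal x y}"
  have B0: "B 0 v = 0" and Badd: "B (a + b) v = B a v + B b v" and Bs: "B (c *\<^sub>R a) v = c * B a v" for a b c v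
    using linear_0[OF l[of v]] linear_add[OF l[of v]] linear_cmul[OF l[of v]] by simp_all
  have R: "subspace ?R"
    by (rule subspaceI) (auto simp: B0 Badd Bs subspace_0 subspace_add subspace_scale V)
  have W: "subspace ?W"
    by (rule subspaceI) (auto simp: orthogonal_def inner_add_right subspace_0 subspace_add subspace_scale V)
  have d: "dim ?W + dim ?R = dim V" by (rule dim_subspace_orthogonal_to_vectors[OF R V Collect_restrict])
  have "even (dim ?W)"
  proof (rule even_dim_nondegenerate[where B=B, OF l _ W])
    show "B u v = - B v u" if "u \<in> ?W" "v \<in> ?W" for u v
      by (rule skew) (use that in simp_all)
    fix u assume u: "u \<in> ?W" "\<And>v. v \<in> ?W \<Longrightarrow> B u v = 0"
    have "B u v = 0" if v: "v \<in> V" for v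
    proof -
      obtain y z where yz: "y \<in> span ?R" "\<And>w. w \<in> span ?R \<Longrightarrow> orthogonal z w" "v = y + z"
        by (rule orthogonal_subspace_decomp_exists[of ?R v]) blast
      have yR: "y \<in> ?R" using yz(1) R by (simp add: span_eq_iff[THEN iffD2])
      have "z = v - y" using yz by simp
      then have zV: "z \<in> V" using v yR V by (simp add: subspace_diff)
      have "orthogonal x z" if "x \<in> ?R" for x
        using yz(2)[OF span_base[OF that]] by (simp only: orthogonal_commute)
      with zV have "z \<in> ?W" by blast
      then have "B u z = 0" by (rule u(2))
      moreover have uV: "u \<in> V" using u(1) by (elim CollectE conjE)
      moreover have "B y u = 0" using yR uV by blast
      moreover have "B u v = - (B y u + B z u)" using skew[OF uV v] by (simp only: yz(3) Badd)
      moreover have "B z u = - B u z" using skew[OF zV uV] .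
      ultimately show ?thesis by simp
    qed
    note Bu = this
    have "u \<in> V" using u(1) by (elim CollectE conjE)
    then have uR: "u \<in> ?R" by (intro CollectI conjI ballI Bu)
    have "\<forall>x\<in>?R. orthogonal x u" using u(1) by (elim CollectE conjE)
    from bspec[OF this uR] have "orthogonal u u" .
    then show "u = 0" by (simp add: orthogonal_def)
  qed
  then show ?thesis using ev unfolding d[symmetric] by (simp only: even_add)
qed

subsection \<open>Semicontinuity of the dimension of kernels\<close>

text \<open>If the limit kernel were too small, its orthogonal complement would meet every kernel of
  \<open>T m\<close> in a unit vector by counting dimensions. A limit of these vectors lies in the
  complement and, by joint convergence in a finite basis, in the limit kernel.\<close>

lemma dim_kernel_limit:
  fixes T :: "nat \<Rightarrow> 'a::euclidean_space \<Rightarrow> 'b::real_normed_vector"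
  assumes T: "\<And>m. linear (T m)" and S: "linear S" and lim: "\<And>v. (\<lambda>m. T m v) \<longlonglongrightarrow> S v"
    and r: "\<And>m. r \<le> dim {v. T m v = 0}"
  shows "r \<le> dim {v. S v = 0}"
proof (rule ccontr)
  assume "\<not> r \<le> dim {v. S v = 0}"
  let ?K = "{v. S v = 0}"
  let ?W = "{y \<in> UNIV. \<forall>x\<in>?K. orthogonal x y}"
  have K: "subspace ?K" using S by (intro subspaceI) (auto simp: linear_0 linear_add linear_cmul)
  have W: "subspace ?W"
    by (rule subspaceI) (auto simp: orthogonal_def inner_add_right)
  have d: "dim ?W + dim ?K = DIM('a)" using dim_subspace_orthogonal_to_vectors[OF K subspace_UNIV] by simp
  have "\<exists>w. w \<in> ?W \<and> T m w = 0 \<and> norm w = 1" for m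
  proof -
    let ?Km = "{v. T m v = 0}"
    have Km: "subspace ?Km" using T[of m] by (intro subspaceI) (auto simp: linear_0 linear_add linear_cmul)
    have "dim {x + y |x y. x \<in> ?W \<and> y \<in> ?Km} \<le> DIM('a)" by (rule dim_subset_UNIV)
    then have "dim (?W \<inter> ?Km) \<noteq> 0"
      using dim_sums_Int[OF W Km] d r[of m] \<open>\<not> r \<le> dim ?K\<close> by linarith
    then obtain w where w: "w \<in> ?W" "w \<in> ?Km" "w \<noteq> 0" by (auto simp: dim_eq_0)
    then have "w /\<^sub>R norm w \<in> ?W" "w /\<^sub>R norm w \<in> ?Km" "norm (w /\<^sub>R norm w) = 1"
      using subspace_scale[OF W] subspace_scale[OF Km] by auto
    then show ?thesis by blast
  qed
  then have "\<exists>w. \<forall>m. w m \<in> ?W \<and> T m (w m) = 0 \<and> norm (w m) = 1" by (intro choice allI)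
  then obtain w where w: "\<And>m. w m \<in> ?W" "\<And>m. T m (w m) = 0" "\<And>m. norm (w m) = 1" by blast
  have "compact (sphere (0::'a) 1)" by simp
  moreover have "\<forall>m. w m \<in> sphere 0 1" using w by simp
  ultimately obtain w0 s where s: "w0 \<in> sphere 0 1" "strict_mono s" "(w \<circ> s) \<longlonglongrightarrow> w0"
    unfolding compact_def by blast
  have "w0 \<in> ?W"
    by (rule closed_sequentially[OF closed_subspace[OF W] _ s(3)]) (use w in auto)
  have "(\<lambda>m. T (s m) (w (s m))) \<longlonglongrightarrow> S w0"
  proof -
    have "(\<lambda>m. \<Sum>b\<in>Basis. (w (s m) \<bullet> b) *\<^sub>R T (s m) b) \<longlonglongrightarrow> (\<Sum>b\<in>Basis. (w0 \<bullet> b) *\<^sub>R S b)"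
    proof (intro tendsto_sum tendsto_scaleR tendsto_inner tendsto_const)
      show "(\<lambda>m. w (s m)) \<longlonglongrightarrow> w0" using s(3) by (simp add: o_def)
      show "(\<lambda>m. T (s m) b) \<longlonglongrightarrow> S b" for b
        using LIMSEQ_subseq_LIMSEQ[OF lim s(2)] by (simp add: o_def)
    qed
    moreover have exp: "L v = (\<Sum>b\<in>Basis. (v \<bullet> b) *\<^sub>R L b)" if "linear L" for L :: "'a \<Rightarrow> 'b" and v
    proof -
      have "L v = L (\<Sum>b\<in>Basis. (v \<bullet> b) *\<^sub>R b)" by (simp add: euclidean_representation)
      then show ?thesis using that by (simp add: linear_sum linear_cmul)
    qed
    have "T (s m) (w (s m)) = (\<Sum>b\<in>Basis. (w (s m) \<bullet> b) *\<^sub>R T (s m) b)"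
      "S w0 = (\<Sum>b\<in>Basis. (w0 \<bullet> b) *\<^sub>R S b)" for m using exp T S by blast+
    ultimately show ?thesis by simp
  qed
  then have "S w0 = 0" using w(2) by (simp add: LIMSEQ_const_iff)
  then have "orthogonal w0 w0" using \<open>w0 \<in> ?W\<close> by simp
  then show False using s(1) by (simp add: orthogonal_def)
qed

section \<open>Eigencovectors, even multiplicities and generic points\<close>

lemma M_phi_facts:
  assumes d: "CARD('n::{finite,linorder}) \<ge> 2" and M: "(p :: 'n rmat) \<in> M_phi"
  shows "p \<in> so" "pluecker p" "p \<bullet> p = 2" "dim (tangent p) = 2 * (CARD('n) - 2)"
    "v \<in> tangent p \<Longrightarrow> v \<in> so" "v \<in> tangent p \<Longrightarrow> pl_polar p v" "v \<in> tangent p \<Longrightarrow> p \<bullet> v = 0"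
    "v \<in> tangent p \<Longrightarrow> lie p (lie p v) = - v"
proof -
  obtain x y where xy: "frame x y" "p = wedge x y" using M_phi_frameD[OF d M] by metis
  show p: "p \<in> so" "pluecker p" "p \<bullet> p = 2" using xy
    by (auto simp: wedge_so wedge_pluecker wedge_inner frame_def)
  show "dim (tangent p) = 2 * (CARD('n) - 2)" using dim_frame_tangent xy by metis
  {
    assume v: "v \<in> tangent p"
    show "v \<in> so" using v tangent_subset_so[OF p(1)] by auto
    show "pl_polar p v" using tangent_pluecker v unfolding pl_polar_def xy(2) by blast
    show "p \<bullet> v = 0" by (rule tangent_inner[OF v p(1)])
    show "lie p (lie p v) = - v" using lie_lie_frame[OF xy(1)] v xy(2) by simp
  }
qed

lemma linear_N_op: "linear (N_op p)"
proof -
  have "N_op p = (\<lambda>v. v + (lie p \<circ> Jb) v)" by (simp add: N_op_def fun_eq_iff)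
  moreover have "linear (lie p \<circ> Jb)" by (rule linear_compose[OF linear_Jb linear_lie])
  from linear_compose_add[OF linear_ident this] have "linear (\<lambda>v. v + (lie p \<circ> Jb) v)" .
  ultimately show ?thesis by (simp only:)
qed

lemma N_op_tangent:
  assumes "p \<in> so" "v \<in> tangent p" shows "N_op p v \<in> tangent p"
  unfolding N_op_def using assms tangent_subset_so[OF assms(1)]
  by (intro subspace_add[OF subspace_tangent] lie_in_tangent so_Jb) auto

lemma inner_Jb: "Jb u \<bullet> v = - (u \<bullet> Jb (v :: 'n::{finite,linorder} rmat))"
proof -
  let ?A = "\<lambda>u v i j. if blk j < blk i then sg i * u $ pr i $ j * v $ i $ j else 0 :: real"
  let ?B = "\<lambda>u v i j. if blk i < blk j then sg j * u $ i $ pr j * v $ i $ j else 0 :: real"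
  have s: "(\<Sum>i\<in>UNIV. f (pr i)) = (\<Sum>i\<in>UNIV. f i)" for f :: "'n \<Rightarrow> real"
    using sum_pr[where P = "\<lambda>_. True" and f = f] by simp
  have eq: "Jb u \<bullet> v = (\<Sum>i\<in>UNIV. \<Sum>j\<in>UNIV. ?A u v i j) + (\<Sum>i\<in>UNIV. \<Sum>j\<in>UNIV. ?B u v i j)" for u v :: "'n rmat"
    unfolding inner_mat sum.distrib[symmetric] Jb_def by (intro sum.cong refl) simp
  have A: "(\<Sum>i\<in>UNIV. \<Sum>j\<in>UNIV. ?A u v i j) = - (\<Sum>i\<in>UNIV. \<Sum>j\<in>UNIV. ?A v u i j)"
    unfolding s[of "\<lambda>i. \<Sum>j\<in>UNIV. ?A u v i j", symmetric] sum_negf[symmetric]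
    by (intro sum.cong refl) simp
  have "(\<Sum>j\<in>UNIV. ?B u v i j) = - (\<Sum>j\<in>UNIV. ?B v u i j)" for i
    unfolding s[of "\<lambda>j. ?B u v i j", symmetric] sum_negf[symmetric]
    by (intro sum.cong refl) simp
  then have "(\<Sum>i\<in>UNIV. \<Sum>j\<in>UNIV. ?B u v i j) = - (\<Sum>i\<in>UNIV. \<Sum>j\<in>UNIV. ?B v u i j)"
    by (simp add: sum_negf)
  then have "Jb u \<bullet> v = - (Jb v \<bullet> u)" unfolding eq A by simp
  then show ?thesis by (simp add: inner_commute)
qed

text \<open>\<open>N_op p - x\<close> followed by \<open>lie p\<close> is skew on the tangent space.\<close>

lemma even_dim_eigenspace:
  assumes d: "CARD('n::{finite,linorder}) \<ge> 2" and M: "(p :: 'n rmat) \<in> M_phi"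
  shows "even (dim (lker (N_op p) (tangent p) [x]))"
proof -
  note p = M_phi_facts[OF d M]
  let ?T = "tangent p"
  define B where "B u v = lie p (N_op p u - x *\<^sub>R u) \<bullet> v" for u v
  have "lker (N_op p) ?T [x] = {u \<in> ?T. \<forall>v\<in>?T. B u v = 0}"
  proof -
    have "N_op p u - x *\<^sub>R u = 0 \<longleftrightarrow> (\<forall>v\<in>?T. B u v = 0)" if u: "u \<in> ?T" for u
    proof
      assume *: "\<forall>v\<in>?T. B u v = 0"
      let ?w = "N_op p u - x *\<^sub>R u"
      have w: "?w \<in> ?T" using u p(1)
        by (intro subspace_diff[OF subspace_tangent] subspace_scale[OF subspace_tangent] N_op_tangent)
      then have "lie p ?w \<in> ?T" by (intro lie_in_tangent p(5))
      then have "lie p ?w \<bullet> lie p ?w = 0" using * by (simp add: B_def)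
      then have "lie p (lie p ?w) = 0" using linear_0[OF linear_lie, of p] by simp
      then show "?w = 0" using p(8)[OF w] by simp
    qed (simp add: B_def linear_0[OF linear_lie])
    then show ?thesis by (auto simp: lker_def)
  qed
  moreover have "even (dim {u \<in> ?T. \<forall>v\<in>?T. B u v = 0})"
  proof (rule even_dim_radical)
    show "linear (\<lambda>u. B u v)" for v
      by (rule linearI) (simp_all add: B_def linear_add[OF linear_N_op] linear_cmul[OF linear_N_op]
          linear_add[OF linear_lie] linear_diff[OF linear_lie] linear_cmul[OF linear_lie] algebra_simps inner_add_left inner_diff_left)
    \<comment> \<open>\<open>Jb u\<close> need not be tangent, so ad p squared cannot be evaluated
      on it; it is moved to the tangent vector v instead, where it is -1.\<close>
    have eq: "B u v = (1 - x) * (lie p u \<bullet> v) - Jb u \<bullet> v" if "u \<in> ?T" "v \<in> ?T" for u v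
    proof -
      have "lie p (lie p (Jb u)) \<bullet> v = Jb u \<bullet> lie p (lie p v)"
        using inner_lie[OF p(1)] by simp
      also have "\<dots> = - (Jb u \<bullet> v)" using p(8)[OF that(2)] by simp
      finally show ?thesis
        by (simp add: B_def N_op_def linear_add[OF linear_lie] linear_diff[OF linear_lie] linear_cmul[OF linear_lie]
            inner_add_left inner_diff_left algebra_simps)
    qed
    show "B u v = - B v u" if "u \<in> ?T" "v \<in> ?T" for u v
    proof -
      have "lie p u \<bullet> v = - (lie p v \<bullet> u)" "Jb u \<bullet> v = - (Jb v \<bullet> u)"
        using inner_lie[OF p(1), of u v] inner_Jb[of u v] by (simp_all add: inner_commute)
      then show ?thesis unfolding eq[OF that] eq[OF that(2,1)] by (simp add: algebra_simps)
    qed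
  qed (simp_all add: subspace_tangent p(4))
  ultimately show ?thesis by simp
qed

text \<open>An eigencovector l vanishes on the image of N - x. If l is nonzero on the tangent space,
  N - x is not surjective there, hence not injective, and evenness raises the dimension of the
  kernel from 1 to 2.\<close>

lemma dim_eigenspace_ge_2:
  assumes d: "CARD('n::{finite,linorder}) \<ge> 2" and M: "(p :: 'n rmat) \<in> M_phi"
    and l: "linear l" "\<And>v. v \<in> tangent p \<Longrightarrow> l (N_op p v) = x * l v"
    and v0: "v0 \<in> tangent p" "l v0 \<noteq> (0::real)"
  shows "2 \<le> dim (lker (N_op p) (tangent p) [x])"
proof -
  note p = M_phi_facts[OF d M]
  let ?T = "tangent p" and ?K = "lker (N_op p) (tangent p) [x]"
  have "?K \<noteq> {0}"
  proof
    assume K: "?K = {0}"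
    let ?f = "\<lambda>v. N_op p v - x *\<^sub>R v"
    have f: "linear ?f" by (rule linear_shift[OF linear_N_op])
    have "inj_on ?f ?T" unfolding linear_injective_on_subspace_0[OF f subspace_tangent]
      using K by (auto simp: lker_def)
    then have "inj_on ?f (span ?T)" by (simp only: span_eq_iff[THEN iffD2] subspace_tangent)
    then have dim: "dim (?f ` ?T) = dim ?T" by (rule dim_image_eq[OF f])
    have sub: "?f ` ?T \<subseteq> ?T" using p(1)
      by (auto intro!: subspace_diff[OF subspace_tangent] subspace_scale[OF subspace_tangent] N_op_tangent)
    have "?f ` ?T = ?T"
      by (rule subspace_dim_equal[OF linear_subspace_image[OF f subspace_tangent] subspace_tangent sub])
         (simp add: dim)
    then obtain v where "v \<in> ?T" "v0 = ?f v" using v0 by blast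
    then have "l v0 = 0" using l by (simp add: linear_diff linear_cmul)
    then show False using v0 by simp
  qed
  moreover have "0 \<in> ?K" by (rule subspace_0[OF subspace_lker[OF linear_N_op subspace_tangent]])
  ultimately have "\<not> ?K \<subseteq> {0}" by blast
  then have "dim ?K \<noteq> 0" unfolding dim_eq_0 .
  then have "0 < dim ?K" by (rule neq0_conv[THEN iffD1])
  then show ?thesis by (rule dvd_imp_le[OF even_dim_eigenspace[OF d M]])
qed

lemma linear_ip: "linear (ip c p)"
  by (rule linearI) (simp_all add: ip_def sum.distrib sum_distrib_left algebra_simps)

lemma linear_ss: "linear (ss c)"
  by (rule linearI) (simp_all add: ss_def sum.distrib sum_distrib_left algebra_simps add_divide_distrib)

text \<open>Since \<open>ip c p\<close> is the differential of a^2, for s of square 1 this is 2 a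
  (da - s ds), the eigencovector of the overview up to the factor -2 s a. The factor removes the
  singularity of the square root at a = 0.\<close>

definition ecov :: "real \<Rightarrow> nat \<Rightarrow> 'n::{finite,linorder} rmat \<Rightarrow> 'n rmat \<Rightarrow> real" where
  "ecov s c p v = ip c p v - 2 * s * aa c p * ss c v"

lemma linear_ecov: "linear (ecov s c p)"
  unfolding ecov_def
  by (rule linearI) (simp_all add: linear_add[OF linear_ip] linear_cmul[OF linear_ip]
      linear_add[OF linear_ss] linear_cmul[OF linear_ss] algebra_simps)

lemma
  assumes d: "CARD('n::{finite,linorder}) \<ge> 2" and M: "(p :: 'n rmat) \<in> M_phi"
    and c: "c \<le> CARD('n) div 2" and v: "v \<in> tangent p"
  shows ip_N: "ip c p (N_op p v) = (1 - ss c p) * ip c p v - 2 * (aa c p)\<^sup>2 * ss c v"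
    and ss_N: "ss c (N_op p v) = (1 - ss c p) * ss c v - ip c p v / 2"
    and ecov_N: "s * s = 1 \<Longrightarrow> ecov s c p (N_op p v) = (1 + s * aa c p - ss c p) * ecov s c p v"
proof -
  note p = M_phi_facts[OF d M]
  note v = p(5-7)[OF v]
  show 1: "ip c p (N_op p v) = (1 - ss c p) * ip c p v - 2 * (aa c p)\<^sup>2 * ss c v"
    unfolding N_op_def linear_add[OF linear_ip] ip_N_op[OF p(1) v(1,2)] aa_sq by (simp add: algebra_simps)
  show 2: "ss c (N_op p v) = (1 - ss c p) * ss c v - ip c p v / 2"
    unfolding N_op_def linear_add[OF linear_ss] ss_N_op[OF c p(1) v] by (simp add: algebra_simps)
  assume s: "s * s = 1"
  have "s * (s * z) = z" for z using s by (metis mult.assoc mult_1)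
  then show "ecov s c p (N_op p v) = (1 + s * aa c p - ss c p) * ecov s c p v"
    unfolding ecov_def 1 2 by (simp add: algebra_simps power2_eq_square)
qed

lemma ip_0:
  fixes p :: "'n::{finite,linorder} rmat"
  assumes p: "p \<in> so" shows "ip 0 p v = 0"
proof -
  have "p $ i $ j = 0" if "i \<in> low 0" "j \<in> low 0" for i j
  proof -
    have "blk i = 0" "blk j = 0" using that by (auto simp: low_def)
    then have "j = i" using blk_eqD[of i j] by (auto simp: pr_def)
    then show ?thesis using so_diag[OF p] by simp
  qed
  then show ?thesis by (simp add: ip_def)
qed

lemma aa_0: "p \<in> so \<Longrightarrow> aa 0 p = 0"
  by (simp add: aa_def ip_0)

lemma aa_top: "p \<bullet> p = 2 \<Longrightarrow> aa (CARD('n) div 2) (p :: 'n::{finite,linorder} rmat) = 1"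
  by (simp add: aa_def ip_def low_top inner_mat)

lemma ss_top: "ss (CARD('n) div 2) (p :: 'n::{finite,linorder} rmat) = 0"
  by (simp add: ss_def low_top)

text \<open>Nonzero discriminants make interlacing strict. For even size the corner at c = 0 is
  empty and \<open>disc 0\<close> vanishes identically; \<open>bb 1\<close> takes its place, because
  it keeps the innermost a away from 0.\<close>

definition generic :: "'n::{finite,linorder} rmat \<Rightarrow> bool" where
  "generic p \<longleftrightarrow> (\<forall>c < CARD('n) div 2. odd CARD('n) \<or> 0 < c \<longrightarrow> disc c p \<noteq> 0) \<and>
     (even CARD('n) \<longrightarrow> bb 1 p \<noteq> 0)"

lemma ss_aa_Lipschitz:
  fixes p :: "'n::{finite,linorder} rmat"
  assumes p: "p \<in> so" "pluecker p" and c: "c' \<le> c" "c \<le> CARD('n) div 2"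
  shows "\<bar>ss c' p - ss c p\<bar> \<le> aa c p - aa c' p"
  using c
proof (induction rule: dec_induct)
  case (step c)
  then have c: "Suc c \<le> CARD('n) div 2" by simp
  show ?case using step interlacing[OF c p] ss_Suc[OF c p(1)] by simp
qed simp

lemma ss_aa_strict:
  fixes p :: "'n::{finite,linorder} rmat"
  assumes p: "p \<in> so" "pluecker p" and g: "generic p"
    and c: "c' < c" "c \<le> CARD('n) div 2" "odd CARD('n) \<or> 0 < c'"
  shows "\<bar>ss c' p - ss c p\<bar> < aa c p - aa c' p"
proof -
  have c': "Suc c' \<le> CARD('n) div 2" using c by simp
  have "disc c' p \<noteq> 0" using g c by (auto simp: generic_def)
  from interlacing_strict[OF c' p this] have "\<bar>bb (Suc c') p\<bar> < aa (Suc c') p - aa c' p" .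
  moreover have "\<bar>ss (Suc c') p - ss c p\<bar> \<le> aa c p - aa (Suc c') p"
    by (rule ss_aa_Lipschitz[OF p]) (use c in auto)
  ultimately show ?thesis using ss_Suc[OF c' p(1)] by linarith
qed

lemma aa_pos:
  fixes p :: "'n::{finite,linorder} rmat"
  assumes p: "p \<in> so" "pluecker p" and g: "generic p" and c: "0 < c" "c \<le> CARD('n) div 2"
  shows "0 < aa c p"
proof (cases "odd CARD('n)")
  case True
  then show ?thesis using ss_aa_strict[OF p g c] aa_nonneg[of 0 p] by linarith
next
  case False
  then have "bb 1 p \<noteq> 0" using g by (auto simp: generic_def)
  moreover have "\<bar>bb (Suc 0) p\<bar> \<le> aa (Suc 0) p - aa 0 p" by (rule interlacing) (use c p in auto)
  moreover have "\<bar>ss 1 p - ss c p\<bar> \<le> aa c p - aa 1 p" by (rule ss_aa_Lipschitz) (use c p in auto)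
  ultimately show ?thesis using aa_nonneg[of 0 p] by (simp del: aa_nonneg)
qed

definition plist :: "'n::{finite,linorder} rmat \<Rightarrow> real list" where
  "plist p = (let N = CARD('n) div 2 in
     map (\<lambda>k. 1 + aa (N - k) p - ss (N - k) p) [1..<N] @
     (if odd CARD('n) then [1 - ss 0 p] else []) @
     map (\<lambda>k. 1 - aa (N - k) p - ss (N - k) p) (rev [1..<N]))"

text \<open>An arbitrary transitive relation R yields the weak order at all points and the strict
  order at generic ones by the same argument. Values with plus decrease and values with minus
  increase as c decreases, meeting at 1 - \<open>ss 0 p\<close> in the odd case.\<close>

lemma sorted_wrt_plist:
  fixes p :: "'n::{finite,linorder} rmat" and R :: "real \<Rightarrow> real \<Rightarrow> bool"
  defines "P \<equiv> \<lambda>c. 1 + aa c p - ss c p" and "Q \<equiv> \<lambda>c. 1 - aa c p - ss c p"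
  assumes p: "p \<in> so" and R: "transp R"
    and step: "\<And>c c'. c' < c \<Longrightarrow> c \<le> CARD('n) div 2 \<Longrightarrow> odd CARD('n) \<or> 0 < c' \<Longrightarrow> R (P c) (P c') \<and> R (Q c') (Q c)"
    and PQ: "\<And>c. 0 < c \<Longrightarrow> c \<le> CARD('n) div 2 \<Longrightarrow> R (P c) (Q c)"
  shows "sorted_wrt R (plist p)"
proof -
  let ?N = "CARD('n) div 2"
  have PQ': "R (P c) (Q c')" if c: "0 < c" "c \<le> ?N" "0 < c'" "c' \<le> ?N" for c c'
  proof (cases c c' rule: linorder_cases)
    case less
    then show ?thesis using step[OF less] PQ[of c] c transpD[OF R] by blast
  next
    case greater
    then show ?thesis using step[OF greater] PQ[of c'] c transpD[OF R] by blast
  qed (use PQ c in simp)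
  have mid: "P 0 = 1 - ss 0 p" "Q 0 = 1 - ss 0 p" using aa_0[OF p] by (simp_all add: P_def Q_def)
  have "sorted_wrt R (map (\<lambda>k. P (?N - k)) [1..<?N])"
    unfolding sorted_wrt_map by (rule sorted_wrt_mono_rel[OF _ sorted_wrt_upt]) (use step in auto)
  moreover have "sorted_wrt R (map (\<lambda>k. Q (?N - k)) (rev [1..<?N]))"
    unfolding sorted_wrt_map sorted_wrt_rev
    by (rule sorted_wrt_mono_rel[OF _ sorted_wrt_upt]) (use step in auto)
  ultimately have "sorted_wrt R (map (\<lambda>k. P (?N - k)) [1..<?N] @ (if odd CARD('n) then [1 - ss 0 p] else []) @
      map (\<lambda>k. Q (?N - k)) (rev [1..<?N]))"
    using PQ' step[of 0] mid by (auto simp: sorted_wrt_append)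
  then show ?thesis by (simp add: plist_def P_def Q_def Let_def)
qed

lemma sorted_plist:
  fixes p :: "'n::{finite,linorder} rmat"
  assumes p: "p \<in> so" "pluecker p"
  shows "sorted_wrt (\<ge>) (plist p)"
proof (rule sorted_wrt_plist[OF p(1)])
  fix c c' assume "c' < c" "c \<le> CARD('n) div 2"
  then have "\<bar>ss c' p - ss c p\<bar> \<le> aa c p - aa c' p" by (intro ss_aa_Lipschitz[OF p]) auto
  then show "1 + aa c' p - ss c' p \<le> 1 + aa c p - ss c p \<and> 1 - aa c p - ss c p \<le> 1 - aa c' p - ss c' p"
    by (simp add: abs_le_iff)
next
  show "1 - aa c p - ss c p \<le> 1 + aa c p - ss c p" for c using aa_nonneg[of c p] by linarith
qed (auto simp: transp_def)

lemma strict_sorted_plist: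
  fixes p :: "'n::{finite,linorder} rmat"
  assumes p: "p \<in> so" "pluecker p" and g: "generic p"
  shows "sorted_wrt (>) (plist p)"
proof (rule sorted_wrt_plist[OF p(1)])
  fix c c' assume "c' < c" "c \<le> CARD('n) div 2" "odd CARD('n) \<or> 0 < c'"
  then have "\<bar>ss c' p - ss c p\<bar> < aa c p - aa c' p" by (rule ss_aa_strict[OF p g])
  then show "1 + aa c' p - ss c' p < 1 + aa c p - ss c p \<and> 1 - aa c p - ss c p < 1 - aa c' p - ss c' p"
    by (simp add: abs_less_iff)
next
  show "1 - aa c p - ss c p < 1 + aa c p - ss c p" if "0 < c" "c \<le> CARD('n) div 2" for c
    using aa_pos[OF p g that] by linarith
qed (auto simp: transp_def)

lemma distinct_plist:
  fixes p :: "'n::{finite,linorder} rmat"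
  assumes "p \<in> so" "pluecker p" "generic p"
  shows "distinct (plist p)"
proof -
  have "sorted_wrt (>) xs \<Longrightarrow> distinct xs" for xs :: "real list"
    by (induction xs) auto
  then show ?thesis using strict_sorted_plist[OF assms] by blast
qed

lemma length_plist:
  "CARD('n) \<ge> 2 \<Longrightarrow> length (plist (p :: 'n::{finite,linorder} rmat)) = CARD('n) - 2"
  by (cases "even CARD('n)") (auto simp: plist_def Let_def elim!: evenE oddE)

lemma ecov_nonzero:
  fixes p :: "'n::{finite,linorder} rmat"
  assumes p: "p \<in> so" "pluecker p" and g: "generic p"
    and c: "0 < c" "c < CARD('n) div 2" and s: "s * s = 1"
  obtains v where "v \<in> tangent p" "ecov s c p v \<noteq> 0"
proof -
  have c': "Suc c \<le> CARD('n) div 2" using c by simp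
  obtain v where v: "v \<in> tangent p" "ip c p v = 2 * bb (Suc c) p * ip c p p" "ss c v = - cc c p p"
    by (rule test_vector[OF c' p])
  have "ecov s c p v = 2 * aa c p * (2 * bb (Suc c) p * aa c p + s * cc c p p)"
    using aa_sq[of c p] by (simp add: ecov_def v power2_eq_square algebra_simps)
  moreover have "2 * bb (Suc c) p * aa c p + s * cc c p p \<noteq> 0"
  proof
    assume "2 * bb (Suc c) p * aa c p + s * cc c p p = 0"
    then have "(s * cc c p p)\<^sup>2 = (2 * bb (Suc c) p * aa c p)\<^sup>2" by (metis add_eq_0_iff power2_minus)
    then have "disc c p = 0" using s by (simp add: disc_def power_mult_distrib aa_sq power2_eq_square[of s])
    then show False using g c by (auto simp: generic_def)
  qed
  moreover have "aa c p \<noteq> 0" using aa_pos[OF p g c(1)] c by simp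
  ultimately show thesis using that v(1) by simp
qed

lemma ss_0_nonzero:
  fixes p :: "'n::{finite,linorder} rmat"
  assumes p: "p \<in> so" "pluecker p" and g: "generic p" and d: "odd CARD('n)" "CARD('n) \<ge> 2"
  obtains v where "v \<in> tangent p" "ss 0 v \<noteq> 0"
proof -
  have c': "Suc 0 \<le> CARD('n) div 2" using d by simp
  obtain v where v: "v \<in> tangent p" "ip 0 p v = 2 * bb (Suc 0) p * ip 0 p p" "ss 0 v = - cc 0 p p"
    by (rule test_vector[OF c' p])
  have "disc 0 p \<noteq> 0" using g d by (auto simp: generic_def)
  then have "cc 0 p p \<noteq> 0" using ip_0[OF p(1), of p] by (auto simp: disc_def)
  then show thesis using that v by simp
qed

lemma generic_eigenspaces:
  fixes p :: "'n::{finite,linorder} rmat"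
  assumes d: "CARD('n) \<ge> 2" and M: "p \<in> M_phi" and g: "generic p" and x: "x \<in> set (plist p)"
  shows "2 \<le> dim (lker (N_op p) (tangent p) [x])"
proof -
  note p = M_phi_facts[OF d M]
  let ?N = "CARD('n) div 2"
  consider s c where "s * s = 1" "0 < c" "c < ?N" "x = 1 + s * aa c p - ss c p" | "odd CARD('n)" "x = 1 - ss 0 p"
  proof -
    from x consider k where "k \<in> {1..<?N}" "x = 1 + 1 * aa (?N - k) p - ss (?N - k) p"
      | k where "k \<in> {1..<?N}" "x = 1 + (- 1) * aa (?N - k) p - ss (?N - k) p" | "odd CARD('n)" "x = 1 - ss 0 p"
      by (auto simp: plist_def Let_def split: if_splits)
    then show thesis
    proof cases
      case 1 then show ?thesis using that(1)[of 1 "?N - k"] by simp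
    next
      case 2 then show ?thesis using that(1)[of "-1" "?N - k"] by simp
    next
      case 3 then show ?thesis using that(2) by simp
    qed
  qed
  then show ?thesis
  proof cases
    case 1
    obtain v where v: "v \<in> tangent p" "ecov s c p v \<noteq> 0"
      by (rule ecov_nonzero[OF p(1,2) g 1(2,3,1)])
    show ?thesis unfolding 1(4)
      by (rule dim_eigenspace_ge_2[OF d M linear_ecov ecov_N[OF d M _ _ 1(1)] v]) (use 1 in auto)
  next
    case 2
    obtain v where v: "v \<in> tangent p" "ss 0 v \<noteq> 0" by (rule ss_0_nonzero[OF p(1,2) g 2(1) d])
    have *: "ss 0 (N_op p v) = (1 - ss 0 p) * ss 0 v" if "v \<in> tangent p" for v
      using ss_N[OF d M _ that, of 0] ip_0[OF p(1), of v] by simp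
    show ?thesis unfolding 2(2)
      by (rule dim_eigenspace_ge_2[OF d M linear_ss * v])
  qed
qed

subsection \<open>Points of the orbit with prescribed parameters\<close>

lemma low_mono: "c \<le> c' \<Longrightarrow> low c \<subseteq> low c'"
  by (auto simp: low_def)

lemma params_cong:
  fixes p p' :: "'n::{finite,linorder} rmat"
  assumes eq: "\<And>i j. i \<in> low c \<Longrightarrow> j \<in> low c \<Longrightarrow> p $ i $ j = p' $ i $ j" and j: "j \<le> c"
  shows "aa j p = aa j p'" "1 \<le> j \<Longrightarrow> j \<le> CARD('n) div 2 \<Longrightarrow> bb j p = bb j p'"
proof -
  have "ip j p p = ip j p' p'"
    unfolding ip_def
  proof (intro sum.cong refl)
    fix i k :: 'n assume "i \<in> low j" "k \<in> low j"
    then have "p $ i $ k = p' $ i $ k" using low_mono[OF j] by (intro eq) auto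
    then show "p $ i $ k * p $ i $ k = p' $ i $ k * p' $ i $ k" by simp
  qed
  then show "aa j p = aa j p'" by (simp add: aa_def)
  assume "1 \<le> j" "j \<le> CARD('n) div 2"
  then have "hd_idx j \<in> (low c :: 'n set)" "pr (hd_idx j) \<in> (low c :: 'n set)"
    using j blk_hd[where 'n='n, of j] by (auto simp: low_def)
  then show "bb j p = bb j p'" by (simp add: bb_def eq)
qed

definition supported :: "'n set \<Rightarrow> real^'n::finite \<Rightarrow> bool" where
  "supported S x \<longleftrightarrow> (\<forall>i. i \<notin> S \<longrightarrow> x $ i = 0)"

lemma ip_supported:
  assumes "supported (low c) x" "supported (low c) y"
  shows "ip c (wedge x y) (wedge x y) = 2 * ((x \<bullet> x) * (y \<bullet> y) - (x \<bullet> y)\<^sup>2)"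
proof -
  let ?p = "wedge x y"
  have z: "?p $ i $ j = 0" if "i \<notin> low c \<or> j \<notin> low c" for i j
    using assms that by (auto simp: supported_def wedge_nth)
  have "?p \<bullet> ?p = (\<Sum>i\<in>low c. \<Sum>j\<in>UNIV. ?p $ i $ j * ?p $ i $ j)"
    unfolding inner_mat using z by (intro sum.mono_neutral_right) auto
  also have "\<dots> = ip c ?p ?p"
    unfolding ip_def by (intro sum.cong refl sum.mono_neutral_right) (auto simp: z)
  finally show ?thesis using wedge_inner[of x y] by simp
qed

text \<open>Unlike plain Gram-Schmidt this also covers x = 0, where a coordinate vector inside S
  becomes the unit vector and y' is 0. Nonemptiness of S is what makes this possible.\<close>

lemma wedge_normal_form_supported:
  assumes x: "supported S x" and y: "supported S y" and i: "i \<in> S"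
  obtains x' y' where "supported S x'" "supported S y'" "x' \<bullet> x' = 1" "x' \<bullet> y' = 0" "wedge x y = wedge x' y'"
proof (cases "x = 0")
  case True
  have "supported S (axis i 1)" using i by (auto simp: supported_def axis_def)
  then show ?thesis using True that[of "axis i 1" 0]
    by (simp add: supported_def wedge_simps inner_axis_axis)
next
  case False
  let ?x = "x /\<^sub>R norm x" and ?y = "norm x *\<^sub>R (y - ((x \<bullet> y) / (x \<bullet> x)) *\<^sub>R x)"
  have "?x \<bullet> ?x = 1" using False by (simp add: dot_square_norm power2_eq_square)
  moreover have "?x \<bullet> ?y = 0" using False by (simp add: inner_diff_right)
  ultimately show ?thesis
    using x y that[of ?x ?y] wedge_normal_form[OF False, of y] by (auto simp: supported_def)
qed

text \<open>P + Q and P - Q are the square roots of K + 2m and K - 2m.\<close>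

lemma sum_prod_split:
  fixes K m :: real
  assumes "2 * \<bar>m\<bar> \<le> K"
  obtains P Q where "P * Q = m" "P\<^sup>2 + Q\<^sup>2 = K"
proof -
  let ?u = "sqrt (K + 2 * m)" and ?v = "sqrt (K - 2 * m)"
  have u: "?u * ?u = K + 2 * m" "?v * ?v = K - 2 * m" using assms by auto
  have "((?u + ?v) / 2) * ((?u - ?v) / 2) = m" using u by (simp add: field_simps)
  moreover have "((?u + ?v) / 2)\<^sup>2 + ((?u - ?v) / 2)\<^sup>2 = K"
    using u by (simp add: power2_eq_square field_simps)
  ultimately show thesis using that by blast
qed

text \<open>Blocks are added from the inside out. The new off-diagonal block must have P Q = a_c
  b_{c+1} by the Pluecker relation, and P^2 + Q^2 equal to the growth of a^2 minus b_{c+1}^2 by the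
  norm; the interlacing inequality is the solvability of these two equations.\<close>

lemma exists_with_params:
  fixes a b :: "nat \<Rightarrow> real"
  assumes a0: "a 0 = 0" and ab: "\<And>c. c < CARD('n::{finite,linorder}) div 2 \<Longrightarrow> \<bar>b (Suc c)\<bar> \<le> a (Suc c) - a c"
    and ev: "even CARD('n) \<Longrightarrow> \<bar>b 1\<bar> = a 1" and c: "c \<le> CARD('n) div 2"
  shows "\<exists>x y :: 'n rvec. supported (low c) x \<and> supported (low c) y \<and>
    (\<forall>j\<le>c. aa j (wedge x y) = a j) \<and> (\<forall>j. 1 \<le> j \<and> j \<le> c \<longrightarrow> bb j (wedge x y) = b j)"
  using c
proof (induction c)
  case 0
  have "(0 :: 'n rmat) \<in> so" by (rule subspace_0[OF subspace_so])
  then show ?case using a0 by (intro exI[of _ 0]) (simp add: supported_def aa_0 wedge_simps)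
next
  case (Suc c)
  then obtain x0 y0 :: "'n rvec" where xy0: "supported (low c) x0" "supported (low c) y0"
    "\<And>j. j \<le> c \<Longrightarrow> aa j (wedge x0 y0) = a j" "\<And>j. 1 \<le> j \<Longrightarrow> j \<le> c \<Longrightarrow> bb j (wedge x0 y0) = b j"
    by auto
  have ac: "0 \<le> a c" using xy0(3)[of c] aa_nonneg[of c "wedge x0 y0"] by simp
  have bc: "\<bar>b (Suc c)\<bar> \<le> a (Suc c) - a c" using ab Suc.prems by simp
  then have aSc: "0 \<le> a (Suc c)" using ac by linarith
  let ?q = "hd_idx (Suc c) :: 'n"
  let ?r = "pr ?q"
  let ?e = "axis ?q 1 :: 'n rvec" and ?f = "axis ?r 1 :: 'n rvec"
  have q: "low (Suc c) = insert ?q (insert ?r (low c))" "?q \<notin> low c" "?r \<notin> low c" "?q \<noteq> ?r"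
    using low_Suc[OF Suc.prems] by auto
  \<comment> \<open>Keeping the old corner preserves all earlier parameters, so only the total norm
    and the new Pfaffian have to be arranged.\<close>
  have step: ?case
    if X: "supported (low (Suc c)) X" "supported (low (Suc c)) Y"
      and eq: "\<And>i j. i \<in> low c \<Longrightarrow> j \<in> low c \<Longrightarrow> wedge X Y $ i $ j = wedge x0 y0 $ i $ j"
      and n: "(X \<bullet> X) * (Y \<bullet> Y) - (X \<bullet> Y)\<^sup>2 = (a (Suc c))\<^sup>2"
      and b: "wedge X Y $ ?q $ ?r = b (Suc c)" for X Y
  proof (intro exI conjI allI impI)
    have "aa (Suc c) (wedge X Y) = a (Suc c)"
      using aSc by (simp add: aa_def ip_supported[OF X] n)
    then show "aa j (wedge X Y) = a j" if "j \<le> Suc c" for j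
      using params_cong(1)[where c = c and j = j, OF eq] xy0(3)[of j] that by (cases "j = Suc c") auto
    show "bb j (wedge X Y) = b j" if "1 \<le> j \<and> j \<le> Suc c" for j
      using params_cong(2)[where c = c and j = j, OF eq] xy0(4)[of j] that b Suc.prems by (cases "j = Suc c") (auto simp: bb_def)
  qed (rule X)+
  show ?case
  proof (cases "low c = ({} :: 'n set)")
    case True
    \<comment> \<open>An empty corner occurs only at the start in even size. The first block is then
      a multiple of sigma, which is why the hypothesis demands equality of |b_1| and a_1.\<close>
    have c0: "c = 0"
    proof (rule ccontr)
      assume "c \<noteq> 0"
      then have "hd_idx c \<in> (low c :: 'n set)" using blk_hd[where 'n='n, of c] Suc.prems by (simp add: low_def)
      then show False using True by simp
    qed
    have "even CARD('n)"
    proof (rule ccontr)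
      assume o: "odd CARD('n)"
      have "pos (idx 0 :: 'n) = 0" by (rule pos_idx) simp
      then have "blk (idx 0 :: 'n) = 0" by (simp add: blk_odd[OF o])
      then have "(idx 0 :: 'n) \<in> low c" by (simp add: low_def)
      then show False using True by blast
    qed
    then have b1: "\<bar>b (Suc c)\<bar> = a (Suc c)" using ev c0 by simp
    show ?thesis
    proof (rule step)
      show "supported (low (Suc c)) ?e" "supported (low (Suc c)) (b (Suc c) *\<^sub>R ?f)"
        using q by (auto simp: supported_def axis_def)
      show "(?e \<bullet> ?e) * ((b (Suc c) *\<^sub>R ?f) \<bullet> (b (Suc c) *\<^sub>R ?f)) - (?e \<bullet> (b (Suc c) *\<^sub>R ?f))\<^sup>2 = (a (Suc c))\<^sup>2"
        using q(4) b1 by (simp add: inner_axis_axis power2_eq_square flip: b1)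
      show "wedge ?e (b (Suc c) *\<^sub>R ?f) $ ?q $ ?r = b (Suc c)"
        using q(4) by (simp add: wedge_nth axis_def)
    qed (use True in auto)
  next
    case False
    then obtain i0 :: 'n where "i0 \<in> low c" by auto
    then obtain x y where xy: "supported (low c) x" "supported (low c) y" "x \<bullet> x = 1" "x \<bullet> y = 0"
      "wedge x0 y0 = wedge x y"
      using wedge_normal_form_supported[OF xy0(1,2)] by metis
    have yy: "y \<bullet> y = (a c)\<^sup>2"
    proof -
      have "(aa c (wedge x y))\<^sup>2 = y \<bullet> y" unfolding aa_sq ip_supported[OF xy(1,2)] using xy by simp
      then show ?thesis using xy0(3)[of c] xy(5) by simp
    qed
    have z: "x $ ?q = 0" "x $ ?r = 0" "y $ ?q = 0" "y $ ?r = 0" using xy(1,2) q by (auto simp: supported_def)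
    have orth: "x \<bullet> ?e = 0" "x \<bullet> ?f = 0" "y \<bullet> ?e = 0" "y \<bullet> ?f = 0" "?e \<bullet> x = 0" "?f \<bullet> x = 0" "?e \<bullet> y = 0" "?f \<bullet> y = 0"
      "?e \<bullet> ?e = 1" "?f \<bullet> ?f = 1" "?e \<bullet> ?f = 0" "?f \<bullet> ?e = 0"
      using z q(4) by (auto simp: inner_axis inner_axis' inner_axis_axis) (simp_all add: axis_def)
    let ?K = "(a (Suc c))\<^sup>2 - (a c)\<^sup>2 - (b (Suc c))\<^sup>2"
    have "(a c + \<bar>b (Suc c)\<bar>)\<^sup>2 \<le> (a (Suc c))\<^sup>2" using ac bc by (intro power_mono) auto
    then have "2 * \<bar>a c * b (Suc c)\<bar> \<le> ?K" using ac by (simp add: power2_sum abs_mult)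
    \<comment> \<open>\<open>P\<close> and \<open>Q\<close> are the singular values of the new off-diagonal block\<close>
    then obtain P Q where PQ: "P * Q = a c * b (Suc c)" "P\<^sup>2 + Q\<^sup>2 = ?K" by (rule sum_prod_split)
    have sup: "supported (low (Suc c)) (r *\<^sub>R v + s *\<^sub>R ?e + t *\<^sub>R ?f)" if "supported (low c) v" for v r s t
      using that q by (auto simp: supported_def axis_def)
    show ?thesis
    proof (cases "a c = 0")
      case a0: False
      \<comment> \<open>As y has norm a_c and x norm 1, tilting x by P / a_c and y by Q gives rows
        of norm P and Q in the off-diagonal block, and their new components give the Pfaffian P Q /
        a_c.\<close>
      let ?X = "1 *\<^sub>R x + (P / a c) *\<^sub>R ?e + 0 *\<^sub>R ?f" and ?Y = "1 *\<^sub>R y + 0 *\<^sub>R ?e + Q *\<^sub>R ?f"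
      have bPQ: "b (Suc c) = P * Q / a c" using PQ a0 by simp
      show ?thesis
      proof (rule step[of ?X ?Y])
        show "wedge ?X ?Y $ i $ j = wedge x0 y0 $ i $ j" if "i \<in> low c" "j \<in> low c" for i j
          using that q(2,3) unfolding xy(5) by (auto simp: wedge_nth axis_def)
        have "?X \<bullet> ?X = 1 + (P / a c)\<^sup>2" "?Y \<bullet> ?Y = (a c)\<^sup>2 + Q\<^sup>2" "?X \<bullet> ?Y = 0"
          using orth xy yy by (simp_all add: inner_add_left inner_add_right power2_eq_square)
        then have "(?X \<bullet> ?X) * (?Y \<bullet> ?Y) - (?X \<bullet> ?Y)\<^sup>2 = (a c)\<^sup>2 + (P\<^sup>2 + Q\<^sup>2) + (P * Q / a c)\<^sup>2"
          using a0 by (simp add: power2_eq_square field_simps)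
        then show "(?X \<bullet> ?X) * (?Y \<bullet> ?Y) - (?X \<bullet> ?Y)\<^sup>2 = (a (Suc c))\<^sup>2"
          unfolding PQ(2) bPQ[symmetric] by simp
        show "wedge ?X ?Y $ ?q $ ?r = b (Suc c)"
          using q(4) z by (simp add: wedge_nth axis_def bPQ)
      qed (intro sup xy)+
    next
      case True
      then have y0: "y = 0" using yy by simp
      let ?L = "sqrt ?K"
      have L: "?L\<^sup>2 = ?K" using PQ(2) by (simp add: real_sqrt_pow2_iff flip: PQ(2))
      \<comment> \<open>With a_c = 0 the old corner is 0. It stays 0 if the second vector is
        \<open>?f\<close>, and the norm then requires |X|^2 = ?K + b^2 with the component b along
        \<open>?e\<close>.\<close>
      let ?X = "?L *\<^sub>R x + b (Suc c) *\<^sub>R ?e + 0 *\<^sub>R ?f" and ?Y = "0 *\<^sub>R x + 0 *\<^sub>R ?e + 1 *\<^sub>R ?f"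
      show ?thesis
      proof (rule step[of ?X ?Y])
        show "wedge ?X ?Y $ i $ j = wedge x0 y0 $ i $ j" if "i \<in> low c" "j \<in> low c" for i j
          using that q(2,3) unfolding xy(5) y0 by (auto simp: wedge_nth axis_def)
        have "?X \<bullet> ?X = ?L\<^sup>2 + (b (Suc c))\<^sup>2" "?Y \<bullet> ?Y = 1" "?X \<bullet> ?Y = 0"
          using orth xy yy by (simp_all add: inner_add_left inner_add_right power2_eq_square)
        then show "(?X \<bullet> ?X) * (?Y \<bullet> ?Y) - (?X \<bullet> ?Y)\<^sup>2 = (a (Suc c))\<^sup>2"
          unfolding L using True by simp
        show "wedge ?X ?Y $ ?q $ ?r = b (Suc c)"
          using q(4) z by (simp add: wedge_nth axis_def)
      qed (intro sup xy)+
    qed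
  qed
qed

lemma exists_M_phi_with_params:
  fixes a b :: "nat \<Rightarrow> real"
  assumes d: "CARD('n::{finite,linorder}) \<ge> 3"
    and a0: "a 0 = 0" and ab: "\<And>c. c < CARD('n::{finite,linorder}) div 2 \<Longrightarrow> \<bar>b (Suc c)\<bar> \<le> a (Suc c) - a c"
    and ev: "even CARD('n) \<Longrightarrow> \<bar>b 1\<bar> = a 1" and aN: "a (CARD('n) div 2) = 1"
  obtains p :: "'n::{finite,linorder} rmat" where "p \<in> M_phi" "\<And>c. c \<le> CARD('n) div 2 \<Longrightarrow> aa c p = a c"
    "\<And>c. 1 \<le> c \<Longrightarrow> c \<le> CARD('n) div 2 \<Longrightarrow> bb c p = b c"
proof -
  let ?N = "CARD('n) div 2"
  obtain x y :: "'n rvec" where xy: "\<And>j. j \<le> ?N \<Longrightarrow> aa j (wedge x y) = a j"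
    "\<And>j. 1 \<le> j \<Longrightarrow> j \<le> ?N \<Longrightarrow> bb j (wedge x y) = b j"
    using exists_with_params[of a b ?N, OF a0 ab ev order_refl] by blast
  have "(aa ?N (wedge x y))\<^sup>2 = 1" using xy(1)[of ?N] aN by simp
  then have "wedge x y \<bullet> wedge x y = 2" unfolding aa_sq by (simp add: ip_def low_top inner_mat)
  then have "wedge x y \<in> M_phi" by (rule wedge_M_phi[OF d])
  then show thesis using that xy by blast
qed

lemma exists_generic:
  assumes d: "CARD('n::{finite,linorder}) \<ge> 3"
  obtains p :: "'n::{finite,linorder} rmat" where "p \<in> M_phi" "generic p"
proof -
  let ?N = "CARD('n) div 2"
  have N: "?N \<ge> 1" using d by simp
  \<comment> \<open>Equal increments of a and vanishing b make every relevant discriminant the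
    square of a positive growth of a^2. In even size b_1 is exempt, because its absolute value must
    be a_1.\<close>
  define a where "a c = real c / real ?N" for c
  define b where "b c = (if even CARD('n) \<and> c = 1 then 1 / real ?N else 0)" for c :: nat
  have inc: "a (Suc c) - a c = 1 / real ?N" for c by (simp add: a_def add_divide_distrib)
  obtain p :: "'n rmat" where p: "p \<in> M_phi" "\<And>c. c \<le> ?N \<Longrightarrow> aa c p = a c"
    "\<And>c. 1 \<le> c \<Longrightarrow> c \<le> ?N \<Longrightarrow> bb c p = b c"
  proof (rule exists_M_phi_with_params[OF d, of a b])
    show "a 0 = 0" "a ?N = 1" using N by (auto simp: a_def)
    show "\<bar>b (Suc c)\<bar> \<le> a (Suc c) - a c" for c unfolding inc by (simp add: b_def)
    show "even CARD('n) \<Longrightarrow> \<bar>b 1\<bar> = a 1" by (simp add: a_def b_def)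
  qed blast
  have so: "p \<in> so" using M_phi_iff[OF d] p(1) by auto
  have "disc c p \<noteq> 0" if c: "c < ?N" "odd CARD('n) \<or> 0 < c" for c
  proof -
    have c': "Suc c \<le> ?N" using c by simp
    have b0: "bb (Suc c) p = 0" using p(3)[of "Suc c"] c by (auto simp: b_def)
    have "cc c p p = (a (Suc c))\<^sup>2 - (a c)\<^sup>2" using aa_Suc_sq[OF c' so] p(2) c' b0 by simp
    moreover have "(a c)\<^sup>2 < (a (Suc c))\<^sup>2"
      using N by (intro power_strict_mono) (auto simp: a_def divide_strict_right_mono)
    ultimately show ?thesis using b0 by (simp add: disc_def)
  qed
  moreover have "bb 1 p \<noteq> 0" if "even CARD('n)" using p(3)[of 1] N that by (simp add: b_def)
  ultimately have "generic p" by (auto simp: generic_def)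
  then show thesis using that p(1) by blast
qed

subsection \<open>Generic points are dense\<close>

lemma real_polynomial_function_finite_zeros:
  fixes f :: "real \<Rightarrow> real"
  assumes "real_polynomial_function f" "f x0 \<noteq> 0"
  shows "finite {x. f x = 0}"
proof -
  obtain a n where f: "f = (\<lambda>x. \<Sum>i\<le>n. a i * x ^ i)" using assms(1) real_polynomial_function_iff_sum by metis
  then have "\<exists>k\<le>n. a k \<noteq> 0" using assms(2) by (metis (no_types, lifting) atMost_iff mult_zero_left sum.neutral)
  then show ?thesis unfolding f using polyfun_finite_roots[of a n] by simp
qed

lemma params_scaleR:
  "ip c (t *\<^sub>R p) (t *\<^sub>R p) = t\<^sup>2 * ip c p p" "cc c (t *\<^sub>R p) (t *\<^sub>R p) = t\<^sup>2 * cc c p p" "bb c (t *\<^sub>R p) = t * bb c p"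
  by (simp_all add: ip_def cc_def bb_def sum_distrib_left power2_eq_square algebra_simps)

lemma generic_scaleR:
  assumes t: "t \<noteq> 0" shows "generic (t *\<^sub>R p) \<longleftrightarrow> generic p"
proof -
  have "disc c (t *\<^sub>R p) = t ^ 4 * disc c p" for c
    by (simp add: disc_def params_scaleR power2_eq_square algebra_simps power4_eq_xxxx)
  then show ?thesis using t by (simp add: generic_def params_scaleR)
qed

lemma polynomial_curve:
  fixes w :: "real \<Rightarrow> 'n::{finite,linorder} rmat"
  assumes w: "\<And>i j. real_polynomial_function (\<lambda>s. w s $ i $ j)"
  shows "real_polynomial_function (\<lambda>s. disc c (w s))" "real_polynomial_function (\<lambda>s. bb c (w s))"
    "real_polynomial_function (\<lambda>s. w s \<bullet> w s)"
proof -
  show b: "real_polynomial_function (\<lambda>s. bb c (w s))" for c unfolding bb_def by (rule w)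
  have "real_polynomial_function (\<lambda>s. (cc c (w s) (w s))\<^sup>2)"
    unfolding cc_def power2_eq_square
    by (intro real_polynomial_function.intros(4) real_polynomial_function.intros(3) real_polynomial_function_sum w) simp_all
  moreover have "real_polynomial_function (\<lambda>s. ip c (w s) (w s))"
    unfolding ip_def by (intro real_polynomial_function.intros(4) real_polynomial_function_sum w) simp_all
  moreover have "disc c (w s) = (cc c (w s) (w s))\<^sup>2 + (- 2) * (bb (Suc c) (w s) * bb (Suc c) (w s)) * ip c (w s) (w s)" for s
    by (simp add: disc_def power2_eq_square)
  ultimately show "real_polynomial_function (\<lambda>s. disc c (w s))"
    by (simp only:) (intro real_polynomial_function.intros(3) real_polynomial_function.intros(4) real_polynomial_function.intros(2) b)
  show "real_polynomial_function (\<lambda>s. w s \<bullet> w s)"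
    unfolding inner_mat by (intro real_polynomial_function.intros(4) real_polynomial_function_sum w) simp_all
qed

lemma generic_dense:
  assumes d: "CARD('n::{finite,linorder}) \<ge> 3" and p: "(p :: 'n rmat) \<in> M_phi"
  obtains P where "\<And>m. P m \<in> M_phi" "\<And>m. generic (P m)" "P \<longlonglongrightarrow> p"
proof -
  have d2: "CARD('n) \<ge> 2" using d by simp
  obtain p1 :: "'n rmat" where p1: "p1 \<in> M_phi" "generic p1" by (rule exists_generic[OF d])
  obtain x y where xy: "p = wedge x y" using M_phi_frameD[OF d2 p] by metis
  obtain x1 y1 where xy1: "p1 = wedge x1 y1" using M_phi_frameD[OF d2 p1(1)] by metis
  define w where "w s = wedge (x + s *\<^sub>R (x1 - x)) (y + s *\<^sub>R (y1 - y))" for s :: real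
  have w0: "w 0 = p" and w1: "w 1 = p1" by (simp_all add: w_def xy xy1)
  have w_nth: "w s $ i $ j = (x $ i + s * (x1 $ i - x $ i)) * (y $ j + s * (y1 $ j - y $ j)) +
     (- 1) * ((x $ j + s * (x1 $ j - x $ j)) * (y $ i + s * (y1 $ i - y $ i)))" for s i j
    by (simp add: w_def wedge_nth)
  have pw: "real_polynomial_function (\<lambda>s. w s $ i $ j)" for i j
    unfolding w_nth
    by (intro real_polynomial_function.intros(3) real_polynomial_function.intros(4) real_polynomial_function.intros(2)
        real_polynomial_function.intros(1) bounded_linear_ident)
  note pc = polynomial_curve[of w, OF pw]
  have n1: "w 1 \<bullet> w 1 \<noteq> 0" using M_phi_facts(3)[OF d2 p1(1)] w1 by simp
  let ?N = "CARD('n) div 2"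
  \<comment> \<open>The parameters at which genericity fails or the curve passes through 0. Each
    condition is a polynomial in s that is nonzero at s = 1, where the curve is at the generic point
    \<open>p1\<close>.\<close>
  define Z where "Z = (\<Union>c\<in>{c. c < ?N \<and> (odd CARD('n) \<or> 0 < c)}. {s. disc c (w s) = 0}) \<union>
    (if even CARD('n) then {s. bb 1 (w s) = 0} else {}) \<union> {s. w s \<bullet> w s = 0}"
  have "finite Z" unfolding Z_def
  proof (intro finite_UnI finite_UN_I)
    show "finite {c. c < ?N \<and> (odd CARD('n) \<or> 0 < c)}" by simp
    show "finite {s. disc c (w s) = 0}" if "c \<in> {c. c < ?N \<and> (odd CARD('n) \<or> 0 < c)}" for c
      by (rule real_polynomial_function_finite_zeros[OF pc(1), of _ 1]) (use that p1 w1 in \<open>auto simp: generic_def\<close>)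
    show "finite (if even CARD('n) then {s. bb 1 (w s) = 0} else {})"
      using real_polynomial_function_finite_zeros[OF pc(2), of 1 1] p1 w1 by (auto simp: generic_def)
    show "finite {s. w s \<bullet> w s = 0}" by (rule real_polynomial_function_finite_zeros[OF pc(3) n1])
  qed
  then have ev: "eventually (\<lambda>s. s \<notin> Z) (at 0)"
    using islimpt_finite[of Z 0] by (simp add: islimpt_iff_eventually)
  have good: "generic (w s)" "w s \<bullet> w s \<noteq> 0" if "s \<notin> Z" for s
    using that by (auto simp: Z_def generic_def split: if_splits)
  define h where "h m = inverse (real (Suc m))" for m
  have h: "h \<longlonglongrightarrow> 0" unfolding h_def by (rule LIMSEQ_inverse_real_of_nat)
  have "filterlim h (at 0) sequentially"
    by (rule filterlim_atI[OF h]) (auto simp: h_def)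
  with ev have "eventually (\<lambda>m. h m \<notin> Z) sequentially"
    by (rule eventually_compose_filterlim)
  then obtain m0 where m0: "\<And>m. m \<ge> m0 \<Longrightarrow> h m \<notin> Z" by (auto simp: eventually_sequentially)
  \<comment> \<open>Scaling back to squared norm 2 returns the curve to the orbit; nonzero scaling
    preserves genericity.\<close>
  define t where "t s = sqrt (2 / (w s \<bullet> w s))" for s
  define P where "P m = t (h (m + m0)) *\<^sub>R w (h (m + m0))" for m
  show thesis
  proof (rule that[of P])
    fix m
    let ?s = "h (m + m0)"
    have g: "generic (w ?s)" "w ?s \<bullet> w ?s \<noteq> 0" using good m0[of "m + m0"] by auto
    then have pos: "w ?s \<bullet> w ?s > 0" by simp
    then have t0: "t ?s \<noteq> 0" "t ?s * t ?s * (w ?s \<bullet> w ?s) = 2" by (auto simp: t_def)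
    show "generic (P m)" unfolding P_def using g t0 by (simp add: generic_scaleR)
    have "P m = wedge (t ?s *\<^sub>R (x + ?s *\<^sub>R (x1 - x))) (y + ?s *\<^sub>R (y1 - y))"
      by (simp only: P_def w_def wedge_simps(3))
    moreover have "P m \<bullet> P m = 2" using t0(2) by (simp add: P_def mult.assoc)
    ultimately show "P m \<in> M_phi" using wedge_M_phi[OF d] by metis
  next
    have tw: "((\<lambda>m. w (h (m + m0))) \<longlonglongrightarrow> p)"
    proof -
      have "(\<lambda>m. h (m + m0)) \<longlonglongrightarrow> 0" using h by (rule LIMSEQ_ignore_initial_segment)
      then have "(\<lambda>m. w (h (m + m0)) $ i $ j) \<longlonglongrightarrow> w 0 $ i $ j" for i j
        unfolding w_nth by (intro tendsto_intros)
      then have "(\<lambda>m. w (h (m + m0))) \<longlonglongrightarrow> w 0" by (intro vec_tendstoI)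
      then show ?thesis by (simp add: w0)
    qed
    have "P \<longlonglongrightarrow> sqrt (2 / (p \<bullet> p)) *\<^sub>R p"
      unfolding P_def t_def
      by (intro tendsto_intros tw) (use M_phi_facts(3)[OF d2 p] in auto)
    then show "P \<longlonglongrightarrow> p" using M_phi_facts(3)[OF d2 p] by simp
  qed
qed

subsection \<open>Multiplicities at all points\<close>

lemma tendsto_lie:
  fixes X Y :: "'b \<Rightarrow> 'n::finite rmat"
  assumes "(X \<longlongrightarrow> A) F" "(Y \<longlongrightarrow> B) F" shows "((\<lambda>m. lie (X m) (Y m)) \<longlongrightarrow> lie A B) F"
proof (intro vec_tendstoI)
  show "((\<lambda>m. lie (X m) (Y m) $ i $ j) \<longlongrightarrow> lie A B $ i $ j) F" for i j
    unfolding lie_def vector_minus_component mat_mult_nth by (intro tendsto_intros assms)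
qed

lemma tendsto_linear:
  fixes f :: "'a::euclidean_space \<Rightarrow> 'b::real_normed_vector"
  shows "linear f \<Longrightarrow> (X \<longlongrightarrow> A) F \<Longrightarrow> ((\<lambda>m. f (X m)) \<longlongrightarrow> f A) F"
  using linear_conv_bounded_linear[of f] bounded_linear.tendsto by blast

lemma tendsto_N_op:
  assumes "(X \<longlongrightarrow> A) F" "(Y \<longlongrightarrow> B) F" shows "((\<lambda>m. N_op (X m) (Y m)) \<longlongrightarrow> N_op A B) F"
  unfolding N_op_def by (intro tendsto_add tendsto_lie tendsto_linear[OF linear_Jb] assms)

lemma tendsto_lprod_N_op:
  assumes X: "(X \<longlongrightarrow> A) F"
  shows "(\<And>i. i \<in> set is \<Longrightarrow> ((\<lambda>m. l m i) \<longlongrightarrow> (x i :: real)) F) \<Longrightarrow> (Y \<longlongrightarrow> B) F \<Longrightarrow>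
    ((\<lambda>m. lprod (N_op (X m)) (map (l m) is) (Y m)) \<longlongrightarrow> lprod (N_op A) (map x is) B) F"
proof (induction "is" arbitrary: Y B)
  case (Cons i "is")
  have "((\<lambda>m. N_op (X m) (Y m) - l m i *\<^sub>R Y m) \<longlongrightarrow> N_op A B - x i *\<^sub>R B) F"
    by (intro tendsto_diff tendsto_scaleR tendsto_N_op X Cons.prems) auto
  with Cons show ?case by simp
qed simp

lemma tendsto_ip: "(X \<longlongrightarrow> A) F \<Longrightarrow> ((\<lambda>m. ip c (X m) (X m)) \<longlongrightarrow> ip c A A) F"
  unfolding ip_def by (intro tendsto_intros)

lemma tendsto_plist:
  assumes X: "(X \<longlongrightarrow> (A :: 'n::{finite,linorder} rmat)) F" and i: "i < length (plist A)"
  shows "((\<lambda>m. plist (X m) ! i) \<longlongrightarrow> plist A ! i) F"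
proof -
  let ?N = "CARD('n) div 2"
  define Fs :: "('n rmat \<Rightarrow> real) list" where "Fs =
     map (\<lambda>k p. 1 + aa (?N - k) p - ss (?N - k) p) [1..<?N] @
     (if odd CARD('n) then [\<lambda>p. 1 - ss 0 p] else []) @
     map (\<lambda>k p. 1 - aa (?N - k) p - ss (?N - k) p) (rev [1..<?N])"
  have pl: "plist p = map (\<lambda>f. f p) Fs" for p by (simp add: plist_def Fs_def Let_def)
  have aa: "((\<lambda>m. aa c (X m)) \<longlongrightarrow> aa c A) F" for c
    unfolding aa_def by (intro tendsto_intros tendsto_ip X) simp
  have ss: "((\<lambda>m. ss c (X m)) \<longlongrightarrow> ss c A) F" for c
    by (rule tendsto_linear[OF linear_ss X])
  have "((\<lambda>m. f (X m)) \<longlongrightarrow> f A) F" if "f \<in> set Fs" for f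
    using that by (auto simp: Fs_def intro!: tendsto_intros aa ss split: if_splits)
  moreover have "i < length Fs" using i by (simp add: pl)
  ultimately show ?thesis unfolding pl by simp
qed

text \<open>Presents the varying tangent space as the kernel of a linear map that depends
  continuously on p, the form in which \<open>dim_kernel_limit\<close> applies. A solution v is
  tangent because v = [p, -[p, v]].\<close>

lemma tangent_kernel:
  assumes d: "CARD('n::{finite,linorder}) \<ge> 2" and M: "(p :: 'n rmat) \<in> M_phi"
  shows "v \<in> tangent p \<longleftrightarrow> v + transpose v = 0 \<and> v + lie p (lie p v) = 0"
proof
  assume "v \<in> tangent p"
  then have "v \<in> so" "lie p (lie p v) = - v" using M_phi_facts[OF d M] by auto
  then show "v + transpose v = 0 \<and> v + lie p (lie p v) = 0" by (simp add: so_def)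
next
  assume *: "v + transpose v = 0 \<and> v + lie p (lie p v) = 0"
  then have "v \<in> so" unfolding so_def by (simp add: add_eq_0_iff)
  then have "- lie p v \<in> so" using M_phi_facts(1)[OF d M] by (simp add: so_lie so_uminus)
  then have "lie p (- lie p v) \<in> tangent p" by (rule lie_in_tangent)
  moreover have "lie p (- lie p v) = v" using * add_eq_0_iff[of v "lie p (lie p v)"] by (simp add: lie_minus_right)
  ultimately show "v \<in> tangent p" by simp
qed

text \<open>At nearby generic points the entries that converge to x are distinct eigenvalues, each
  with an eigenspace of dimension at least 2. The kernel of the product of their factors is large,
  and in the limit the product becomes a power of N - x.\<close>

lemma dim_lker_plist:
  assumes d: "CARD('n::{finite,linorder}) \<ge> 3" and M: "(p :: 'n rmat) \<in> M_phi"
  shows "2 * count_list (plist p) x \<le> dim (lker (N_op p) (tangent p) (replicate (count_list (plist p) x) x))"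
proof -
  have d2: "CARD('n) \<ge> 2" using d by simp
  obtain P where P: "\<And>m. P m \<in> M_phi" "\<And>m. generic (P m)" "P \<longlonglongrightarrow> p" by (rule generic_dense[OF d M]) blast
  let ?n = "CARD('n) - 2"
  define js where "js = filter (\<lambda>i. plist p ! i = x) [0..<?n]"
  have len: "length (plist q) = ?n" for q :: "'n rmat" by (rule length_plist[OF d2])
  have count: "length js = count_list (plist p) x"
  proof -
    have "count_list (plist p) x = length (filter (\<lambda>y. y = x) (plist p))"
      unfolding count_list_eq_length_filter by (intro arg_cong[where f=length] filter_cong) auto
    moreover have "plist p = map (\<lambda>i. plist p ! i) [0..<?n]" by (simp add: map_nth flip: len[of p])
    ultimately have "count_list (plist p) x = length (filter (\<lambda>y. y = x) (map (\<lambda>i. plist p ! i) [0..<?n]))"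
      by simp
    then show ?thesis by (simp add: filter_map js_def o_def)
  qed
  have js: "i < ?n" if "i \<in> set js" for i using that by (simp add: js_def)
  have mapx: "map (\<lambda>i. x) js = replicate (count_list (plist p) x) x"
    unfolding count[symmetric] by (rule map_replicate_const)
  \<comment> \<open>Bundles the tangency equations with the product of factors, so that a kernel on
    the full matrix space replaces one on the moving tangent space.\<close>
  define T where "T q ls v = (v + transpose v, v + lie q (lie q v), lprod (N_op q) ls v)" for q :: "'n rmat" and ls v
  have ker: "lker (N_op q) (tangent q) ls = {v. T q ls v = 0}" if "q \<in> M_phi" for q :: "'n rmat" and ls
    unfolding lker_def T_def using tangent_kernel[OF d2 that] by (auto simp: zero_prod_def)
  have lin: "linear (T q ls)" for q ls
  proof -
    have "linear (transpose :: 'n rmat \<Rightarrow> 'n rmat)" by (rule linearI) (simp_all add: transpose_def vec_eq_iff)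
    then show ?thesis
      by (intro linearI) (simp_all add: T_def linear_add linear_cmul lie_add_right lie_scaleR_right
          linear_add[OF linear_lprod[OF linear_N_op]] linear_cmul[OF linear_lprod[OF linear_N_op]] algebra_simps)
  qed
  have "2 * count_list (plist p) x \<le> dim {v. T p (map (\<lambda>i. x) js) v = 0}"
  proof (rule dim_kernel_limit[OF lin lin])
    let ?ls = "\<lambda>m. map (\<lambda>i. plist (P m) ! i) js"
    show "2 * count_list (plist p) x \<le> dim {v. T (P m) (?ls m) v = 0}" for m
    proof -
      note q = M_phi_facts[OF d2 P(1)[of m]]
      have dist: "distinct (plist (P m))" by (rule distinct_plist[OF q(1,2) P(2)])
      have "distinct (?ls m)" unfolding distinct_map
        using dist js len[of "P m"] by (auto simp: js_def inj_on_def nth_eq_iff_index_eq)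
      moreover have "2 \<le> dim (lker (N_op (P m)) (tangent (P m)) [y])" if "y \<in> set (?ls m)" for y
      proof (rule generic_eigenspaces[OF d2 P(1,2)])
        show "y \<in> set (plist (P m))" using that js len[of "P m"] by auto
      qed
      ultimately have "2 * length (?ls m) \<le> dim (lker (N_op (P m)) (tangent (P m)) (?ls m))"
        by (rule dim_lker_distinct[OF linear_N_op subspace_tangent])
      then show ?thesis unfolding ker[OF P(1)] by (simp add: count)
    qed
    show "(\<lambda>m. T (P m) (?ls m) v) \<longlonglongrightarrow> T p (map (\<lambda>i. x) js) v" for v
      unfolding T_def
    proof (intro tendsto_Pair tendsto_add tendsto_const tendsto_lie P(3) tendsto_lprod_N_op)
      fix i assume "i \<in> set js"
      then have "i < length (plist p)" "plist p ! i = x" using len[of p] by (auto simp: js_def)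
      then show "(\<lambda>m. plist (P m) ! i) \<longlonglongrightarrow> x" using tendsto_plist[OF P(3)] by metis
    qed
  qed
  then show ?thesis unfolding ker[OF M] mapx .
qed

text \<open>The lower bounds of \<open>dim_lker_plist\<close> already add up to the dimension of the
  tangent space, while generalized eigenspaces for different values are independent; so every bound
  is an equality.\<close>

theorem N_eigenvalue_list_plist:
  assumes d: "CARD('n::{finite,linorder}) \<ge> 3" and M: "(p :: 'n rmat) \<in> M_phi"
  shows "N_eigenvalue_list p (plist p)"
proof -
  have d2: "CARD('n) \<ge> 2" using d by simp
  note p = M_phi_facts[OF d2 M]
  let ?T = "tangent p" and ?G = "\<lambda>x. {v \<in> tangent p. \<exists>k. ((\<lambda>u. N_op p u - x *\<^sub>R u) ^^ k) v = 0}"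
  have GE: "N_gen_eigenspace p x = ?G x" for x
  proof -
    have "((\<lambda>u. N_phi p u - x *\<^sub>R u) ^^ k) v = ((\<lambda>u. N_op p u - x *\<^sub>R u) ^^ k) v \<and>
       ((\<lambda>u. N_op p u - x *\<^sub>R u) ^^ k) v \<in> ?T" if "v \<in> ?T" for v k
    proof (induction k)
      case (Suc k)
      let ?w = "((\<lambda>u. N_op p u - x *\<^sub>R u) ^^ k) v"
      have "?w \<in> ?T" using Suc by simp
      then have "N_phi p ?w = N_op p ?w" "N_op p ?w - x *\<^sub>R ?w \<in> ?T"
        using N_phi_eq[OF d2 M] N_op_tangent[OF p(1)]
        by (auto intro!: subspace_diff[OF subspace_tangent] subspace_scale[OF subspace_tangent])
      then show ?case using Suc by simp
    qed (use that in simp)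
    then show ?thesis unfolding N_gen_eigenspace_def by auto
  qed
  have lower: "2 * count_list (plist p) x \<le> dim (?G x)" for x
  proof -
    let ?c = "count_list (plist p) x"
    have "lker (N_op p) ?T (replicate ?c x) \<subseteq> ?G x" by (auto simp: lker_def lprod_replicate)
    then have "dim (lker (N_op p) ?T (replicate ?c x)) \<le> dim (?G x)" by (rule dim_subset)
    then show ?thesis using dim_lker_plist[OF d M, of x] by linarith
  qed
  have len: "length (plist p) = CARD('n) - 2" by (rule length_plist[OF d2])
  have eq: "dim (?G x) = 2 * count_list (plist p) x" for x
  proof -
    have "\<exists>k. \<forall>y. ?G y = lker (N_op p) ?T (replicate (k y) y)"
    proof (rule choice, rule allI)
      fix y
      show "\<exists>k. ?G y = lker (N_op p) ?T (replicate k y)"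
        by (rule gen_eigenspace_lker[OF linear_N_op subspace_tangent, of 0 p p y]) blast
    qed
    then obtain k where k: "\<And>y. ?G y = lker (N_op p) ?T (replicate (k y) y)" by blast
    \<comment> \<open>Adjoining x includes values outside the list, for which the count shows that
      the generalized eigenspace is trivial.\<close>
    define xs where "xs = remdups (x # plist p)"
    have xs: "distinct xs" "set xs = insert x (set (plist p))" by (auto simp: xs_def)
    have "(\<Sum>y\<in>set xs. dim (?G y)) = (\<Sum>y\<leftarrow>xs. dim (lker (N_op p) ?T (replicate (k y) y)))"
      unfolding k by (rule sum_list_distinct_conv_sum_set[OF xs(1), symmetric])
    also have "\<dots> \<le> dim ?T" by (rule sum_dim_lker_replicate[OF linear_N_op subspace_tangent xs(1)])
    also have "\<dots> = 2 * length (plist p)" by (simp add: p(4) len)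
    also have "\<dots> = (\<Sum>y\<in>set xs. 2 * count_list (plist p) y)"
      unfolding sum_distrib_left[symmetric] using sum_count_set[of "plist p" "set xs"] xs(2) by (simp add: subset_insertI)
    finally have "(\<Sum>y\<in>set xs. dim (?G y)) \<le> (\<Sum>y\<in>set xs. 2 * count_list (plist p) y)" .
    moreover have "(\<Sum>y\<in>set xs. 2 * count_list (plist p) y) \<le> (\<Sum>y\<in>set xs. dim (?G y))"
      by (rule sum_mono) (rule lower)
    ultimately have "(\<Sum>y\<in>set xs. 2 * count_list (plist p) y) = (\<Sum>y\<in>set xs. dim (?G y))" by (rule antisym[rotated])
    from sum_mono_inv[OF this, of x] lower xs(2) show ?thesis by simp
  qed
  show ?thesis unfolding N_eigenvalue_list_def GE
    using eq len p(4) sorted_plist[OF p(1,2)] by simp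
qed

lemma N_eigenvalues_plist:
  assumes d: "CARD('n::{finite,linorder}) \<ge> 3" and M: "(p :: 'n rmat) \<in> M_phi"
  shows "N_eigenvalues p = set (plist p)"
proof -
  have d2: "CARD('n) \<ge> 2" using d by simp
  note p = M_phi_facts[OF d2 M]
  let ?T = "tangent p"
  have dimG: "dim (N_gen_eigenspace p x) = 2 * count_list (plist p) x" for x
    using N_eigenvalue_list_plist[OF d M] by (simp add: N_eigenvalue_list_def)
  have "x \<in> N_eigenvalues p \<longleftrightarrow> x \<in> set (plist p)" for x
  proof
    assume "x \<in> N_eigenvalues p"
    then obtain v where v: "v \<in> ?T" "v \<noteq> 0" "N_phi p v = x *\<^sub>R v" by (auto simp: N_eigenvalues_def)
    then have "v \<in> N_gen_eigenspace p x" unfolding N_gen_eigenspace_def by (auto intro!: exI[of _ 1])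
    then have "dim (N_gen_eigenspace p x) \<noteq> 0" using v(2) by (auto simp: dim_eq_0)
    then show "x \<in> set (plist p)" by (metis dimG count_list_0_iff mult_0_right)
  next
    assume "x \<in> set (plist p)"
    then have c: "count_list (plist p) x \<noteq> 0" by (simp add: count_list_0_iff)
    show "x \<in> N_eigenvalues p"
    proof (rule ccontr)
      assume no: "x \<notin> N_eigenvalues p"
      have "lprod (N_op p) (replicate k x) v = 0 \<Longrightarrow> v \<in> ?T \<Longrightarrow> v = 0" for k v
      proof (induction k arbitrary: v)
        case (Suc k)
        have "N_op p v - x *\<^sub>R v \<in> ?T" using Suc.prems(2) N_op_tangent[OF p(1)]
          by (auto intro!: subspace_diff[OF subspace_tangent] subspace_scale[OF subspace_tangent])
        moreover have "lprod (N_op p) (replicate k x) (N_op p v - x *\<^sub>R v) = 0" using Suc.prems(1) by simp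
        ultimately have "N_op p v - x *\<^sub>R v = 0" by (rule Suc.IH[rotated])
        then have "N_op p v = x *\<^sub>R v" by simp
        then have "N_phi p v = x *\<^sub>R v" using N_phi_eq[OF d2 M Suc.prems(2)] by simp
        then show ?case using no Suc.prems(2) unfolding N_eigenvalues_def by blast
      qed simp
      then have "lker (N_op p) ?T (replicate k x) \<subseteq> {0}" for k by (auto simp: lker_def)
      then have "dim (lker (N_op p) ?T (replicate (count_list (plist p) x) x)) = 0" by (simp add: dim_eq_0)
      then show False using dim_lker_plist[OF d M, of x] c by linarith
    qed
  qed
  then show ?thesis by blast
qed

lemma dense_open_generic:
  assumes d: "CARD('n::{finite,linorder}) \<ge> 3"
  shows "dense_open_in (M_phi :: 'n rmat set) {p \<in> M_phi. generic p}"
  unfolding dense_open_in_def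
proof
  have cont: "continuous_on UNIV (\<lambda>p :: 'n rmat. disc c p)" "continuous_on UNIV (\<lambda>p :: 'n rmat. bb c p)" for c
    unfolding disc_def cc_def bb_def ip_def by (auto intro!: continuous_intros)
  have "{p :: 'n rmat. generic p} =
    (\<Inter>c\<in>{c. c < CARD('n) div 2 \<and> (odd CARD('n) \<or> 0 < c)}. {p. disc c p \<noteq> 0}) \<inter>
    (if even CARD('n) then {p. bb 1 p \<noteq> 0} else UNIV)"
    by (auto simp: generic_def)
  moreover have "open {p :: 'n rmat. disc c p \<noteq> 0}" "open {p :: 'n rmat. bb 1 p \<noteq> 0}" for c
    by (intro open_Collect_neq cont continuous_on_const)+
  ultimately have "open {p :: 'n rmat. generic p}" by (auto intro!: open_Int open_INT)
  moreover have "{p \<in> M_phi. generic p} = M_phi \<inter> {p :: 'n rmat. generic p}" by auto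
  ultimately show "openin (top_of_set M_phi) {p :: 'n rmat \<in> M_phi. generic p}"
    by (simp add: openin_open_Int)
  show "(M_phi :: 'n rmat set) \<subseteq> closure {p \<in> M_phi. generic p}"
  proof
    fix p :: "'n rmat" assume "p \<in> M_phi"
    then obtain P where "\<And>m. P m \<in> M_phi" "\<And>m. generic (P m)" "P \<longlonglongrightarrow> p" by (rule generic_dense[OF d]) blast
    then show "p \<in> closure {p \<in> M_phi. generic p}" unfolding closure_sequential by blast
  qed
qed

lemma N_maximal_rank:
  assumes d: "CARD('n::{finite,linorder}) \<ge> 3"
  shows "N_maximal_rank TYPE('n)"
  unfolding N_maximal_rank_def
proof (intro exI[of _ "{p :: 'n rmat \<in> M_phi. generic p}"] conjI ballI)
  show "dense_open_in (M_phi :: 'n rmat set) {p \<in> M_phi. generic p}" by (rule dense_open_generic[OF d])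
  fix p :: "'n rmat" assume p: "p \<in> {p \<in> M_phi. generic p}"
  have d2: "CARD('n) \<ge> 2" using d by simp
  have "p \<in> so" "pluecker p" "dim (tangent p) = 2 * (CARD('n) - 2)" using M_phi_facts[OF d2] p by auto
  then have "distinct (plist p)" using distinct_plist p by auto
  then show "card (N_eigenvalues p) = dim (tangent p) div 2"
    using N_eigenvalues_plist[OF d] p \<open>dim _ = _\<close> length_plist[OF d2, of p] by (simp add: distinct_card)
qed

subsection \<open>Poisson commutativity\<close>

definition subalgebra :: "'n::finite rmat set \<Rightarrow> bool" where
  "subalgebra k \<longleftrightarrow> subspace k \<and> k \<subseteq> so \<and> (\<forall>X\<in>k. \<forall>Y\<in>k. lie X Y \<in> k)"

lemma orthogonal_projection_unique:
  fixes y y' :: "'a::real_inner"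
  assumes "subspace k" "y \<in> k" "y' \<in> k" "\<And>z. z \<in> k \<Longrightarrow> y \<bullet> z = y' \<bullet> z"
  shows "y = y'"
proof -
  have "y - y' \<in> k" using assms by (simp add: subspace_diff)
  then have "(y - y') \<bullet> (y - y') = 0" using assms(4) by (simp add: inner_diff_left)
  then show ?thesis by simp
qed

text \<open>The trace form on k is minus the inner product, so the definite description is the
  orthogonal projection onto k.\<close>

lemma
  fixes k :: "'n::finite rmat set"
  assumes k: "subspace k" "k \<subseteq> so"
  shows trace_proj_in: "trace_proj k x \<in> k"
    and trace_proj_inner: "z \<in> k \<Longrightarrow> trace_proj k x \<bullet> z = x \<bullet> z"
proof -
  have tr: "trace (A ** z) = - (A \<bullet> z)" if "z \<in> k" for A z using that k by (intro trace_so) auto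
  obtain y w where yw: "y \<in> span k" "\<And>z. z \<in> span k \<Longrightarrow> orthogonal w z" "x = y + w"
    by (rule orthogonal_subspace_decomp_exists[of k x]) blast
  have y: "y \<in> k" "\<forall>z\<in>k. trace (y ** z) = trace (x ** z)"
    using yw k by (auto simp: span_eq_iff[THEN iffD2] tr inner_add_left orthogonal_def)
  have "trace_proj k x = y" unfolding trace_proj_def
  proof (rule the_equality)
    show "y \<in> k \<and> (\<forall>z\<in>k. trace (y ** z) = trace (x ** z))" using y by simp
    fix y' assume y': "y' \<in> k \<and> (\<forall>z\<in>k. trace (y' ** z) = trace (x ** z))"
    show "y' = y"
    proof (rule orthogonal_projection_unique[OF k(1)])
      fix z assume z: "z \<in> k"
      then have "trace (y' ** z) = trace (y ** z)" using y y' by simp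
      then show "y' \<bullet> z = y \<bullet> z" using z by (simp add: tr)
    qed (use y y' in auto)
  qed
  then show "trace_proj k x \<in> k" "z \<in> k \<Longrightarrow> trace_proj k x \<bullet> z = x \<bullet> z"
    using y tr by auto
qed

lemma linear_trace_proj:
  fixes k :: "'n::finite rmat set"
  assumes k: "subspace k" "k \<subseteq> so"
  shows "linear (trace_proj k)"
proof (rule linearI)
  note t = trace_proj_in[OF k] trace_proj_inner[OF k]
  show "trace_proj k (x + y) = trace_proj k x + trace_proj k y" for x y
    by (rule orthogonal_projection_unique[OF k(1)]) (simp_all add: t subspace_add[OF k(1)] inner_add_left)
  show "trace_proj k (c *\<^sub>R x) = c *\<^sub>R trace_proj k x" for c x
    by (rule orthogonal_projection_unique[OF k(1)]) (simp_all add: t subspace_scale[OF k(1)])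
qed

text \<open>The gradients at \<open>p\<close> of the generators of the algebra of collective functions.\<close>

definition grads :: "'n::finite rmat set set \<Rightarrow> 'n rmat \<Rightarrow> 'n rmat set" where
  "grads K p = {X. \<exists>k\<in>K. X \<in> k \<and> lie (trace_proj k p) X = 0}"

text \<open>The gradient of a generator is the projection to k of the gradient of h, and coadjoint
  invariance says that it commutes with the projected point. Sums and products only form linear
  combinations of such gradients, the product rule having function values as coefficients.\<close>

lemma collective_gradient:
  fixes K :: "'n::finite rmat set set"
  assumes K: "\<And>k. k \<in> K \<Longrightarrow> subalgebra k" and f: "f \<in> collective K"
  shows "\<exists>X\<in>span (grads K p). (f has_derivative (\<lambda>v. v \<bullet> X)) (at p)"
  using f
proof induction
  case (gen k h)
  have k: "subspace k" "k \<subseteq> so" and kl: "\<And>X Y. X \<in> k \<Longrightarrow> Y \<in> k \<Longrightarrow> lie X Y \<in> k"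
    using K[OF gen(1)] by (auto simp: subalgebra_def)
  let ?y = "trace_proj k p"
  have "h differentiable (at ?y)" using gen(2) unfolding smooth_def by blast
  then have D: "(h has_derivative frechet_derivative h (at ?y)) (at ?y)" by (simp add: frechet_derivative_works)
  obtain G where G: "\<And>v. frechet_derivative h (at ?y) v = v \<bullet> G"
    using gradient_exists[OF has_derivative_linear[OF D]] by metis
  let ?X = "trace_proj k G"
  have lin: "bounded_linear (trace_proj k)" using linear_trace_proj[OF k] by (simp add: linear_conv_bounded_linear)
  have yk: "?y \<in> k" and Xk: "?X \<in> k" by (rule trace_proj_in[OF k])+
  have "((\<lambda>x. h (trace_proj k x)) has_derivative (\<lambda>v. frechet_derivative h (at ?y) (trace_proj k v))) (at p)"
    by (rule has_derivative_compose[OF bounded_linear_imp_has_derivative[OF lin] D])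
  also have "(\<lambda>v. frechet_derivative h (at ?y) (trace_proj k v)) = (\<lambda>v. v \<bullet> ?X)"
  proof
    fix v
    have "frechet_derivative h (at ?y) (trace_proj k v) = ?X \<bullet> trace_proj k v"
      unfolding G using trace_proj_inner[OF k, of "trace_proj k v" G] trace_proj_in[OF k]
      by (simp add: inner_commute)
    also have "\<dots> = v \<bullet> ?X" using trace_proj_inner[OF k Xk, of v] by (simp add: inner_commute)
    finally show "frechet_derivative h (at ?y) (trace_proj k v) = v \<bullet> ?X" .
  qed
  finally have der: "((\<lambda>x. h (trace_proj k x)) has_derivative (\<lambda>v. v \<bullet> ?X)) (at p)" .
  have "lie ?y ?X = 0"
  proof (rule orthogonal_projection_unique[OF k(1) kl[OF yk Xk] subspace_0[OF k(1)]])
    fix z assume z: "z \<in> k"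
    have "lie z ?y \<bullet> G = 0" using gen(3) yk z G unfolding coadjoint_invariant_def by metis
    then have "?X \<bullet> lie z ?y = 0"
      using trace_proj_inner[OF k kl[OF z yk], of G] by (simp add: inner_commute)
    moreover have "lie ?y ?X \<bullet> z = - (?X \<bullet> lie ?y z)" using yk k by (intro inner_lie) auto
    ultimately show "lie ?y ?X \<bullet> z = 0 \<bullet> z" by (simp add: lie_anti[of ?y z])
  qed
  then have "?X \<in> grads K p" using gen(1) Xk by (auto simp: grads_def)
  then show ?case using der span_base by blast
next
  case (const c)
  have "((\<lambda>x. c) has_derivative (\<lambda>v. v \<bullet> 0)) (at p)" by simp
  then show ?case using span_zero by blast
next
  case (add f h)
  then obtain X Y where XY: "X \<in> span (grads K p)" "Y \<in> span (grads K p)"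
    "(f has_derivative (\<lambda>v. v \<bullet> X)) (at p)" "(h has_derivative (\<lambda>v. v \<bullet> Y)) (at p)" by auto
  have "((\<lambda>x. f x + h x) has_derivative (\<lambda>v. v \<bullet> (X + Y))) (at p)"
    using has_derivative_add[OF XY(3,4)] by (simp add: inner_add_right)
  then show ?case using span_add[OF XY(1,2)] by blast
next
  case (mult f h)
  then obtain X Y where XY: "X \<in> span (grads K p)" "Y \<in> span (grads K p)"
    "(f has_derivative (\<lambda>v. v \<bullet> X)) (at p)" "(h has_derivative (\<lambda>v. v \<bullet> Y)) (at p)" by auto
  have "((\<lambda>x. f x * h x) has_derivative (\<lambda>v. v \<bullet> (h p *\<^sub>R X + f p *\<^sub>R Y))) (at p)"
    using has_derivative_mult[OF XY(3,4)] by (simp add: inner_add_right algebra_simps)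
  then show ?case using span_add[OF span_scale[OF XY(1)] span_scale[OF XY(2)]] by blast
qed

text \<open>Thimm's argument: of two nested subalgebras the larger contains both gradients, so p may
  be projected to it, and the gradient belonging to it commutes with that projection.\<close>

lemma grads_commute:
  fixes K :: "'n::finite rmat set set"
  assumes K: "\<And>k. k \<in> K \<Longrightarrow> subalgebra k" and ch: "\<And>k k'. k \<in> K \<Longrightarrow> k' \<in> K \<Longrightarrow> k \<subseteq> k' \<or> k' \<subseteq> k"
    and X: "X \<in> grads K p" and Y: "Y \<in> grads K p"
  shows "p \<bullet> lie X Y = 0"
proof -
  have *: "p \<bullet> lie X Y = 0" if kk: "k \<in> K" "X \<in> k" "Y \<in> k" "lie (trace_proj k p) X = 0" for k X Y
  proof -
    have k: "subspace k" "k \<subseteq> so" "lie X Y \<in> k" using K[OF kk(1)] kk by (auto simp: subalgebra_def)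
    have "p \<bullet> lie X Y = trace_proj k p \<bullet> lie X Y" using trace_proj_inner[OF k(1,2,3)] by simp
    also have "\<dots> = - (lie X (trace_proj k p) \<bullet> Y)" using inner_lie[of X "trace_proj k p" Y] k kk by auto
    also have "\<dots> = lie (trace_proj k p) X \<bullet> Y" by (subst lie_anti) simp
    finally show ?thesis using kk by simp
  qed
  obtain k k' where k: "k \<in> K" "X \<in> k" "lie (trace_proj k p) X = 0" "k' \<in> K" "Y \<in> k'" "lie (trace_proj k' p) Y = 0"
    using X Y by (auto simp: grads_def)
  from ch[OF k(1,4)] show ?thesis
  proof
    assume "k \<subseteq> k'"
    then have "p \<bullet> lie Y X = 0" using *[of k' Y X] k by auto
    then show ?thesis by (simp add: lie_anti[of X Y])
  next
    assume "k' \<subseteq> k"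
    then show ?thesis using *[of k X Y] k by auto
  qed
qed

lemma collective_commute:
  fixes K :: "'n::finite rmat set set"
  assumes K: "\<And>k. k \<in> K \<Longrightarrow> subalgebra k" and ch: "\<And>k k'. k \<in> K \<Longrightarrow> k' \<in> K \<Longrightarrow> k \<subseteq> k' \<or> k' \<subseteq> k"
    and f: "f \<in> collective K" and h: "h \<in> collective K" and p: "p \<in> so"
  shows "kks p (frechet_derivative f (at p)) (frechet_derivative h (at p)) = 0"
proof -
  obtain X Y where XY: "X \<in> span (grads K p)" "Y \<in> span (grads K p)"
    "(f has_derivative (\<lambda>v. v \<bullet> X)) (at p)" "(h has_derivative (\<lambda>v. v \<bullet> Y)) (at p)"
    using collective_gradient[OF K f] collective_gradient[OF K h] by metis
  have D: "frechet_derivative f (at p) = (\<lambda>v. v \<bullet> X)" "frechet_derivative h (at p) = (\<lambda>v. v \<bullet> Y)"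
    using frechet_derivative_at XY(3,4) by metis+
  have "grads K p \<subseteq> so" using K by (auto simp: grads_def subalgebra_def)
  then have so: "X \<in> so" "Y \<in> so" using XY(1,2) span_minimal[OF _ subspace_so] by blast+
  have "p \<bullet> lie X Y = 0"
  proof -
    have 1: "p \<bullet> lie X' Y = 0" if "X' \<in> grads K p" for X'
    proof -
      have "span (grads K p) \<subseteq> {Y. p \<bullet> lie X' Y = 0}"
      proof (rule span_minimal)
        show "grads K p \<subseteq> {Y. p \<bullet> lie X' Y = 0}" using grads_commute[OF K ch that] by auto
        show "subspace {Y. p \<bullet> lie X' Y = 0}" using linear_0[OF linear_lie, of X']
          by (intro subspaceI) (auto simp: lie_add_right lie_scaleR_right inner_add_right)
      qed
      then show ?thesis using XY(2) by auto
    qed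
    have "span (grads K p) \<subseteq> {X. p \<bullet> lie X Y = 0}"
    proof (rule span_minimal)
      show "grads K p \<subseteq> {X. p \<bullet> lie X Y = 0}" using 1 by auto
      have "lie 0 Y = 0" using lie_scaleR_left[of 0 0 Y] by simp
      then show "subspace {X. p \<bullet> lie X Y = 0}"
        by (intro subspaceI) (auto simp: lie_add_left lie_scaleR_left inner_add_right)
    qed
    then show ?thesis using XY(1) by auto
  qed
  moreover have "kks p (\<lambda>v. v \<bullet> X) (\<lambda>v. v \<bullet> Y) = lie p (- X) \<bullet> Y"
  proof (rule kks_eq[OF p so_uminus[OF so(1)]])
    show "linear (\<lambda>v. v \<bullet> Y)" by (rule linearI) (simp_all add: inner_add_left)
    show "v \<bullet> X = trace (v ** - X)" for v using so_uminus[OF so(1)] by (simp add: trace_so)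
  qed
  moreover have "lie p (- X) \<bullet> Y = lie X p \<bullet> Y" by (simp add: lie_minus_right lie_anti[of p X])
  moreover have "lie X p \<bullet> Y = - (p \<bullet> lie X Y)" by (rule inner_lie[OF so(1)])
  ultimately show ?thesis unfolding D by simp
qed

subsection \<open>The chain of subalgebras\<close>

text \<open>The chain member of index k = N - c, expressed by block numbers; in this indexing
  inclusion increases with c.\<close>

definition gs :: "nat \<Rightarrow> 'n::{finite,linorder} rmat set" where
  "gs c = {X \<in> so. \<forall>i j. X $ i $ j \<noteq> 0 \<longrightarrow> (blk i \<le> c \<and> blk j \<le> c) \<or> (blk i = Suc c \<and> blk j = Suc c)}"

lemma pos_block_iff:
  assumes c: "c < CARD('n::{finite,linorder}) div 2"
  shows "pos (i::'n) \<in> {CARD('n) - 2 * (CARD('n) div 2 - c), CARD('n) - 2 * (CARD('n) div 2 - c) + 1} \<longleftrightarrow> blk i = Suc c"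
proof -
  let ?m = "CARD('n) - 2 * (CARD('n) div 2 - c)"
  have m: "CARD('n) - 2 * (CARD('n) div 2 - Suc c) = ?m + 2" using c by simp
  have "blk i = Suc c \<longleftrightarrow> blk i \<le> Suc c \<and> \<not> blk i \<le> c" by auto
  also have "\<dots> \<longleftrightarrow> pos i < ?m + 2 \<and> \<not> pos i < ?m"
    using pos_less_blk[of c i] pos_less_blk[of "Suc c" i] c m by simp
  finally show ?thesis by auto
qed

lemma g_sub_gs:
  assumes c: "c < CARD('n::{finite,linorder}) div 2"
  shows "g_sub (CARD('n) div 2 - c) = (gs c :: 'n rmat set)"
  unfolding g_sub_def gs_def Let_def pos_block_iff[OF c]
  using pos_less_blk[of c, where 'n='n] c by simp

text \<open>In even size c = 0 is absent, as the chain ends with two copies of \<open>so(2)\<close>,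
  the innermost two blocks.\<close>

lemma so_chain_gs: "(so_chain :: 'n::{finite,linorder} rmat set set) = gs ` {c. c < CARD('n) div 2 \<and> (odd CARD('n) \<or> 0 < c)}"
proof -
  let ?N = "CARD('n) div 2"
  let ?C = "{c. c < ?N \<and> (odd CARD('n) \<or> 0 < c)}"
  have "{1..(if even CARD('n) then ?N - 1 else ?N)} = (\<lambda>c. ?N - c) ` ?C" (is "?L = ?R")
  proof
    show "?R \<subseteq> ?L" by (auto split: if_splits)
    show "?L \<subseteq> ?R"
    proof
      fix k assume "k \<in> ?L"
      then have "?N - k \<in> ?C" "k = ?N - (?N - k)" by (auto split: if_splits)
      then show "k \<in> ?R" by blast
    qed
  qed
  then have "(so_chain :: 'n rmat set set) = (\<lambda>c. g_sub (?N - c)) ` ?C"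
    unfolding so_chain_def by (simp add: image_image)
  also have "\<dots> = gs ` ?C" by (intro image_cong refl g_sub_gs) auto
  finally show ?thesis .
qed

lemma subalgebra_gs: "subalgebra (gs c :: 'n::{finite,linorder} rmat set)"
  unfolding subalgebra_def
proof (intro conjI ballI)
  show "subspace (gs c :: 'n rmat set)"
  proof (rule subspaceI)
    show "x + y \<in> gs c" if "x \<in> gs c" "y \<in> gs c" for x y :: "'n rmat"
      using that unfolding gs_def by (auto simp: so_add) (metis add.right_neutral)+
    show "r *\<^sub>R x \<in> gs c" if "x \<in> gs c" for r and x :: "'n rmat"
      using that unfolding gs_def by (auto simp: subspace_scale[OF subspace_so])
  qed (simp add: gs_def subspace_0[OF subspace_so])
  show "(gs c :: 'n rmat set) \<subseteq> so" by (auto simp: gs_def)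
  fix X Y :: "'n rmat" assume X: "X \<in> gs c" and Y: "Y \<in> gs c"
  let ?R = "\<lambda>i j :: 'n. (blk i \<le> c \<and> blk j \<le> c) \<or> (blk i = Suc c \<and> blk j = Suc c)"
  have prod: "?R i j" if "(A ** B) $ i $ j \<noteq> 0" and AB: "A \<in> gs c" "B \<in> gs c" for A B :: "'n rmat" and i j
  proof -
    from that(1) obtain l where "A $ i $ l * B $ l $ j \<noteq> 0"
      unfolding mat_mult_nth by (metis (mono_tags, lifting) sum.neutral)
    then have "?R i l" "?R l j" using AB by (auto simp: gs_def)
    then show ?thesis by auto
  qed
  have "?R i j" if "lie X Y $ i $ j \<noteq> 0" for i j
  proof -
    have "(X ** Y) $ i $ j \<noteq> 0 \<or> (Y ** X) $ i $ j \<noteq> 0" using that by (auto simp: lie_def)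
    then show ?thesis using prod X Y by blast
  qed
  moreover have "lie X Y \<in> so" using X Y by (auto simp: gs_def so_lie)
  ultimately show "lie X Y \<in> gs c" unfolding gs_def by blast
qed

lemma gs_mono: "c \<le> c' \<Longrightarrow> gs c \<subseteq> gs c'"
proof -
  assume "c \<le> c'"
  have "(blk i \<le> c' \<and> blk j \<le> c') \<or> (blk i = Suc c' \<and> blk j = Suc c')"
    if "(blk i \<le> c \<and> blk j \<le> c) \<or> (blk i = Suc c \<and> blk j = Suc c)" for i j :: "'n::{finite,linorder}"
    using that \<open>c \<le> c'\<close> by auto
  then show ?thesis unfolding gs_def by blast
qed

lemma trace_proj_gs:
  fixes x :: "'n::{finite,linorder} rmat"
  assumes x: "x \<in> so"
  shows "trace_proj (gs c) x $ i $ j =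
    (if (blk i \<le> c \<and> blk j \<le> c) \<or> (blk i = Suc c \<and> blk j = Suc c) then x $ i $ j else 0)"
proof -
  have g: "subspace (gs c)" "gs c \<subseteq> (so :: 'n rmat set)" using subalgebra_gs by (auto simp: subalgebra_def)
  define y where "y = (\<chi> i j. if (blk i \<le> c \<and> blk j \<le> c) \<or> (blk i = Suc c \<and> blk j = Suc c) then x $ i $ j else 0)"
  have "y \<in> so" unfolding so_iff
  proof (intro allI)
    fix i j
    have "x $ i $ j = - x $ j $ i" by (rule so_nth[OF x])
    then show "y $ i $ j = - y $ j $ i" unfolding y_def by simp
  qed
  then have "y \<in> gs c" by (auto simp: gs_def y_def)
  have "trace_proj (gs c) x = y"
  proof (rule orthogonal_projection_unique[OF g(1) trace_proj_in[OF g] \<open>y \<in> gs c\<close>])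
    fix z :: "'n rmat" assume z: "z \<in> gs c"
    have "x \<bullet> z = y \<bullet> z"
      unfolding inner_mat using z by (intro sum.cong refl) (auto simp: y_def gs_def)
    then show "trace_proj (gs c) x \<bullet> z = y \<bullet> z" using trace_proj_inner[OF g z] by simp
  qed
  then show ?thesis by (simp add: y_def)
qed

section \<open>Explicit hamiltonians from the chain\<close>

definition cut :: "nat \<Rightarrow> 'n::{finite,linorder} rmat \<Rightarrow> 'n rmat" where
  "cut c v = (\<chi> i j. if i \<in> low c \<and> j \<in> low c then v $ i $ j else 0)"

lemma ip_cut: "ip c x v = x \<bullet> cut c v"
proof -
  have "x \<bullet> cut c v = (\<Sum>i\<in>low c. \<Sum>j\<in>UNIV. x $ i $ j * cut c v $ i $ j)"
    unfolding inner_mat by (intro sum.mono_neutral_right) (auto simp: cut_def)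
  also have "\<dots> = ip c x v"
    unfolding ip_def by (intro sum.cong refl sum.mono_neutral_cong_right) (auto simp: cut_def)
  finally show ?thesis by simp
qed

lemma ip_commute: "ip c x y = ip c y x"
  by (simp add: ip_def mult.commute)

lemma cut_cut: "cut c (cut c v) = cut c v"
  by (simp add: cut_def vec_eq_iff)

lemma ip_cut_cut: "ip c x v = cut c x \<bullet> cut c v"
  by (metis cut_cut inner_commute ip_commute ip_cut)

lemma cut_so: "v \<in> so \<Longrightarrow> cut c v \<in> so"
proof -
  assume v: "v \<in> so"
  show ?thesis unfolding so_iff
  proof (intro allI)
    fix i j
    have "v $ i $ j = - v $ j $ i" by (rule so_nth[OF v])
    then show "cut c v $ i $ j = - cut c v $ j $ i" unfolding cut_def by simp
  qed
qed

lemma has_derivative_ip: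
  fixes x :: "'n::{finite,linorder} rmat"
  shows "((\<lambda>x. ip c x x) has_derivative (\<lambda>v. 2 * ip c x v)) (at x)"
proof -
  have "linear (cut c :: 'n rmat \<Rightarrow> _)" by (rule linearI) (auto simp: cut_def vec_eq_iff)
  then have "bounded_linear (cut c :: 'n rmat \<Rightarrow> _)" by (simp add: linear_conv_bounded_linear)
  from has_derivative_inner[OF has_derivative_ident bounded_linear_imp_has_derivative[OF this]]
  have "((\<lambda>x. ip c x x) has_derivative (\<lambda>v. ip c x v + ip c v x)) (at x)" unfolding ip_cut .
  moreover have "(\<lambda>v. ip c x v + ip c v x) = (\<lambda>v. 2 * ip c x v)"
    using ip_commute[of c x] by (simp add: fun_eq_iff)
  ultimately show ?thesis by simp
qed

text \<open>A class closed under directional derivatives, as \<open>smooth\<close> demands: the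
  derivative of such a function in a fixed direction is affine. It contains the quadratic invariant
  \<open>ip\<close> and the linear invariant \<open>bb\<close>.\<close>

definition quads :: "('n::{finite,linorder} rmat \<Rightarrow> real) set" where
  "quads = {f. \<exists>c a A b. f = (\<lambda>x. a * ip c x x + x \<bullet> A + b)}"

lemma quads_derivative:
  "((\<lambda>x. a * ip c x x + x \<bullet> A + b) has_derivative (\<lambda>v. 2 * a * ip c x v + v \<bullet> A)) (at x)"
  by (rule has_derivative_eq_rhs, (rule derivative_intros has_derivative_ip)+) (simp add: fun_eq_iff)

lemma smooth_quads:
  assumes "f \<in> quads" shows "smooth f"
  unfolding smooth_def
proof (intro exI[of _ quads] conjI ballI allI)
  fix h x v assume "h \<in> (quads :: ('n::{finite,linorder} rmat \<Rightarrow> real) set)"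
  then obtain c a A b where h: "h = (\<lambda>x. a * ip c x x + x \<bullet> A + b)" by (auto simp: quads_def)
  show "h differentiable (at x)" unfolding h differentiable_def using quads_derivative by blast
  have "frechet_derivative h (at x) v = 2 * a * ip c x v + v \<bullet> A" for x
    unfolding h by (simp add: frechet_derivative_at[OF quads_derivative, symmetric])
  then have "(\<lambda>x. frechet_derivative h (at x) v) = (\<lambda>x. 0 * ip 0 x x + x \<bullet> ((2 * a) *\<^sub>R cut c v) + v \<bullet> A)"
    by (simp add: fun_eq_iff ip_cut)
  then show "(\<lambda>x. frechet_derivative h (at x) v) \<in> quads"
    unfolding quads_def by (intro CollectI exI)
qed (rule assms)

lemma gs_facts:
  "subspace (gs c :: 'n::{finite,linorder} rmat set)" "gs c \<subseteq> (so :: 'n rmat set)"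
  using subalgebra_gs by (auto simp: subalgebra_def)

text \<open>Elements of \<open>gs c\<close> do not mix the corner with the rest, so their bracket
  has the bracket of the corners as corner, and the squared norm of the corner is
  ad-invariant.\<close>

lemma ip_invariant:
  fixes x y :: "'n::{finite,linorder} rmat"
  assumes "x \<in> gs c" "y \<in> gs c"
  shows "ip c x (lie y x) = 0"
proof -
  have mult: "(A ** B) $ i $ j = (cut c A ** cut c B) $ i $ j" if "i \<in> low c" "j \<in> low c" "A \<in> gs c" "B \<in> gs c"
    for A B :: "'n rmat" and i j
  proof -
    have "A $ i $ l = 0" if "l \<notin> low c" for l
    proof (rule ccontr)
      assume "A $ i $ l \<noteq> 0"
      then have "(blk i \<le> c \<and> blk l \<le> c) \<or> (blk i = Suc c \<and> blk l = Suc c)"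
        using \<open>A \<in> gs c\<close> unfolding gs_def by blast
      then show False using that \<open>i \<in> low c\<close> by (auto simp: low_def)
    qed
    then show ?thesis unfolding mat_mult_nth using that by (intro sum.cong refl) (auto simp: cut_def)
  qed
  have "ip c x (lie y x) = ip c x (lie (cut c y) (cut c x))"
    unfolding ip_def by (intro sum.cong refl) (simp add: lie_def mult assms)
  also have "\<dots> = ip c (lie (cut c y) (cut c x)) x" by (rule ip_commute)
  also have "\<dots> = lie (cut c y) (cut c x) \<bullet> cut c x" by (rule ip_cut)
  also have "\<dots> = cut c x \<bullet> lie (cut c y) (cut c x)" by (rule inner_commute)
  also have "\<dots> = 0"
  proof -
    have "cut c y \<in> so" using assms gs_facts by (intro cut_so) auto
    from inner_lie[OF this, of "cut c x" "cut c x"] show ?thesis by (simp add: inner_commute)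
  qed
  finally show ?thesis .
qed

lemma bb_invariant:
  fixes x y :: "'n::{finite,linorder} rmat"
  assumes c: "Suc c \<le> CARD('n) div 2" and xy: "x \<in> gs c" "y \<in> gs c"
  shows "bb (Suc c) (lie y x) = 0"
proof -
  let ?q = "hd_idx (Suc c) :: 'n"
  have q: "blk ?q = Suc c" using low_Suc[OF c] by simp
  have mult: "(A ** B) $ ?q $ pr ?q = 0" if AB: "A \<in> gs c" "B \<in> gs c" for A B :: "'n rmat"
    unfolding mat_mult_nth
  proof (intro sum.neutral ballI)
    fix l
    have so: "A \<in> so" "B \<in> so" using AB gs_facts by auto
    show "A $ ?q $ l * B $ l $ pr ?q = 0"
    proof (cases "blk l = Suc c")
      case True
      then have "l = ?q \<or> l = pr ?q" using q blk_eqD by metis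
      then show ?thesis using so_diag[OF so(1)] so_diag[OF so(2)] by auto
    next
      case False
      then have "A $ ?q $ l = 0" using AB(1) q unfolding gs_def by fastforce
      then show ?thesis by simp
    qed
  qed
  show ?thesis by (simp add: bb_def lie_def mult xy)
qed

text \<open>The projection gives it the shape of a generator of \<open>collective\<close>; on
  antisymmetric matrices it does not change the value, which is 2 a^2.\<close>

definition E_fun :: "nat \<Rightarrow> 'n::{finite,linorder} rmat \<Rightarrow> real" where
  "E_fun c x = ip c (trace_proj (gs c) x) (trace_proj (gs c) x)"

definition B_fun :: "nat \<Rightarrow> 'n::{finite,linorder} rmat \<Rightarrow> real" where
  "B_fun c x = bb (Suc c) (trace_proj (gs c) x)"

definition S_fun :: "nat \<Rightarrow> 'n::{finite,linorder} rmat \<Rightarrow> real" where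
  "S_fun c x = (\<Sum>j\<in>{c..<CARD('n) div 2}. B_fun j x)"

lemma E_fun_collective:
  assumes "(gs c :: 'n::{finite,linorder} rmat set) \<in> K" shows "E_fun c \<in> collective K"
proof -
  have "(\<lambda>x :: 'n rmat. ip c x x) = (\<lambda>x. 1 * ip c x x + x \<bullet> 0 + 0)" by simp
  then have "(\<lambda>x :: 'n rmat. ip c x x) \<in> quads" unfolding quads_def by blast
  moreover have "coadjoint_invariant (gs c) (\<lambda>x :: 'n rmat. ip c x x)"
    unfolding coadjoint_invariant_def frechet_derivative_at[OF has_derivative_ip, symmetric]
    by (simp add: ip_invariant)
  ultimately have "(\<lambda>x. (\<lambda>x. ip c x x) (trace_proj (gs c) x)) \<in> collective K"
    by (intro collective.gen[OF assms] smooth_quads)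
  then show ?thesis by (simp add: E_fun_def[abs_def])
qed

lemma linear_bb: "linear (bb c)"
  by (rule linearI) (simp_all add: bb_def)

lemma B_fun_collective:
  fixes K :: "'n::{finite,linorder} rmat set set"
  assumes c: "Suc c \<le> CARD('n) div 2" and K: "gs c \<in> K" shows "B_fun c \<in> collective K"
proof -
  obtain G :: "'n rmat" where G: "\<And>v. bb (Suc c) v = v \<bullet> G" by (rule gradient_exists[OF linear_bb]) blast
  then have "bb (Suc c) = (\<lambda>x :: 'n rmat. 0 * ip 0 x x + x \<bullet> G + 0)" by (simp add: fun_eq_iff)
  then have "(bb (Suc c) :: 'n rmat \<Rightarrow> real) \<in> quads" unfolding quads_def by blast
  moreover have "coadjoint_invariant (gs c) (bb (Suc c) :: 'n rmat \<Rightarrow> real)"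
  proof -
    have "((bb (Suc c) :: 'n rmat \<Rightarrow> real) has_derivative bb (Suc c)) (at x)" for x
      using linear_bb by (intro bounded_linear_imp_has_derivative) (simp add: linear_conv_bounded_linear)
    then have "frechet_derivative (bb (Suc c) :: 'n rmat \<Rightarrow> real) (at x) = bb (Suc c)" for x
      using frechet_derivative_at by metis
    then show ?thesis unfolding coadjoint_invariant_def using bb_invariant[OF c] by simp
  qed
  ultimately have "(\<lambda>x. bb (Suc c) (trace_proj (gs c) x)) \<in> collective K"
    by (intro collective.gen[OF K] smooth_quads)
  then show ?thesis by (simp add: B_fun_def[abs_def])
qed

lemma S_fun_collective:
  fixes K :: "'n::{finite,linorder} rmat set set"
  assumes K: "\<And>j. c \<le> j \<Longrightarrow> j < CARD('n) div 2 \<Longrightarrow> gs j \<in> K" shows "S_fun c \<in> collective K"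
proof -
  have "(\<lambda>x. \<Sum>j\<in>A. B_fun j x) \<in> collective K" if "finite A" "A \<subseteq> {c..<CARD('n) div 2}" for A
    using that
  proof (induction A rule: finite_induct)
    case (insert j A)
    have "B_fun j \<in> collective K" using insert by (intro B_fun_collective K) auto
    with insert show ?case using collective.add[of "B_fun j"] by simp
  qed (simp add: collective.const)
  then show ?thesis unfolding S_fun_def[abs_def] by simp
qed

lemma ss_sum:
  fixes v :: "'n::{finite,linorder} rmat"
  assumes v: "v \<in> so" and c: "c \<le> CARD('n) div 2"
  shows "ss c v = (\<Sum>j\<in>{c..<CARD('n) div 2}. bb (Suc j) v)"
  using c
proof (induction rule: inc_induct)
  case (step c)
  have "{c..<CARD('n) div 2} = insert c {Suc c..<CARD('n) div 2}" using step by auto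
  then show ?case using step ss_Suc[of c v] v by simp
qed (simp add: ss_top)

lemma trace_proj_gs_params:
  fixes x y :: "'n::{finite,linorder} rmat"
  assumes x: "x \<in> so" and y: "y \<in> so"
  shows "ip c (trace_proj (gs c) x) (trace_proj (gs c) y) = ip c x y"
    "Suc c \<le> CARD('n) div 2 \<Longrightarrow> bb (Suc c) (trace_proj (gs c) x) = bb (Suc c) x"
proof -
  show "ip c (trace_proj (gs c) x) (trace_proj (gs c) y) = ip c x y"
    unfolding ip_def by (intro sum.cong refl) (simp add: trace_proj_gs[OF x] trace_proj_gs[OF y] low_def)
  assume "Suc c \<le> CARD('n) div 2"
  then have "blk (hd_idx (Suc c) :: 'n) = Suc c" using low_Suc by blast
  then show "bb (Suc c) (trace_proj (gs c) x) = bb (Suc c) x" by (simp add: bb_def trace_proj_gs[OF x])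
qed

lemma
  fixes p v :: "'n::{finite,linorder} rmat"
  assumes p: "p \<in> so" and v: "v \<in> so"
  shows E_fun_derivative: "frechet_derivative (E_fun c) (at p) v = 2 * ip c p v"
    and S_fun_derivative: "c \<le> CARD('n) div 2 \<Longrightarrow> frechet_derivative (S_fun c) (at p) v = ss c v"
proof -
  have lin: "linear (trace_proj (gs c) :: 'n rmat \<Rightarrow> _)" for c by (rule linear_trace_proj[OF gs_facts])
  then have bl: "bounded_linear (trace_proj (gs c) :: 'n rmat \<Rightarrow> _)" for c by (simp add: linear_conv_bounded_linear)
  have "(E_fun c has_derivative (\<lambda>v. 2 * ip c (trace_proj (gs c) p) (trace_proj (gs c) v))) (at p)"
    unfolding E_fun_def[abs_def]
    by (rule has_derivative_compose[OF bounded_linear_imp_has_derivative[OF bl] has_derivative_ip])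
  from frechet_derivative_at[OF this, symmetric] show "frechet_derivative (E_fun c) (at p) v = 2 * ip c p v"
    by (simp add: trace_proj_gs_params[OF p v])
  assume c: "c \<le> CARD('n) div 2"
  have "linear (S_fun c :: 'n rmat \<Rightarrow> real)"
    unfolding S_fun_def[abs_def] B_fun_def
    by (rule linearI) (simp_all add: linear_add[OF lin] linear_cmul[OF lin] linear_add[OF linear_bb] linear_cmul[OF linear_bb]
        sum.distrib sum_distrib_left)
  then have "(S_fun c has_derivative S_fun c) (at p)"
    by (intro bounded_linear_imp_has_derivative) (simp add: linear_conv_bounded_linear)
  from frechet_derivative_at[OF this, symmetric] have "frechet_derivative (S_fun c) (at p) v = S_fun c v" by simp
  also have "\<dots> = ss c v" unfolding S_fun_def ss_sum[OF v c]
    by (intro sum.cong refl) (simp add: B_fun_def trace_proj_gs_params(2)[OF v v])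
  finally show "frechet_derivative (S_fun c) (at p) v = ss c v" .
qed

subsection \<open>Functional independence\<close>

text \<open>The product of f - y over the eigenvalues y of the other covectors annihilates all terms
  but one and scales the remaining one by a nonzero factor. The pointwise conclusion allows
  nonvanishing of the covectors to be supplied separately.\<close>

lemma eigencovectors_independent:
  fixes l :: "'i \<Rightarrow> 'a::real_vector \<Rightarrow> real"
  assumes f: "linear f" and T: "subspace T" "\<And>v. v \<in> T \<Longrightarrow> f v \<in> T" and I: "finite I"
    and lin: "\<And>i. i \<in> I \<Longrightarrow> linear (l i)"
    and ev: "\<And>i v. i \<in> I \<Longrightarrow> v \<in> T \<Longrightarrow> l i (f v) = x i * l i v" and inj: "inj_on x I"
    and zero: "\<And>v. v \<in> T \<Longrightarrow> (\<Sum>i\<in>I. a i * l i v) = 0" and i: "i \<in> I" and v: "v \<in> T"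
  shows "a i * l i v = 0"
proof -
  obtain ks where ks: "set ks = x ` (I - {i})" using finite_list[of "x ` (I - {i})"] I by auto
  have *: "l j (lprod f ys w) = (\<Prod>y\<leftarrow>ys. x j - y) * l j w" if "j \<in> I" "w \<in> T" for j ys w
    using that(2)
  proof (induction ys arbitrary: w)
    case (Cons y ys)
    have "f w - y *\<^sub>R w \<in> T" using T Cons.prems by (simp add: subspace_diff subspace_scale)
    from Cons.IH[OF this] show ?case
      using ev[OF that(1) Cons.prems] lin[OF that(1)] by (simp add: linear_diff linear_cmul algebra_simps)
  qed simp
  let ?w = "lprod f ks v"
  have "?w \<in> T" by (rule lprod_invariant[OF T v])
  then have "0 = (\<Sum>j\<in>I. a j * l j ?w)" using zero by simp
  also have "\<dots> = (\<Sum>j\<in>I. if j = i then a i * l i ?w else 0)"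
  proof (intro sum.cong refl)
    fix j assume j: "j \<in> I"
    have "l j ?w = 0" if "j \<noteq> i"
    proof -
      have "x j \<in> set ks" using ks j that by auto
      then have "(\<Prod>y\<leftarrow>ks. x j - y) = 0" by (force simp: prod_list_zero_iff)
      then show ?thesis using *[OF j v] by simp
    qed
    then show "a j * l j ?w = (if j = i then a i * l i ?w else 0)" by auto
  qed
  also have "\<dots> = a i * l i ?w" using I i by simp
  finally have "a i * ((\<Prod>y\<leftarrow>ks. x i - y) * l i v) = 0" using *[OF i v] by simp
  moreover have "(\<Prod>y\<leftarrow>ks. x i - y) \<noteq> 0"
    using inj i unfolding prod_list_zero_iff by (auto simp: ks inj_on_def)
  ultimately show ?thesis by simp
qed

lemma sum_lessThan_add: "(\<Sum>i<a + b. g i) = (\<Sum>i<a. g i) + (\<Sum>i<b. g (a + i :: nat) :: real)"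
  by (induction b) (simp_all add: add.assoc)

text \<open>On the tangent space at a generic point, the differentials \<open>ip c p\<close> and \<open>ss c\<close> are combinations of
  eigencovectors with distinct eigenvalues.\<close>

lemma params_independent:
  fixes p :: "'n::{finite,linorder} rmat" and A B :: "nat \<Rightarrow> real" and C :: real
  assumes d: "CARD('n) \<ge> 3" and M: "p \<in> M_phi" and g: "generic p"
    and zero: "\<And>v. v \<in> tangent p \<Longrightarrow> (\<Sum>c\<in>{1..<CARD('n) div 2}. A c * ip c p v + B c * ss c v)
      + (if odd CARD('n) then C * ss 0 v else 0) = 0"
  shows "c \<in> {1..<CARD('n) div 2} \<Longrightarrow> A c = 0 \<and> B c = 0" "odd CARD('n) \<Longrightarrow> C = 0"
proof -
  let ?N = "CARD('n) div 2" and ?o = "odd CARD('n)"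
  have d2: "CARD('n) \<ge> 2" using d by simp
  note p = M_phi_facts[OF d2 M]
  \<comment> \<open>A pair (s, c) labels the eigencovector of sign s; for odd size (0, 0) labels
    \<open>ss 0\<close>, whose eigenvalue 1 - \<open>ss 0 p\<close> fits the common formula with s =
    0.\<close>
  define I :: "(real \<times> nat) set" where "I = {1, - 1} \<times> {1..<?N} \<union> (if ?o then {(0, 0)} else {})"
  define l where "l = (\<lambda>(s, c). if c = 0 then ss 0 else ecov s c p)"
  define x where "x = (\<lambda>(s, c). 1 + s * aa c p - ss c p)"
  \<comment> \<open>Solves a_+ + a_- = A and -2 \<open>aa\<close> (a_+ - a_-) = B, which expresses A
    \<open>ip\<close> + B \<open>ss\<close> through the two \<open>ecov\<close>.\<close>
  define a where "a = (\<lambda>(s, c). if c = 0 then C else A c / 2 - s * (B c / (4 * aa c p)))"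
  have pos: "aa c p > 0" if "c \<in> {1..<?N}" for c using aa_pos[OF p(1,2) g, of c] that by simp
  have I: "finite I" by (simp add: I_def)
  have "a i * l i v = 0" if i: "i \<in> I" and v: "v \<in> tangent p" for i v
  proof (rule eigencovectors_independent[OF linear_N_op subspace_tangent N_op_tangent[OF p(1)] I _ _ _ _ i v])
    show "linear (l i)" if "i \<in> I" for i
      using linear_ss linear_ecov by (auto simp: l_def split: prod.split)
    show "l i (N_op p v) = x i * l i v" if "i \<in> I" "v \<in> tangent p" for i v
      using that ecov_N[OF d2 M _ that(2)] ss_N[OF d2 M _ that(2), of 0] ip_0[OF p(1), of v]
      by (auto simp: I_def l_def x_def split: if_splits)
    show "inj_on x I"
    proof (rule inj_onI)
      fix i j assume ij: "i \<in> I" "j \<in> I" "x i = x j"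
      obtain s c s' c' where sc: "i = (s, c)" "j = (s', c')" by (cases i, cases j) auto
      \<comment> \<open>Equal eigenvalues would make the difference of the \<open>ss\<close> equal
        to s' a' - s a, whose absolute value is at least a - a', against strict interlacing.\<close>
      have *: False if "(s, c) \<in> I" "(s', c') \<in> I" "x (s, c) = x (s', c')" "c' < c" for s c s' c'
      proof -
        have c: "c \<le> ?N" "?o \<or> 0 < c'" "s = 1 \<or> s = -1" "s' = 1 \<or> s' = -1 \<or> s' = 0" using that by (auto simp: I_def split: if_splits)
        have "\<bar>ss c' p - ss c p\<bar> < aa c p - aa c' p" by (rule ss_aa_strict[OF p(1,2) g that(4) c(1,2)])
        moreover have "ss c' p - ss c p = s' * aa c' p - s * aa c p" using that(3) by (simp add: x_def)
        moreover have "0 \<le> aa c' p" by simp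
        ultimately show False using c(3,4) by (auto simp: abs_less_iff simp del: aa_nonneg)
      qed
      consider "c' < c" | "c < c'" | "c = c'" by linarith
      then show "i = j"
      proof cases
        case 1 then show ?thesis using *[of s c s' c'] ij sc by auto
      next
        case 2 then show ?thesis using *[of s' c' s c] ij sc by auto
      next
        case 3
        show ?thesis
        proof (cases "c = 0")
          case True then show ?thesis using 3 ij sc by (auto simp: I_def split: if_splits)
        next
          case False
          then have "c \<in> {1..<?N}" using ij sc by (auto simp: I_def split: if_splits)
          from pos[OF this] show ?thesis using 3 ij sc by (auto simp: x_def)
        qed
      qed
    qed
    show "(\<Sum>i\<in>I. a i * l i v) = 0" if v: "v \<in> tangent p" for v
    proof -
      let ?f = "\<lambda>i. a i * l i v"
      have "sum ?f I = sum ?f ({1, - 1} \<times> {1..<?N}) + sum ?f (if ?o then {(0, 0)} else {})"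
        unfolding I_def by (rule sum.union_disjoint) auto
      also have "sum ?f ({1, - 1} \<times> {1..<?N}) = (\<Sum>s\<in>{1, - 1}. \<Sum>c\<in>{1..<?N}. ?f (s, c))"
        by (simp add: sum.cartesian_product)
      also have "\<dots> = (\<Sum>c\<in>{1..<?N}. ?f (1, c) + ?f (- 1, c))" by (simp add: sum.distrib)
      also have "\<dots> = (\<Sum>c\<in>{1..<?N}. A c * ip c p v + B c * ss c v)"
      proof (intro sum.cong refl)
        fix c assume c: "c \<in> {1..<?N}"
        then have "aa c p \<noteq> 0" "c \<noteq> 0" using pos[of c] by auto
        then show "?f (1, c) + ?f (- 1, c) = A c * ip c p v + B c * ss c v"
          by (simp add: a_def l_def ecov_def field_simps)
      qed
      also have "sum ?f (if ?o then {(0, 0)} else {}) = (if ?o then C * ss 0 v else 0)"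
        by (simp add: a_def l_def)
      finally show ?thesis using zero[OF v] by simp
    qed
  qed
  note az = this
  show "A c = 0 \<and> B c = 0" if c: "c \<in> {1..<?N}"
  proof -
    have "a (s, c) = 0" if s: "s = 1 \<or> s = - 1" for s
    proof -
      have s2: "s * s = 1" using s by auto
      obtain v where v: "v \<in> tangent p" "ecov s c p v \<noteq> 0"
        using ecov_nonzero[OF p(1,2) g _ _ s2, of c] c by auto
      have "(s, c) \<in> I" using s c by (auto simp: I_def)
      from az[OF this v(1)] v(2) c show ?thesis by (simp add: l_def)
    qed
    from this[of 1] this[of "-1"] pos[OF c] c show ?thesis by (auto simp: a_def)
  qed
  show "C = 0" if o: ?o
  proof -
    obtain v where v: "v \<in> tangent p" "ss 0 v \<noteq> 0" by (rule ss_0_nonzero[OF p(1,2) g o d2])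
    have "(0, 0) \<in> I" using o by (simp add: I_def)
    from az[OF this v(1)] v(2) show ?thesis by (simp add: l_def a_def)
  qed
qed

text \<open>The values of c run through 1 to N - 1: at c = N the parameters a and s are the
  constants 1 and 0. At c = 0 the parameter a is 0, so odd size contributes one more partial
  sum.\<close>

definition hamiltonian :: "nat \<Rightarrow> 'n::{finite,linorder} rmat \<Rightarrow> real" where
  "hamiltonian i = (let K = CARD('n) div 2 - 1 in
     if i < K then E_fun (Suc i) else if i < 2 * K then S_fun (Suc (i - K)) else S_fun 0)"

lemma hamiltonian_collective:
  assumes i: "i < CARD('n::{finite,linorder}) - 2"
  shows "hamiltonian i \<in> collective (so_chain :: 'n rmat set set)"
proof -
  let ?N = "CARD('n) div 2"
  have gs: "gs c \<in> (so_chain :: 'n rmat set set)" if "c < ?N" "odd CARD('n) \<or> 0 < c" for c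
    unfolding so_chain_gs using that by auto
  have odd: "odd CARD('n)" if "\<not> i < 2 * (?N - 1)"
  proof
    assume "even CARD('n)"
    then show False using that i by (auto elim!: evenE)
  qed
  show ?thesis using odd
    by (auto simp: hamiltonian_def Let_def intro!: E_fun_collective S_fun_collective gs)
qed

lemma hamiltonians_independent:
  fixes p :: "'n::{finite,linorder} rmat"
  assumes d: "CARD('n) \<ge> 3" and M: "p \<in> M_phi" and g: "generic p"
  shows "functionally_independent_at p (CARD('n) - 2) hamiltonian"
  unfolding functionally_independent_at_def
proof (intro allI impI)
  define K where "K = CARD('n) div 2 - 1"
  let ?n = "CARD('n) - 2" and ?o = "odd CARD('n)"
  have ham: "(hamiltonian i :: 'n rmat \<Rightarrow> real) =
    (if i < K then E_fun (Suc i) else if i < 2 * K then S_fun (Suc (i - K)) else S_fun 0)" for i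
    by (simp only: hamiltonian_def Let_def K_def)
  have d2: "CARD('n) \<ge> 2" using d by simp
  note p = M_phi_facts[OF d2 M]
  have n: "?n = K + K + (if ?o then 1 else 0)" using d unfolding K_def by (auto elim!: evenE oddE)
  fix c :: "nat \<Rightarrow> real" and i
  assume zero: "\<forall>v\<in>tangent p. (\<Sum>i<?n. c i * frechet_derivative (hamiltonian i) (at p) v) = 0" and i: "i < ?n"
  \<comment> \<open>The factor 2 comes from differentiating the quadratic \<open>E_fun\<close>; the
    shift by one turns positions among the hamiltonians into block numbers.\<close>
  define A where "A j = 2 * c (j - 1)" for j
  define B where "B j = c (K + (j - 1))" for j
  have "(\<Sum>j\<in>{1..<CARD('n) div 2}. A j * ip j p v + B j * ss j v) + (if ?o then c (K + K) * ss 0 v else 0) = 0"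
    if v: "v \<in> tangent p" for v
  proof -
    have so: "v \<in> so" using p(5)[OF v] .
    let ?g = "\<lambda>i. c i * frechet_derivative (hamiltonian i) (at p) v"
    have g1: "?g i = A (Suc i) * ip (Suc i) p v" if "i < K" for i
      using that by (simp add: ham E_fun_derivative[OF p(1) so] A_def)
    have g2: "?g (K + i) = B (Suc i) * ss (Suc i) v" if "i < K" for i
    proof -
      have "hamiltonian (K + i) = (S_fun (Suc i) :: 'n rmat \<Rightarrow> real)" using that by (simp add: ham)
      then show ?thesis using that by (simp add: S_fun_derivative[OF p(1) so] B_def K_def)
    qed
    have g3: "?g (K + K) = c (K + K) * ss 0 v"
    proof -
      have "hamiltonian (K + K) = (S_fun 0 :: 'n rmat \<Rightarrow> real)" by (simp add: ham)
      then show ?thesis by (simp add: S_fun_derivative[OF p(1) so])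
    qed
    have "0 = (\<Sum>i<?n. ?g i)" using zero v by simp
    also have "\<dots> = (\<Sum>i<K + K. ?g i) + (if ?o then ?g (K + K) else 0)" unfolding n by simp
    also have "(\<Sum>i<K + K. ?g i) = (\<Sum>i<K. ?g i) + (\<Sum>i<K. ?g (K + i))" by (rule sum_lessThan_add)
    also have "\<dots> = (\<Sum>i<K. A (Suc i) * ip (Suc i) p v + B (Suc i) * ss (Suc i) v)"
      unfolding sum.distrib by (intro arg_cong2[where f = "(+)"] sum.cong refl) (simp_all only: lessThan_iff g1 g2)
    also have "\<dots> = (\<Sum>j\<in>{1..<CARD('n) div 2}. A j * ip j p v + B j * ss j v)"
      by (rule sum.reindex_bij_witness[where i = "\<lambda>j. j - 1" and j = Suc]) (auto simp: K_def)
    finally show ?thesis unfolding g3 by simp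
  qed
  note ind = params_independent[OF d M g this]
  consider "i < K" | "K \<le> i" "i < K + K" | "?o" "i = K + K"
    using i unfolding n by (cases ?o) (simp_all, linarith+)
  then show "c i = 0"
  proof cases
    case 1
    then show ?thesis using ind(1)[of "Suc i"] by (simp add: A_def K_def)
  next
    case 2
    then obtain j where j: "i = K + j" "j < K" by (metis add_less_cancel_left le_iff_add)
    then have "Suc j \<in> {1..<CARD('n) div 2}" by (auto simp: K_def)
    then have "B (Suc j) = 0" using ind(1)[of "Suc j"] by simp
    then show ?thesis by (simp add: B_def j)
  next
    case 3
    then show ?thesis using ind(2) by simp
  qed
qed

theorem collective_completely_integrable:
  assumes d: "CARD('n::{finite,linorder}) \<ge> 3"
  shows "completely_integrable (collective (so_chain :: 'n rmat set set))"
  unfolding completely_integrable_def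
proof (intro conjI ballI)
  have d2: "CARD('n) \<ge> 2" using d by simp
  fix f h :: "'n rmat \<Rightarrow> real" and p :: "'n rmat"
  assume fh: "f \<in> collective so_chain" "h \<in> collective so_chain" and p: "p \<in> M_phi"
  show "kks p (frechet_derivative f (at p)) (frechet_derivative h (at p)) = 0"
  proof (rule collective_commute[OF _ _ fh M_phi_facts(1)[OF d2 p]])
    show "subalgebra k" if "k \<in> (so_chain :: 'n rmat set set)" for k
      using that unfolding so_chain_gs by (auto intro: subalgebra_gs)
    show "k \<subseteq> k' \<or> k' \<subseteq> k" if "k \<in> so_chain" "k' \<in> (so_chain :: 'n rmat set set)" for k k'
    proof -
      from that obtain c c' where "k = gs c" "k' = gs c'" unfolding so_chain_gs by blast
      then show ?thesis using gs_mono[of c c'] gs_mono[of c' c] by (cases "c \<le> c'") auto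
    qed
  qed
next
  have d2: "CARD('n) \<ge> 2" using d by simp
  have "orb (mat 1) = (rho_phi :: 'n rmat)" by (simp add: orb_def matrix_mul_lid matrix_mul_rid)
  moreover have "rotation_matrix (mat 1 :: 'n rmat)" by (simp add: rotation_matrix_def orthogonal_matrix_def)
  ultimately have "(rho_phi :: 'n rmat) \<in> M_phi" unfolding M_phi_def by force
  then have dim: "dim (tangent (rho_phi :: 'n rmat)) div 2 = CARD('n) - 2" using M_phi_facts(4)[OF d2] by simp
  show "\<exists>f U. (\<forall>i < dim (tangent (rho_phi :: 'n rmat)) div 2. f i \<in> collective (so_chain :: 'n rmat set set)) \<and>
        dense_open_in M_phi U \<and>
        (\<forall>p\<in>U. functionally_independent_at p (dim (tangent (rho_phi :: 'n rmat)) div 2) f)"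
    unfolding dim
    by (intro exI[of _ hamiltonian] exI[of _ "{p \<in> M_phi. generic p}"] conjI allI impI ballI)
       (auto intro: hamiltonian_collective hamiltonians_independent[OF d] dense_open_generic[OF d])
qed

subsection \<open>Eigenvalues of the diagonal blocks\<close>

type_synonym 'n cvec = "complex^'n"

lemma cut_pluecker: "pluecker p \<Longrightarrow> pluecker (cut c p)"
proof -
  assume p: "pluecker p"
  have *: "p $ i $ j * p $ k $ l - p $ i $ k * p $ j $ l + p $ i $ l * p $ j $ k = 0" for i j k l
    using p unfolding pluecker_def by blast
  have "cut c p $ i $ j * cut c p $ k $ l - cut c p $ i $ k * cut c p $ j $ l + cut c p $ i $ l * cut c p $ j $ k = 0" for i j k l
  proof (cases "i \<in> low c \<and> j \<in> low c \<and> k \<in> low c \<and> l \<in> low c")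
    case True then show ?thesis using *[of i j k l] by (simp add: cut_def)
  next
    case False then show ?thesis by (auto simp: cut_def)
  qed
  then show ?thesis unfolding pluecker_def by blast
qed

text \<open>An antisymmetric matrix of rank at most 2 squares to a negative multiple of the
  projection to its plane. Here the identity results from contracting the Pluecker relation with
  q_kl, which produces the cube twice.\<close>

lemma pluecker_cube:
  fixes q :: "'n::finite rmat"
  assumes q: "q \<in> so" "pluecker q"
  shows "q ** q ** q = - ((q \<bullet> q) / 2) *\<^sub>R q"
proof -
  have "(q ** q ** q) $ i $ j = - ((q \<bullet> q) / 2) * q $ i $ j" for i j
  proof -
    have cube: "(q ** q ** q) $ i $ j = (\<Sum>k\<in>UNIV. \<Sum>l\<in>UNIV. q $ i $ k * q $ k $ l * q $ l $ j)"
      unfolding matrix_mul_assoc[symmetric] mat_mult_nth[of q "q ** q"] mat_mult_nth[of q q] sum_distrib_left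
      by (simp add: mult.assoc)
    have "(q \<bullet> q) * q $ i $ j = (\<Sum>k\<in>UNIV. \<Sum>l\<in>UNIV. q $ k $ l * (q $ i $ j * q $ k $ l))"
      unfolding inner_mat sum_distrib_right by (intro sum.cong refl) simp
    also have "\<dots> = (\<Sum>k\<in>UNIV. \<Sum>l\<in>UNIV. - (q $ i $ k * q $ k $ l * q $ l $ j) - q $ i $ l * q $ l $ k * q $ k $ j)"
    proof (intro sum.cong refl)
      fix k l
      have "q $ i $ j * q $ k $ l - q $ i $ k * q $ j $ l + q $ i $ l * q $ j $ k = 0"
        using q(2) unfolding pluecker_def by blast
      moreover have "q $ j $ l = - q $ l $ j" "q $ j $ k = - q $ k $ j" "q $ l $ k = - q $ k $ l"
        by (rule so_nth[OF q(1)])+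
      ultimately have "q $ i $ j * q $ k $ l = - (q $ i $ k * q $ l $ j) + q $ i $ l * q $ k $ j" by simp
      then have "q $ k $ l * (q $ i $ j * q $ k $ l) = q $ k $ l * (- (q $ i $ k * q $ l $ j) + q $ i $ l * q $ k $ j)" by simp
      then show "q $ k $ l * (q $ i $ j * q $ k $ l) = - (q $ i $ k * q $ k $ l * q $ l $ j) - q $ i $ l * q $ l $ k * q $ k $ j"
        using \<open>q $ l $ k = - q $ k $ l\<close> by (simp add: algebra_simps)
    qed
    also have "\<dots> = - (q ** q ** q) $ i $ j - (\<Sum>k\<in>UNIV. \<Sum>l\<in>UNIV. q $ i $ l * q $ l $ k * q $ k $ j)"
      unfolding cube sum_subtractf sum_negf ..
    also have "(\<Sum>k\<in>UNIV. \<Sum>l\<in>UNIV. q $ i $ l * q $ l $ k * q $ k $ j) = (q ** q ** q) $ i $ j"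
      unfolding cube by (rule sum.swap)
    finally show ?thesis by simp
  qed
  then show ?thesis by (simp add: vec_eq_iff)
qed

lemma cplx_mult_vec_scaleR: "cplx (r *\<^sub>R A) *v v = of_real r *s (cplx A *v v)"
  by (simp add: vec_eq_iff matrix_vector_mult_def sum_distrib_left mult.assoc)

text \<open>The cube identity forces z^3 = -a^2 z for every eigenvalue z. Conversely both signs of
  \<i> a are attained, by the vector w below if a is nonzero and by a coordinate vector in the
  kernel if a = 0.\<close>

lemma block_eigenvalues_eq:
  fixes p :: "'n::{finite,linorder} rmat"
  assumes p: "p \<in> so" "pluecker p" and c: "0 < c" "c \<le> CARD('n) div 2"
  defines "E \<equiv> block_eigenvalues (CARD('n) - 2 * (CARD('n) div 2 - c)) p"
  shows "{\<i> * aa c p, - (\<i> * aa c p)} \<subseteq> E" "E \<subseteq> {\<i> * aa c p, - (\<i> * aa c p), 0}"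
proof -
  let ?q = "cut c p" and ?a = "aa c p"
  let ?P = "cplx ?q"
  have q: "?q \<in> so" "pluecker ?q" by (intro cut_so cut_pluecker p)+
  have aq: "?q \<bullet> ?q = 2 * ?a\<^sup>2" by (simp add: aa_sq ip_cut_cut)
  have "cplx (?q ** ?q ** ?q) = cplx (- (?a\<^sup>2) *\<^sub>R ?q)" using pluecker_cube[OF q] aq by simp
  then have cube: "?P *v (?P *v (?P *v v)) = - (of_real (?a\<^sup>2)) *s (?P *v v)" for v
  proof -
    have "?P *v (?P *v (?P *v v)) = cplx (?q ** ?q ** ?q) *v v"
      by (simp add: cplx_simps matrix_vector_mul_assoc matrix_mul_assoc)
    also have "\<dots> = of_real (- (?a\<^sup>2)) *s (?P *v v)"
      using \<open>cplx (?q ** ?q ** ?q) = _\<close> by (simp only: cplx_mult_vec_scaleR)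
    finally show ?thesis by simp
  qed
  have low: "pos i < CARD('n) - 2 * (CARD('n) div 2 - c) \<longleftrightarrow> i \<in> low c" for i :: 'n
    using pos_less_blk[OF c(2)] by (simp add: low_def)
  have Pv: "(?P *v v) $ i = (if i \<in> low c then (cplx p *v v) $ i else 0)" if "\<forall>i. i \<notin> low c \<longrightarrow> v $ i = 0" for v i
    unfolding matrix_vector_mult_def vec_lambda_beta using that by (auto intro!: sum.cong sum.neutral simp: cut_def)
  have E: "E = {z. \<exists>v. v \<noteq> 0 \<and> (\<forall>i. i \<notin> low c \<longrightarrow> v $ i = 0) \<and> ?P *v v = z *s v}"
  proof -
    have "(\<forall>i. i \<in> low c \<longrightarrow> (cplx p *v v) $ i = z * v $ i) \<longleftrightarrow> ?P *v v = z *s v"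
      if v: "\<forall>i. i \<notin> low c \<longrightarrow> v $ i = 0" for v z
      unfolding vec_eq_iff Pv[OF v] using v by auto
    then have "(v \<noteq> 0 \<and> (\<forall>i. i \<notin> low c \<longrightarrow> v $ i = 0) \<and> (\<forall>i. i \<in> low c \<longrightarrow> (cplx p *v v) $ i = z * v $ i)) \<longleftrightarrow>
        (v \<noteq> 0 \<and> (\<forall>i. i \<notin> low c \<longrightarrow> v $ i = 0) \<and> ?P *v v = z *s v)" for v z by blast
    then show ?thesis unfolding E_def block_eigenvalues_def low not_less[symmetric] by simp
  qed
  show "E \<subseteq> {\<i> * ?a, - (\<i> * ?a), 0}"
  proof
    fix z assume "z \<in> E"
    then obtain v where v: "v \<noteq> 0" "?P *v v = z *s v" unfolding E by blast
    have "z *s (z *s (z *s v)) = - (of_real (?a\<^sup>2)) *s (z *s v)"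
      using cube[of v] by (simp only: v(2) vector_scalar_commute)
    moreover obtain i where i: "v $ i \<noteq> 0" using v(1) by (auto simp: vec_eq_iff)
    ultimately have "(z *s (z *s (z *s v))) $ i = (- (of_real (?a\<^sup>2)) *s (z *s v)) $ i"
      by (simp only:)
    then have "z * (z * (z * v $ i)) = - (of_real (?a\<^sup>2)) * (z * v $ i)"
      by (simp only: vector_smult_component)
    then have "(z * z * z) * v $ i = (- (of_real (?a\<^sup>2)) * z) * v $ i" by (simp only: mult.assoc)
    then have "z * z * z = - (of_real (?a\<^sup>2)) * z" using i by (simp only: mult_cancel_right) simp
    then have "z * ((z - \<i> * ?a) * (z + \<i> * ?a)) = 0" by (simp add: algebra_simps power2_eq_square)
    then have "z = 0 \<or> z - \<i> * ?a = 0 \<or> z + \<i> * ?a = 0" by (simp only: mult_eq_0_iff)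
    then show "z \<in> {\<i> * ?a, - (\<i> * ?a), 0}"
      using right_minus_eq[of z "\<i> * ?a"] eq_neg_iff_add_eq_0[of z "\<i> * ?a"] by blast
  qed
  have mem: "\<i> * of_real r \<in> E" if r: "r * r = ?a\<^sup>2" for r
  proof (cases "?a = 0")
    case True
    then have "?q = 0" using aq by simp
    then have P0: "?P *v v = 0" for v by (simp add: vec_eq_iff matrix_vector_mult_def)
    have "hd_idx c \<in> (low c :: 'n set)" using blk_hd[where 'n='n, of c] c by (simp add: low_def)
    then have "(\<forall>i. i \<notin> low c \<longrightarrow> (axis (hd_idx c :: 'n) 1 :: 'n cvec) $ i = 0)" by (auto simp: axis_def)
    moreover have "axis (hd_idx c :: 'n) 1 \<noteq> (0 :: 'n cvec)" by simp
    moreover have "r = 0" using True r by simp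
    ultimately show ?thesis unfolding E using P0
      by (intro CollectI exI[of _ "axis (hd_idx c :: 'n) 1"]) simp
  next
    case False
    then have "?q \<noteq> 0" using aq by auto
    then obtain i0 j0 where ij: "?q $ i0 $ j0 \<noteq> 0" by (auto simp: vec_eq_iff)
    define u :: "'n cvec" where "u = axis j0 1"
    define y where "y = ?P *v u"
    \<comment> \<open>On the image of \<open>?P\<close> its square is -r^2, so \<open>?P\<close> +
      \<i> r maps y to an eigenvector for \<i> r. Reality of \<open>?P\<close> and y shows w
      \<noteq> 0, by the imaginary part of one entry.\<close>
    define w where "w = ?P *v y + (\<i> * of_real r) *s y"
    have y_nth: "y $ i = of_real (?q $ i $ j0)" for i
      by (simp add: y_def u_def matrix_vector_mult_def axis_def if_distrib[of "\<lambda>x. _ * x"] cong: if_cong)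
    have "w $ i0 \<noteq> 0"
    proof
      assume w0: "w $ i0 = 0"
      have "Im ((?P *v y) $ i0) = 0" by (simp add: matrix_vector_mult_def y_nth)
      then have "Im (w $ i0) = r * ?q $ i0 $ j0" by (simp add: w_def y_nth)
      moreover have "r \<noteq> 0" using r False by auto
      ultimately show False using w0 ij by simp
    qed
    then have "w \<noteq> 0" by auto
    moreover have "w $ i = 0" if "i \<notin> low c" for i
      using that by (simp add: w_def y_nth) (simp add: matrix_vector_mult_def cut_def)
    moreover have "?P *v w = (\<i> * of_real r) *s w"
    proof -
      have "?P *v w = ?P *v (?P *v y) + (\<i> * of_real r) *s (?P *v y)"
        by (simp add: w_def matrix_vector_right_distrib vector_scalar_commute)
      also have "?P *v (?P *v y) = ((\<i> * of_real r) * (\<i> * of_real r)) *s y"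
      proof -
        have "(\<i> * complex_of_real r) * (\<i> * of_real r) = - of_real (r * r)"
          by (simp add: complex_eq_iff)
        then show ?thesis using cube[of u] unfolding y_def r by simp
      qed
      finally show ?thesis by (simp add: w_def vec_eq_iff algebra_simps)
    qed
    ultimately show ?thesis unfolding E by blast
  qed
  show "{\<i> * ?a, - (\<i> * ?a)} \<subseteq> E"
    using mem[of ?a] mem[of "- ?a"] by (simp add: power2_eq_square)
qed

lemma block_param_iff:
  fixes p :: "'n::{finite,linorder} rmat"
  assumes p: "p \<in> so" "pluecker p" and c: "0 < c" "c \<le> CARD('n) div 2"
  shows "block_param (CARD('n) - 2 * (CARD('n) div 2 - c)) p a \<longleftrightarrow> \<bar>a\<bar> = aa c p"
proof
  note E = block_eigenvalues_eq[OF p c]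
  show "block_param (CARD('n) - 2 * (CARD('n) div 2 - c)) p a" if "\<bar>a\<bar> = aa c p"
  proof -
    have "a = aa c p \<or> a = - aa c p" using that by linarith
    then show ?thesis using E unfolding block_param_def by (auto simp: insert_commute)
  qed
  assume "block_param (CARD('n) - 2 * (CARD('n) div 2 - c)) p a"
  then have "{\<i> * of_real a, - (\<i> * of_real a)} \<subseteq> {\<i> * aa c p, - (\<i> * aa c p), 0}"
    "{\<i> * aa c p, - (\<i> * aa c p)} \<subseteq> {\<i> * of_real a, - (\<i> * of_real a), 0}"
    using E unfolding block_param_def by blast+
  then have "a = aa c p \<or> a = - aa c p \<or> a = 0" "aa c p = a \<or> aa c p = - a \<or> aa c p = 0"
    by (auto simp: complex_eq_iff)
  then show "\<bar>a\<bar> = aa c p" using aa_nonneg[of c p] by (auto simp del: aa_nonneg)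
qed

lemma block_pf_bb:
  fixes p :: "'n::{finite,linorder} rmat"
  assumes c: "1 \<le> c" "c \<le> CARD('n) div 2"
  shows "block_pf (CARD('n) - 2 * (CARD('n) div 2 - c + 1)) p = bb c p"
proof -
  let ?q = "hd_idx c :: 'n"
  have q: "CARD('n) - 2 * (CARD('n) div 2 - c + 1) = CARD('n) mod 2 + 2 * (c - 1)"
    using c by (cases "even CARD('n)") (auto elim!: evenE oddE)
  have "pos ?q = CARD('n) mod 2 + 2 * (c - 1)" by (rule pos_hd[OF c])
  moreover have "pos (pr ?q) = pos ?q + 1"
  proof -
    have "blk ?q \<noteq> 0" "(sg ?q :: int) = 1" using blk_hd[OF c] c by auto
    then show ?thesis unfolding pos_pr by (auto simp: sg_def split: if_splits)
  qed
  ultimately show ?thesis unfolding block_pf_def q bb_def by (metis idx_pos)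
qed

text \<open>The sums of b_j telescope to \<open>ss\<close> from the full matrix inwards. In even
  size they stop at N - 1, before the block whose Pfaffian the statement replaces by 0.\<close>

lemma plist_lam_list:
  fixes p :: "'n::{finite,linorder} rmat"
  defines "N \<equiv> CARD('n) div 2"
  assumes n: "CARD('n) = n + 2" and p: "p \<in> so" and a: "\<And>k. k \<in> {1..N-1} \<Longrightarrow> \<bar>a k\<bar> = aa (N - k) p"
    and b: "\<And>k. k \<in> {1..(if n + 2 = 2 * N then N - 1 else N)} \<Longrightarrow> b k = bb (N - k + 1) p"
  shows "plist p = lam_list n N a b"
proof -
  have o: "odd CARD('n) \<longleftrightarrow> n + 2 = 2 * N + 1" "even CARD('n) \<longleftrightarrow> n + 2 = 2 * N"
  proof -
    have "odd m \<longleftrightarrow> m = 2 * (m div 2) + 1" "even m \<longleftrightarrow> m = 2 * (m div 2)" for m :: nat by presburger+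
    then show "odd CARD('n) \<longleftrightarrow> n + 2 = 2 * N + 1" "even CARD('n) \<longleftrightarrow> n + 2 = 2 * N"
      unfolding n[symmetric] N_def by blast+
  qed
  have sum: "(\<Sum>j=1..k. b j) = ss (N - k) p" if "k \<le> (if n + 2 = 2 * N then N - 1 else N)" for k
    using that
  proof (induction k)
    case 0
    then show ?case by (simp add: N_def ss_top)
  next
    case (Suc k)
    have k: "Suc k \<le> N" using Suc.prems by (auto split: if_splits)
    then have "Suc (N - Suc k) = N - k" by simp
    moreover have "Suc (N - Suc k) \<le> CARD('n) div 2" using k unfolding N_def by linarith
    ultimately have "ss (N - Suc k) p = ss (N - k) p + bb (N - k) p" using ss_Suc[of "N - Suc k" p] p k
      by (metis Suc_le_eq diff_le_self N_def)
    moreover have "b (Suc k) = bb (N - Suc k + 1) p" using Suc.prems by (intro b) auto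
    moreover have "N - Suc k + 1 = N - k" using k by simp
    ultimately show ?case using Suc by simp
  qed
  have "lam_plus a b k = 1 + aa (N - k) p - ss (N - k) p" "lam_minus a b k = 1 - aa (N - k) p - ss (N - k) p"
    if "k \<in> {1..<N}" for k
  proof -
    have "k \<le> (if n + 2 = 2 * N then N - 1 else N)" "k \<in> {1..N-1}" using that by auto
    then show "lam_plus a b k = 1 + aa (N - k) p - ss (N - k) p" "lam_minus a b k = 1 - aa (N - k) p - ss (N - k) p"
      unfolding lam_plus_def lam_minus_def using a[of k] sum[of k] by simp_all
  qed
  moreover have "lam_last b N = 1 - ss 0 p" if "odd CARD('n)"
    using sum[of N] that o by (simp add: lam_last_def)
  ultimately show ?thesis
    unfolding plist_def lam_list_def N_def[symmetric] Let_def o(1) by (auto simp: o)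
qed

section \<open>Lists from multiplicities, the excluded size, and the theorem\<close>

lemma sorted_list_unique:
  fixes L L' :: "real list"
  assumes "sorted_wrt (\<ge>) L" "sorted_wrt (\<ge>) L'" "\<And>x. count_list L x = count_list L' x"
  shows "L = L'"
proof -
  have s: "sorted (rev L)" "sorted (rev L')" using assms(1,2) by (simp_all add: sorted_wrt_rev)
  have "mset (rev L) = mset (rev L')" using assms(3) by (intro multiset_eqI) (simp add: count_mset)
  then have "rev L = rev L'" using s by (metis properties_for_sort sorted_sort_id)
  then show ?thesis by simp
qed

text \<open>In size 2 the algebra is abelian, against the nonzero bracket in
  \<open>simple_lie\<close>. So simplicity supplies the size of at least 3 on which transitivity on
  frames depends.\<close>

lemma simple_so_card:
  assumes "simple_lie (so :: 'n::{finite,linorder} cmat set)"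
  shows "CARD('n) \<noteq> 2"
proof
  assume "CARD('n) = 2"
  then obtain i j :: 'n where ij: "UNIV = {i, j}" "i \<noteq> j" by (metis card_2_iff)
  have "lie X Y = 0" if "X \<in> so" "Y \<in> so" for X Y :: "'n cmat"
  proof -
    have "lie X Y $ a $ b = 0" for a b
    proof -
      have "a \<in> {i, j}" "b \<in> {i, j}" using ij(1) by auto
      moreover have "X $ j $ i = - X $ i $ j" "Y $ j $ i = - Y $ i $ j" using that by (auto intro: so_nth)
      moreover have "X $ i $ i = 0" "X $ j $ j = 0" "Y $ i $ i = 0" "Y $ j $ j = 0"
        using that by (auto intro: so_diag)
      moreover have "(\<Sum>l\<in>UNIV. f l) = f i + f j" for f :: "'n \<Rightarrow> complex" unfolding ij(1) using ij(2) by simp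
      ultimately show ?thesis
        by (elim insertE emptyE) (simp_all add: lie_def mat_mult_nth)
    qed
    then show ?thesis by (simp add: vec_eq_iff)
  qed
  then show False using assms unfolding simple_lie_def by blast
qed

theorem theorem10p1:
  fixes n N :: nat
  assumes "CARD('n::{finite,linorder}) = n + 2"
    and "n + 2 = 2 * N \<or> n + 2 = 2 * N + 1"
    and "simple_lie (so :: 'n cmat set)"
  shows "completely_integrable (collective (so_chain :: 'n rmat set set)) \<and>
    N_maximal_rank TYPE('n) \<and>
    (\<forall>\<mu>\<in>(M_phi :: 'n rmat set).
       (\<exists>a. \<forall>k\<in>{1..N-1}. block_param (n + 2 - 2 * k) \<mu> (a k)) \<and>
       (\<forall>a b. (\<forall>k\<in>{1..N-1}. block_param (n + 2 - 2 * k) \<mu> (a k)) \<longrightarrow>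
          (\<forall>k\<in>{1..(if n + 2 = 2 * N then N - 1 else N)}. b k = block_pf (n + 2 - 2 * k) \<mu>) \<longrightarrow>
          N_eigenvalues \<mu> =
            {lam_plus a b k | k. k \<in> {1..N-1}} \<union> {lam_minus a b k | k. k \<in> {1..N-1}} \<union>
            (if n + 2 = 2 * N + 1 then {lam_last b N} else {}) \<and>
          N_eigenvalue_list \<mu> (lam_list n N a b))) \<and>
    (\<forall>L. L \<in> bihamiltonian_polytope TYPE('n) \<longleftrightarrow>
       (\<exists>a b. L = lam_list n N a b \<and> a 0 = 1 \<and> a N = 0 \<and> (n + 2 = 2 * N \<longrightarrow> b N = 0) \<and>
          (\<forall>k\<in>{1..N}. 0 \<le> \<bar>a k\<bar> \<and> \<bar>a k\<bar> \<le> \<bar>a (k - 1)\<bar> \<and> \<bar>b k\<bar> \<le> \<bar>a (k - 1)\<bar> - \<bar>a k\<bar>)))"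
proof -
  have d: "CARD('n) \<ge> 3" using assms(1) simple_so_card[OF assms(3)] by linarith
  then have d2: "CARD('n) \<ge> 2" by simp
  have N: "N = CARD('n) div 2" using assms(1,2) by auto
  have N1: "N \<ge> 1" using d N by simp
  have ev: "even CARD('n) \<longleftrightarrow> n + 2 = 2 * N" using assms(2) unfolding assms(1)[symmetric] by auto
  let ?R = "if n + 2 = 2 * N then N - 1 else N"
  have bp: "block_param (n + 2 - 2 * k) \<mu> a \<longleftrightarrow> \<bar>a\<bar> = aa (N - k) \<mu>"
    if "k \<in> {1..N-1}" "\<mu> \<in> so" "pluecker \<mu>" for k a and \<mu> :: "'n rmat"
  proof -
    have "N - (N - k) = k" "0 < N - k" using that(1) by auto
    then show ?thesis using block_param_iff[OF that(2,3), of "N - k" a] unfolding N[symmetric] by (simp add: assms(1))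
  qed
  have pf: "block_pf (n + 2 - 2 * k) \<mu> = bb (N - k + 1) \<mu>" if "k \<in> {1..N}" for k and \<mu> :: "'n rmat"
  proof -
    have "N - (N - k + 1) + 1 = k" using that by auto
    then show ?thesis using block_pf_bb[of "N - k + 1" \<mu>] that unfolding N[symmetric] by (auto simp: assms(1))
  qed
  have R: "?R \<le> N" by simp
  note plist = plist_lam_list[where 'n='n, folded N, OF assms(1)]
  have eig: "(\<exists>a. \<forall>k\<in>{1..N-1}. block_param (n + 2 - 2 * k) \<mu> (a k)) \<and>
       (\<forall>a b. (\<forall>k\<in>{1..N-1}. block_param (n + 2 - 2 * k) \<mu> (a k)) \<longrightarrow>
          (\<forall>k\<in>{1..?R}. b k = block_pf (n + 2 - 2 * k) \<mu>) \<longrightarrow>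
          N_eigenvalues \<mu> =
            {lam_plus a b k | k. k \<in> {1..N-1}} \<union> {lam_minus a b k | k. k \<in> {1..N-1}} \<union>
            (if n + 2 = 2 * N + 1 then {lam_last b N} else {}) \<and>
          N_eigenvalue_list \<mu> (lam_list n N a b))" if M: "\<mu> \<in> M_phi" for \<mu> :: "'n rmat"
  proof (intro conjI allI impI)
    note p = M_phi_facts(1,2)[OF d2 M]
    show "\<exists>a. \<forall>k\<in>{1..N-1}. block_param (n + 2 - 2 * k) \<mu> (a k)"
      using bp[OF _ p] by (intro exI[of _ "\<lambda>k. aa (N - k) \<mu>"]) simp
    fix a b
    assume a: "\<forall>k\<in>{1..N-1}. block_param (n + 2 - 2 * k) \<mu> (a k)"
      and b: "\<forall>k\<in>{1..?R}. b k = block_pf (n + 2 - 2 * k) \<mu>"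
    have L: "plist \<mu> = lam_list n N a b"
    proof (rule plist[OF p(1)])
      show "\<bar>a k\<bar> = aa (N - k) \<mu>" if "k \<in> {1..N-1}" for k
        using a[rule_format, OF that] bp[OF that p] by blast
      show "b k = bb (N - k + 1) \<mu>" if "k \<in> {1..?R}" for k
      proof -
        have "k \<in> {1..N}" using that R by (meson atLeastAtMost_iff le_trans)
        then show ?thesis using b that pf by simp
      qed
    qed
    show "N_eigenvalue_list \<mu> (lam_list n N a b)"
      using N_eigenvalue_list_plist[OF d M] L by simp
    have "{1..<N} = {1..N-1}" using N1 by auto
    then show "N_eigenvalues \<mu> =
            {lam_plus a b k | k. k \<in> {1..N-1}} \<union> {lam_minus a b k | k. k \<in> {1..N-1}} \<union>
            (if n + 2 = 2 * N + 1 then {lam_last b N} else {})"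
      unfolding N_eigenvalues_plist[OF d M] L lam_list_def by auto
  qed
  have poly: "L \<in> bihamiltonian_polytope TYPE('n) \<longleftrightarrow>
       (\<exists>a b. L = lam_list n N a b \<and> a 0 = 1 \<and> a N = 0 \<and> (n + 2 = 2 * N \<longrightarrow> b N = 0) \<and>
          (\<forall>k\<in>{1..N}. 0 \<le> \<bar>a k\<bar> \<and> \<bar>a k\<bar> \<le> \<bar>a (k - 1)\<bar> \<and> \<bar>b k\<bar> \<le> \<bar>a (k - 1)\<bar> - \<bar>a k\<bar>))"
    (is "?l \<longleftrightarrow> ?r") for L
  proof
    assume ?l
    then obtain p :: "'n rmat" where M: "p \<in> M_phi" and L: "N_eigenvalue_list p L"
      by (auto simp: bihamiltonian_polytope_def)
    note p = M_phi_facts(1-3)[OF d2 M]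
    have L': "L = plist p"
    proof (rule sorted_list_unique)
      show "sorted_wrt (\<ge>) L" "sorted_wrt (\<ge>) (plist p)"
        using L sorted_plist[OF p(1,2)] by (auto simp: N_eigenvalue_list_def)
      show "count_list L x = count_list (plist p) x" for x
        using L N_eigenvalue_list_plist[OF d M] unfolding N_eigenvalue_list_def by (metis mult_cancel1 zero_neq_numeral)
    qed
    define a where "a k = aa (N - k) p" for k
    \<comment> \<open>In even size the statement requires b_N = 0, although the Pfaffian
      \<open>bb 1 p\<close> of the innermost block is plus or minus a_{N-1}.\<close>
    define b where "b k = (if n + 2 = 2 * N \<and> k = N then 0 else bb (N - k + 1) p)" for k
    have "plist p = lam_list n N a b"
    proof (rule plist[OF p(1)])
      show "\<bar>a k\<bar> = aa (N - k) p" for k by (simp add: a_def)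
      show "b k = bb (N - k + 1) p" if "k \<in> {1..?R}" for k using that N1 by (auto simp: b_def)
    qed
    moreover have "a 0 = 1" "a N = 0" using aa_top[OF p(3)] aa_0[OF p(1)] by (simp_all add: a_def N)
    moreover have "\<bar>a k\<bar> \<le> \<bar>a (k - 1)\<bar> \<and> \<bar>b k\<bar> \<le> \<bar>a (k - 1)\<bar> - \<bar>a k\<bar>" if k: "k \<in> {1..N}" for k
    proof -
      have "Suc (N - k) = N - (k - 1)" "Suc (N - k) \<le> CARD('n) div 2" "N - k + 1 = Suc (N - k)" using k N by auto
      with interlacing[OF _ p(1,2), of "N - k"] have "\<bar>bb (N - k + 1) p\<bar> \<le> a (k - 1) - a k"
        by (simp add: a_def)
      moreover have "0 \<le> a k" "0 \<le> a (k - 1)" by (simp_all add: a_def)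
      ultimately show ?thesis by (auto simp: b_def)
    qed
    ultimately show ?r using L' by (intro exI[of _ a] exI[of _ b]) (auto simp: b_def)
  next
    assume ?r
    then obtain a b where L: "L = lam_list n N a b" and a0: "a 0 = 1" and aN: "a N = 0"
      and ab: "\<And>k. k \<in> {1..N} \<Longrightarrow> \<bar>a k\<bar> \<le> \<bar>a (k - 1)\<bar>" "\<And>k. k \<in> {1..N} \<Longrightarrow> \<bar>b k\<bar> \<le> \<bar>a (k - 1)\<bar> - \<bar>a k\<bar>"
      by blast
    define a' where "a' c = \<bar>a (N - c)\<bar>" for c
    \<comment> \<open>Reverses the indexing and undoes the convention b_N = 0: in even size the
      innermost Pfaffian must have absolute value a_{N-1}, and the positive sign is chosen.\<close>
    define b' where "b' c = (if even CARD('n) \<and> c = 1 then a' 1 else b (N - c + 1))" for c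
    obtain p :: "'n rmat" where M: "p \<in> M_phi" and pa: "\<And>c. c \<le> N \<Longrightarrow> aa c p = a' c"
      and pb: "\<And>c. 1 \<le> c \<Longrightarrow> c \<le> N \<Longrightarrow> bb c p = b' c"
    proof (rule exists_M_phi_with_params[OF d, of a' b'])
      show z: "a' 0 = 0" by (simp add: a'_def aN)
      show "a' (CARD('n) div 2) = 1" by (simp add: a'_def a0 flip: N)
      show "\<bar>b' 1\<bar> = a' 1" if "even CARD('n)" using that by (simp add: b'_def a'_def)
      show "\<bar>b' (Suc c)\<bar> \<le> a' (Suc c) - a' c" if "c < CARD('n) div 2" for c
      proof (cases "even CARD('n) \<and> c = 0")
        case True
        then show ?thesis using z by (simp add: b'_def) (simp add: a'_def)
      next
        case False
        have c: "N - c \<in> {1..N}" "N - c - 1 = N - Suc c" "N - Suc c + 1 = N - c" using that N by auto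
        then show ?thesis using ab(2)[OF c(1)] False by (auto simp: a'_def b'_def)
      qed
    qed (use N in auto)
    note p = M_phi_facts(1-3)[OF d2 M]
    have "plist p = lam_list n N a b"
    proof (rule plist[OF p(1)])
      show "\<bar>a k\<bar> = aa (N - k) p" if "k \<in> {1..N-1}" for k
      proof -
        have "N - (N - k) = k" using that by auto
        then show ?thesis using pa[of "N - k"] by (simp add: a'_def)
      qed
      show "b k = bb (N - k + 1) p" if k: "k \<in> {1..?R}" for k
      proof -
        have "k \<in> {1..N}" using k R by (meson atLeastAtMost_iff le_trans)
        moreover have "\<not> (even CARD('n) \<and> N - k + 1 = 1)" using k ev N1 by auto
        moreover have "N - (N - k + 1) + 1 = k" using \<open>k \<in> {1..N}\<close> by auto
        ultimately show ?thesis using pb[of "N - k + 1"] by (auto simp: b'_def)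
      qed
    qed
    then show ?l using N_eigenvalue_list_plist[OF d M] M L by (auto simp: bihamiltonian_polytope_def)
  qed
  show ?thesis
    using collective_completely_integrable[OF d] N_maximal_rank[OF d] eig poly by blast
qed

end
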